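(* Let $G$ be a connected cubic outerplanar graph (half-edges allowed). Then $G$ is edge-reflexive if and only if $G$ is triangle-free.
   Context: All graphs are finite. A 3-coloring of a graph $X$ is an unordered partition $\{V_1,V_2,V_3\}$ of $V(X)$ into three independent sets (a part may be empty); the $V_i$ are the color classes of the coloring. For a 3-colorable graph $X$, the 3-coloring complex $B(X)$ is the graph whose vertices are all color classes of all 3-colorings of $X$, with two vertices $C\neq D$ joined by an edge if $C$ and $D$ are color classes of a common 3-coloring of $X$. If $X$ is a 3-colorable graph without isolated vertices, then $B(X)$ is 3-colorable and the canonical map $\phi_X(v)=\{C\in V(B(X)) : v\in C\}$, $v\in V(X)$, is a graph homomorphism $X\to B(B(X))$. The graph $X$ is reflexive if $\phi_X$ is an isomorphism. A cubic graph is a graph without loops or parallel edges in which half-edges (edges incident with only one vertex) are allowed, and in which every vertex is incident with exactly three edges (full edges or half-edges). The line graph $L(G)$ of a cubic graph $G$ has as vertices all edges of $G$ (full edges and half-edges), two distinct ones being adjacent if they are incident with a common vertex. A cubic graph $G$ is 3-edge-colorable if $L(G)$ is 3-colorable, and edge-reflexive if it is 3-edge-colorable and $L(G)$ is reflexive. A graph is outerplanar if it has a planar drawing in which all of its vertices lie on the unbounded face. *)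

theory Defs
  imports "HOL-Analysis.Analysis"
begin

section \<open>3-colorings, the 3-coloring complex and reflexive graphs\<close>

text \<open>A simple graph is given by its vertex set and its edge set, each edge being a
  two-element set of vertices.\<close>

record 'a sgraph =
  nodes :: "'a set"
  links :: "'a set set"

definition independent_set :: "'a sgraph \<Rightarrow> 'a set \<Rightarrow> bool" where
  "independent_set X S \<longleftrightarrow>
     S \<subseteq> nodes X \<and> (\<forall>x\<in>S. \<forall>y\<in>S. {x, y} \<notin> links X)"

text \<open>A 3-coloring is the unordered family of its three color classes. Empty classes are allowed;
  if two of them are empty, the set below has fewer than three members.\<close>

definition three_coloring :: "'a sgraph \<Rightarrow> 'a set set \<Rightarrow> bool" where
  "three_coloring X P \<longleftrightarrow>
     (\<exists>V1 V2 V3. P = {V1, V2, V3} \<and>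
        V1 \<union> V2 \<union> V3 = nodes X \<and>
        V1 \<inter> V2 = {} \<and> V1 \<inter> V3 = {} \<and> V2 \<inter> V3 = {} \<and>
        independent_set X V1 \<and> independent_set X V2 \<and> independent_set X V3)"

definition three_colorable :: "'a sgraph \<Rightarrow> bool" where
  "three_colorable X \<longleftrightarrow> (\<exists>P. three_coloring X P)"

definition coloring_complex :: "'a sgraph \<Rightarrow> 'a set sgraph" where
  "coloring_complex X =
     \<lparr> nodes = {C. \<exists>P. three_coloring X P \<and> C \<in> P},
       links = {{C, D} | C D. C \<noteq> D \<and> (\<exists>P. three_coloring X P \<and> C \<in> P \<and> D \<in> P)} \<rparr>"

definition canonical_map :: "'a sgraph \<Rightarrow> 'a \<Rightarrow> 'a set set" where
  "canonical_map X v = {C \<in> nodes (coloring_complex X). v \<in> C}"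

definition graph_isomorphism :: "'a sgraph \<Rightarrow> 'b sgraph \<Rightarrow> ('a \<Rightarrow> 'b) \<Rightarrow> bool" where
  "graph_isomorphism X Y f \<longleftrightarrow>
     bij_betw f (nodes X) (nodes Y) \<and>
     (\<forall>x\<in>nodes X. \<forall>y\<in>nodes X. {x, y} \<in> links X \<longleftrightarrow> {f x, f y} \<in> links Y)"

definition no_isolated_vertices :: "'a sgraph \<Rightarrow> bool" where
  "no_isolated_vertices X \<longleftrightarrow> (\<forall>x\<in>nodes X. \<exists>y\<in>nodes X. {x, y} \<in> links X)"

definition reflexive :: "'a sgraph \<Rightarrow> bool" where
  "reflexive X \<longleftrightarrow>
     three_colorable X \<and> no_isolated_vertices X \<and>
     graph_isomorphism X (coloring_complex (coloring_complex X)) (canonical_map X)"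


section \<open>Cubic graphs with half-edges\<close>

text \<open>Edges are abstract objects, and \<open>ends\<close> gives the set of vertices incident with an edge:
  two vertices for a full edge, one for a half-edge. There is no way to encode a loop.
  Several half-edges may be attached to the same vertex.\<close>

record ('v, 'e) hgraph =
  verts :: "'v set"
  edges :: "'e set"
  ends :: "'e \<Rightarrow> 'v set"

definition half_edge_graph :: "('v, 'e) hgraph \<Rightarrow> bool" where
  "half_edge_graph G \<longleftrightarrow>
     finite (verts G) \<and> finite (edges G) \<and>
     (\<forall>e\<in>edges G. ends G e \<subseteq> verts G \<and> (card (ends G e) = 1 \<or> card (ends G e) = 2)) \<and>
     (\<forall>e\<in>edges G. \<forall>f\<in>edges G. card (ends G e) = 2 \<and> ends G e = ends G f \<longrightarrow> e = f)"

definition cubic_graph :: "('v, 'e) hgraph \<Rightarrow> bool" where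
  "cubic_graph G \<longleftrightarrow>
     half_edge_graph G \<and> (\<forall>v\<in>verts G. card {e \<in> edges G. v \<in> ends G e} = 3)"

definition adjacent :: "('v, 'e) hgraph \<Rightarrow> 'v \<Rightarrow> 'v \<Rightarrow> bool" where
  "adjacent G u v \<longleftrightarrow> u \<noteq> v \<and> (\<exists>e\<in>edges G. ends G e = {u, v})"

definition connected_graph :: "('v, 'e) hgraph \<Rightarrow> bool" where
  "connected_graph G \<longleftrightarrow>
     verts G \<noteq> {} \<and> (\<forall>u\<in>verts G. \<forall>v\<in>verts G. (adjacent G)\<^sup>*\<^sup>* u v)"

definition triangle_free :: "('v, 'e) hgraph \<Rightarrow> bool" where
  "triangle_free G \<longleftrightarrow>
     \<not> (\<exists>u\<in>verts G. \<exists>v\<in>verts G. \<exists>w\<in>verts G.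
          adjacent G u v \<and> adjacent G v w \<and> adjacent G u w)"

definition line_graph :: "('v, 'e) hgraph \<Rightarrow> 'e sgraph" where
  "line_graph G =
     \<lparr> nodes = edges G,
       links = {{e, f} | e f. e \<in> edges G \<and> f \<in> edges G \<and> e \<noteq> f \<and> ends G e \<inter> ends G f \<noteq> {}} \<rparr>"

definition three_edge_colorable :: "('v, 'e) hgraph \<Rightarrow> bool" where
  "three_edge_colorable G \<longleftrightarrow> three_colorable (line_graph G)"

definition edge_reflexive :: "('v, 'e) hgraph \<Rightarrow> bool" where
  "edge_reflexive G \<longleftrightarrow> three_edge_colorable G \<and> reflexive (line_graph G)"


section \<open>Outerplanarity\<close>

text \<open>A planar drawing places the vertices at distinct points \<open>p v\<close> of the plane and draws every
  edge \<open>e\<close> as a simple arc \<open>\<gamma> e\<close>. A full edge joins the points of its two vertices. A half-edge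
  has one end at the point of its vertex; its other end is free, and by the last two
  conditions lies neither on a vertex nor on another edge.\<close>

definition planar_drawing ::
    "('v, 'e) hgraph \<Rightarrow> ('v \<Rightarrow> complex) \<Rightarrow> ('e \<Rightarrow> real \<Rightarrow> complex) \<Rightarrow> bool" where
  "planar_drawing G p \<gamma> \<longleftrightarrow>
     inj_on p (verts G) \<and>
     (\<forall>e\<in>edges G. arc (\<gamma> e) \<and> p ` ends G e \<subseteq> {pathstart (\<gamma> e), pathfinish (\<gamma> e)}) \<and>
     (\<forall>e\<in>edges G. path_image (\<gamma> e) \<inter> p ` verts G \<subseteq> p ` ends G e) \<and>
     (\<forall>e\<in>edges G. \<forall>f\<in>edges G. e \<noteq> f \<longrightarrow>
        path_image (\<gamma> e) \<inter> path_image (\<gamma> f) \<subseteq> p ` (ends G e \<inter> ends G f))"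

definition drawing_image ::
    "('v, 'e) hgraph \<Rightarrow> ('v \<Rightarrow> complex) \<Rightarrow> ('e \<Rightarrow> real \<Rightarrow> complex) \<Rightarrow> complex set" where
  "drawing_image G p \<gamma> = p ` verts G \<union> (\<Union>e\<in>edges G. path_image (\<gamma> e))"

text \<open>For a finite graph the drawing is compact, so \<open>outside\<close> of it is the unique unbounded
  component of its complement, i.e. the unbounded face; a vertex lies on this face if it
  belongs to the boundary of the face.\<close>

definition outerplanar :: "('v, 'e) hgraph \<Rightarrow> bool" where
  "outerplanar G \<longleftrightarrow>
     (\<exists>p \<gamma>. planar_drawing G p \<gamma> \<and>
        p ` verts G \<subseteq> frontier (outside (drawing_image G p \<gamma>)))"

end

(* If u v w is a triangle, then in every 3-edge-coloring the edge v w has the color of the third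
   edge at u, so the canonical map of the line graph is not injective.

   For the converse, call the graph dictatorial if every 3-coloring of the coloring complex of its
   line graph is given by evaluation at some vertex ("dictator") and if pairs and triples of edges
   can be separated by 3-edge-colorings. Dictatorial graphs have reflexive line graphs. A
   connected triangle-free cubic graph without a theta subgraph (three internally disjoint paths,
   all with interior vertices) can be grown from a single vertex by attaching leaves, or ears of at
   least two vertices along an edge: a shortest path that leaves the current vertex set and returns
   to it has adjacent ends, and the absence of thetas preserves this property. Leaves and ears
   preserve dictatoriality. The reason is that there are maps from the new graph to the old one
   that send stars of vertices bijectively to stars; pulling colorings back along them exhibits
   copies of the old coloring complex in the new one, and on each of them a dictator is known by
   induction. Comparing these dictators, by feeding suitable hybrid colorings of the old complex
   to the induction hypothesis, determines the coloring everywhere.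

   A theta in an outerplanar drawing would give three arcs with common ends, each with a
   point on the outer face, which contradicts Janiszewski's theorem. *)
theory Submission
  imports Defs
begin

section \<open>Outerplanar drawings contain no theta graph\<close>

text \<open>A dictator on each pulled back copy leaves two questions open: whether the dictators of
  different copies fit together, and which labels occur on colorings that are not pulled back. The
  first is settled by half-edges: two dictatorial labellings that agree on the classes of one
  half-edge agree everywhere, unless the claw at that half-edge rules both. Separation of triples
  enters here, so it has to be carried through the induction. For the second, Kempe changes of old
  colorings, along a chain of three edges ending in two half-edges, relate the copies and the
  exceptional colorings to each other. All this is done for abstract systems of claws, because a
  long ear is obtained from one with two vertices by repeatedly splitting its first vertex, and the
  claws of the intermediate systems need not be stars of vertices of \<open>G\<close>. Ears with one
  vertex do not occur: their ends would be adjacent, which closes a triangle.\<close>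

lemma three_arcs_not_all_on_outer_face:
  fixes c1 c2 c3 :: "real \<Rightarrow> complex"
  assumes arcs: "arc c1" "arc c2" "arc c3"
    and starts: "pathstart c1 = a" "pathstart c2 = a" "pathstart c3 = a"
    and finishes: "pathfinish c1 = b" "pathfinish c2 = b" "pathfinish c3 = b"
    and inter: "path_image c1 \<inter> path_image c2 = {a, b}" "path_image c1 \<inter> path_image c3 = {a, b}"
      "path_image c2 \<inter> path_image c3 = {a, b}"
    and x: "x1 \<in> path_image c1 - {a, b}" "x2 \<in> path_image c2 - {a, b}" "x3 \<in> path_image c3 - {a, b}"
    and S: "path_image c1 \<union> path_image c2 \<union> path_image c3 \<subseteq> S"
    and face: "{x1, x2, x3} \<subseteq> closure (outside S)"
  shows False
proof -
  define A B C where "A = path_image c1" and "B = path_image c2" and "C = path_image c3"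
  note ABC = A_def B_def C_def
  have cpt: "compact A" "compact B" "compact C"
    using arcs by (auto simp: ABC compact_arc_image)
  have conn: "connected (A - {a, b})" "connected (B - {a, b})" "connected (C - {a, b})"
    using arcs starts finishes connected_simple_path_endless arc_imp_simple_path
    unfolding ABC by metis+
  have loops: "simple_path (c1 +++ reversepath c2)" "simple_path (c1 +++ reversepath c3)"
      "simple_path (c2 +++ reversepath c3)"
    using arcs starts finishes inter by (auto intro!: simple_path_join_loop arc_reversepath)
  have im: "path_image (c1 +++ reversepath c2) = A \<union> B" "path_image (c1 +++ reversepath c3) = A \<union> C"
      "path_image (c2 +++ reversepath c3) = B \<union> C"
    using starts finishes by (auto simp: ABC path_image_join)
  note J12 = Jordan_inside_outside[OF loops(1), unfolded im] and J13 = Jordan_inside_outside[OF loops(2), unfolded im]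
    and J23 = Jordan_inside_outside[OF loops(3), unfolded im]
  have in12: "open (inside (A \<union> B))" "connected (inside (A \<union> B))" "frontier (inside (A \<union> B)) = A \<union> B"
    and out12: "connected (outside (A \<union> B))" "inside (A \<union> B) \<inter> outside (A \<union> B) = {}"
      "inside (A \<union> B) \<union> outside (A \<union> B) = - (A \<union> B)"
    using J12 starts finishes by auto
  have in13: "open (inside (A \<union> C))" "connected (inside (A \<union> C))" "frontier (inside (A \<union> C)) = A \<union> C"
    "inside (A \<union> C) \<noteq> {}" "inside (A \<union> C) \<inter> outside (A \<union> C) = {}"
    using J13 starts finishes by auto
  have in23: "open (inside (B \<union> C))" "connected (inside (B \<union> C))" "frontier (inside (B \<union> C)) = B \<union> C"
    and out23: "connected (outside (B \<union> C))" "inside (B \<union> C) \<union> outside (B \<union> C) = - (B \<union> C)"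
    using J23 starts finishes by auto
  \<comment> \<open>\<open>inside U\<close> is open and, as \<open>U\<close> lies in
    \<open>S\<close>, disjoint from \<open>outside S\<close>; so it contains no point of the closure
    of \<open>outside S\<close>. One such point \<open>y\<close> therefore keeps the whole connected
    set \<open>T\<close> out of \<open>inside U\<close>. This is applied to each arc without its
    ends and the Jordan curve formed by the other two.\<close>
  have key: "T \<inter> inside U = {}" if "connected T" "T \<inter> U = {}" "U \<subseteq> S" "open (inside U)" 
      "y \<in> T" "y \<in> closure (outside S)" for T U y
  proof (rule ccontr)
    assume ne: "T \<inter> inside U \<noteq> {}"
    have "y \<in> inside U"
    proof (rule ccontr)
      assume "y \<notin> inside U"
      then have "y \<in> outside U" using that by (auto simp: outside_inside)
      then show False using inside_outside_intersect_connected[of T U] ne that by auto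
    qed
    then have "outside S \<inter> inside U \<noteq> {}"
      using that by (metis closure_iff_nhds_not_empty disjoint_iff open_Int_closure_eq_empty)
    then show False
      using outside_mono[OF \<open>U \<subseteq> S\<close>] inside_Int_outside[of U] by blast
  qed
  have C_out: "(C - {a, b}) \<inter> inside (A \<union> B) = {}"
    using conn inter x S face in12 unfolding ABC by (intro key[of _ _ x3]) auto
  have B_out: "(B - {a, b}) \<inter> inside (A \<union> C) = {}"
    using conn inter x S face in13 unfolding ABC by (intro key[of _ _ x2]) auto
  have A_out: "(A - {a, b}) \<inter> inside (B \<union> C) = {}"
    using conn inter x S face in23 unfolding ABC by (intro key[of _ _ x1]) auto
  have ab: "a \<in> A" "a \<in> B" "a \<in> C" "b \<in> A" "b \<in> B" "b \<in> C"
    using inter unfolding ABC by auto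
  have xs: "x1 \<in> A" "x1 \<notin> B" "x1 \<notin> C" "x2 \<in> B" "x2 \<notin> A" "x2 \<notin> C" "x3 \<in> C" "x3 \<notin> A" "x3 \<notin> B"
    using x inter unfolding ABC by auto
  have inS: "inside U \<inter> U = {}" for U :: "complex set" by (simp add: inside_no_overlap)
  have B_out': "B \<inter> inside (A \<union> C) = {}" using B_out inS[of "A \<union> C"] ab by blast
  have C_out': "C \<inter> inside (A \<union> B) = {}" using C_out inS[of "A \<union> B"] ab by blast
  have A_out': "A \<inter> inside (B \<union> C) = {}" using A_out inS[of "B \<union> C"] ab by blast
  obtain z where z: "z \<in> inside (A \<union> C)" using in13 by auto
  have sub: "inside U \<subseteq> inside V"
    if "connected (inside U)" "V \<inter> inside U = {}" "w \<in> inside U" "w \<in> inside V" for U V and w :: complex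
  proof
    fix y assume "y \<in> inside U"
    then have "connected_component (- V) w y"
      using that by (auto simp: connected_component_def intro!: exI[of _ "inside U"])
    then show "y \<in> inside V" using inside_same_component that by blast
  qed
  have disj: "(A \<union> B) \<inter> inside (A \<union> C) = {}" "(A \<union> C) \<inter> inside (A \<union> B) = {}"
      "(B \<union> C) \<inter> inside (A \<union> C) = {}" "(A \<union> C) \<inter> inside (B \<union> C) = {}"
    using A_out' B_out' C_out' inS[of "A \<union> B"] inS[of "A \<union> C"] inS[of "B \<union> C"] by blast+
  \<comment> \<open>Each of the two insides is connected and misses the other curve, so a common
    point would make them equal. But the frontier of the inside is the curve itself, and the curves
    differ.\<close>
  have "z \<notin> inside (A \<union> B)"
  proof
    assume zi: "z \<in> inside (A \<union> B)"
    have "inside (A \<union> C) = inside (A \<union> B)"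
      using sub[OF in13(2) disj(1) z zi] sub[OF in12(2) disj(2) zi z] by (rule equalityI)
    then have "A \<union> B = A \<union> C" using in12(3) in13(3) by simp
    then show False using xs by blast
  qed
  then have z12: "z \<in> outside (A \<union> B)" using z disj(1) unfolding outside_inside by blast
  have "z \<notin> inside (B \<union> C)"
  proof
    assume zi: "z \<in> inside (B \<union> C)"
    have "inside (A \<union> C) = inside (B \<union> C)"
      using sub[OF in13(2) disj(3) z zi] sub[OF in23(2) disj(4) zi z] by (rule equalityI)
    then have "B \<union> C = A \<union> C" using in23(3) in13(3) by simp
    then show False using xs by blast
  qed
  then have z23: "z \<in> outside (B \<union> C)" using z disj(3) unfolding outside_inside by blast
  obtain y where y: "y \<in> outside (A \<union> B \<union> C)"
    using cpt by (metis all_not_in_conv bounded_Un compact_imp_bounded outside_bounded_nonempty)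
  have y': "y \<in> outside (A \<union> B)" "y \<in> outside (B \<union> C)" "y \<in> outside (A \<union> C)"
    using y outside_mono[of "A \<union> B" "A \<union> B \<union> C"] outside_mono[of "B \<union> C" "A \<union> B \<union> C"]
      outside_mono[of "A \<union> C" "A \<union> B \<union> C"] by auto
  have cc: "connected_component (- U) z y" if "connected (outside U)" "z \<in> outside U" "y \<in> outside U" for U
    using that outside_no_overlap[of U] unfolding connected_component_def
    by (intro exI[of _ "outside U"]) blast
  \<comment> \<open>Neither \<open>A \<union> B\<close> nor \<open>B \<union> C\<close> separates \<open>z\<close> from \<open>y\<close>, and these two sets meet in the connected
    set \<open>B\<close>, so their union does not separate them either, although \<open>A \<union> C\<close> does.\<close>
  have "connected B" using arcs by (simp add: B_def connected_arc_image)
  moreover have "(A \<union> B) \<inter> (B \<union> C) = B" using inter ab unfolding ABC by auto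
  ultimately have "connected_component (- ((A \<union> B) \<union> (B \<union> C))) z y"
    using cpt cc[OF out12(1) z12 y'(1)] cc[OF out23(1) z23 y'(2)]
    by (intro Janiszewski[of "A \<union> B" "B \<union> C"]) (simp_all add: compact_Un compact_imp_closed closed_Un)
  then have "connected_component (- (A \<union> C)) z y"
    by (rule connected_component_of_subset) auto
  then have "y \<in> inside (A \<union> C)" using inside_same_component z by blast
  then show False using y'(3) in13(5) by blast
qed

lemma adjacentD:
  assumes "half_edge_graph G" "adjacent G u v"
  shows "u \<in> verts G" "v \<in> verts G" "u \<noteq> v" "adjacent G v u"
  using assms unfolding half_edge_graph_def adjacent_def by (auto simp: insert_commute)

lemma planar_drawing_Int:
  assumes "planar_drawing G p \<gamma>" "e \<in> edges G" "f \<in> edges G" "e \<noteq> f"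
    "y \<in> path_image (\<gamma> e)" "y \<in> path_image (\<gamma> f)"
  shows "y \<in> p ` (ends G e \<inter> ends G f)"
  using assms unfolding planar_drawing_def by (meson IntI subsetD)

lemma drawn_edge:
  assumes "planar_drawing G p \<gamma>" "e \<in> edges G" "ends G e = {u, v}" "p u \<noteq> p v"
  obtains g where "arc g" "pathstart g = p u" "pathfinish g = p v" "path_image g = path_image (\<gamma> e)"
proof -
  have "arc (\<gamma> e) \<and> p ` ends G e \<subseteq> {pathstart (\<gamma> e), pathfinish (\<gamma> e)}"
    using assms(1,2) unfolding planar_drawing_def by meson
  then have "arc (\<gamma> e)" "{p u, p v} \<subseteq> {pathstart (\<gamma> e), pathfinish (\<gamma> e)}"
    by (simp_all add: assms(3))
  then consider "pathstart (\<gamma> e) = p u" "pathfinish (\<gamma> e) = p v"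
    | "pathstart (\<gamma> e) = p v" "pathfinish (\<gamma> e) = p u"
    using assms(4) by (metis empty_iff insert_iff insert_subset)
  then show thesis
  proof cases
    case 1
    then show ?thesis using that \<open>arc (\<gamma> e)\<close> by blast
  next
    case 2
    then show ?thesis using that[of "reversepath (\<gamma> e)"] \<open>arc (\<gamma> e)\<close> by (simp add: arc_reversepath)
  qed
qed

text \<open>Besides the arc, the edges that it may use are bounded. For a path with interior
  vertices the edge joining the ends is excluded; otherwise two paths with the same ends could not
  be seen to use different edges.\<close>

lemma drawn_path:
  assumes G: "half_edge_graph G" and pl: "planar_drawing G p \<gamma>"
    and "distinct (a # xs @ [b])" "successively (adjacent G) (a # xs @ [b])"
  shows "\<exists>g. arc g \<and> pathstart g = p a \<and> pathfinish g = p b \<and> p ` set xs \<subseteq> path_image g \<and>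
    path_image g \<subseteq> (\<Union>e\<in>{e \<in> edges G. card (ends G e) = 2 \<and> ends G e \<subseteq> set (a # xs @ [b]) \<and>
      (xs \<noteq> [] \<longrightarrow> ends G e \<noteq> {a, b})}. path_image (\<gamma> e))"
  using assms(3,4)
proof (induction xs arbitrary: a)
  case Nil
  then have "adjacent G a b" by simp
  then obtain e where e: "e \<in> edges G" "ends G e = {a, b}" "a \<noteq> b" unfolding adjacent_def by auto
  have "p a \<noteq> p b"
    using pl e adjacentD[OF G \<open>adjacent G a b\<close>] unfolding planar_drawing_def inj_on_def by auto
  then obtain g where "arc g" "pathstart g = p a" "pathfinish g = p b" "path_image g = path_image (\<gamma> e)"
    using drawn_edge[OF pl e(1,2)] by metis
  then show ?case using e by (intro exI[of _ g]) auto
next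
  case (Cons x xs)
  have ax: "adjacent G a x" using Cons.prems by simp
  then obtain e where e: "e \<in> edges G" "ends G e = {a, x}" "a \<noteq> x" unfolding adjacent_def by auto
  have "p a \<noteq> p x"
    using pl e adjacentD[OF G ax] unfolding planar_drawing_def inj_on_def by auto
  then obtain g1 where g1: "arc g1" "pathstart g1 = p a" "pathfinish g1 = p x" "path_image g1 = path_image (\<gamma> e)"
    using drawn_edge[OF pl e(1,2)] by metis
  obtain g2 where g2: "arc g2" "pathstart g2 = p x" "pathfinish g2 = p b" "p ` set xs \<subseteq> path_image g2"
    "path_image g2 \<subseteq> (\<Union>e\<in>{e \<in> edges G. card (ends G e) = 2 \<and> ends G e \<subseteq> set (x # xs @ [b])}. path_image (\<gamma> e))"
    using Cons.IH[of x] Cons.prems by fastforce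
  have "path_image g1 \<inter> path_image g2 \<subseteq> {p x}"
  proof
    fix y assume y: "y \<in> path_image g1 \<inter> path_image g2"
    then obtain f where f: "f \<in> edges G" "ends G f \<subseteq> set (x # xs @ [b])" "y \<in> path_image (\<gamma> f)"
      using g2 by blast
    then have "f \<noteq> e" using e Cons.prems by auto
    then have "y \<in> p ` (ends G e \<inter> ends G f)"
      using planar_drawing_Int[OF pl e(1) f(1)] f y g1 by auto
    then show "y \<in> {p x}" using f e Cons.prems by auto
  qed
  then have arc: "arc (g1 +++ g2)" using g1 g2 by (intro arc_join) auto
  have im: "path_image (g1 +++ g2) = path_image (\<gamma> e) \<union> path_image g2"
    using g1 g2 by (simp add: path_image_join)
  have "p x \<in> path_image g2" using g2 pathstart_in_path_image by metis
  then have xs: "p ` set (x # xs) \<subseteq> path_image (g1 +++ g2)" using g2(4) unfolding im by auto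
  have "path_image g2 \<subseteq> (\<Union>e\<in>{e \<in> edges G. card (ends G e) = 2 \<and> ends G e \<subseteq> set (a # (x # xs) @ [b]) \<and>
      (x # xs \<noteq> [] \<longrightarrow> ends G e \<noteq> {a, b})}. path_image (\<gamma> e))"
    by (rule order_trans[OF g2(5)]) (rule UN_mono, use Cons.prems in auto)
  moreover have "path_image (\<gamma> e) \<subseteq> (\<Union>e\<in>{e \<in> edges G. card (ends G e) = 2 \<and> ends G e \<subseteq> set (a # (x # xs) @ [b]) \<and>
      (x # xs \<noteq> [] \<longrightarrow> ends G e \<noteq> {a, b})}. path_image (\<gamma> e))"
    by (rule UN_upper) (use e Cons.prems in \<open>auto simp: doubleton_eq_iff\<close>)
  ultimately have sub: "path_image (g1 +++ g2) \<subseteq> (\<Union>e\<in>{e \<in> edges G. card (ends G e) = 2 \<and>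
      ends G e \<subseteq> set (a # (x # xs) @ [b]) \<and> (x # xs \<noteq> [] \<longrightarrow> ends G e \<noteq> {a, b})}. path_image (\<gamma> e))"
    unfolding im by (rule Un_least[rotated])
  have "pathstart (g1 +++ g2) = p a" "pathfinish (g1 +++ g2) = p b" using g1 g2 by simp_all
  then show ?case using arc xs sub by (intro exI[of _ "g1 +++ g2"] conjI)
qed

text \<open>Because all three paths have interior vertices, a cycle with a chord is not a theta;
  outerplanar graphs may well contain those.\<close>

definition theta_free :: "('v, 'e) hgraph \<Rightarrow> bool" where
  "theta_free G \<longleftrightarrow> \<not> (\<exists>a b xs ys zs. xs \<noteq> [] \<and> ys \<noteq> [] \<and> zs \<noteq> [] \<and> distinct (a # b # xs @ ys @ zs) \<and>
     successively (adjacent G) (a # xs @ [b]) \<and> successively (adjacent G) (a # ys @ [b]) \<and>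
     successively (adjacent G) (a # zs @ [b]))"

lemma successively_adjacent_verts:
  assumes "half_edge_graph G" "successively (adjacent G) xs" "length xs \<ge> 2"
  shows "set xs \<subseteq> verts G"
  using assms(2,3)
proof (induction "adjacent G" xs rule: successively.induct)
  case (3 x y xs)
  then show ?case using adjacentD[OF assms(1), of x y] by (cases xs) auto
qed auto

lemma outerplanar_theta_free:
  assumes G: "half_edge_graph G" and "outerplanar G"
  shows "theta_free G"
  unfolding theta_free_def
proof (rule notI, elim exE conjE)
  fix a b xs ys zs
  assume ne: "xs \<noteq> []" "ys \<noteq> []" "zs \<noteq> []" and dist: "distinct (a # b # xs @ ys @ zs)"
    and suc: "successively (adjacent G) (a # xs @ [b])" "successively (adjacent G) (a # ys @ [b])"
     "successively (adjacent G) (a # zs @ [b])"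
  obtain p \<gamma> where pl: "planar_drawing G p \<gamma>"
    and fr: "p ` verts G \<subseteq> frontier (outside (drawing_image G p \<gamma>))"
    using assms(2) unfolding outerplanar_def by blast
  define I where "I = (\<lambda>ws. \<Union>e\<in>{e \<in> edges G. card (ends G e) = 2 \<and> ends G e \<subseteq> set (a # ws @ [b]) \<and>
      ends G e \<noteq> {a, b}}. path_image (\<gamma> e))"
  have ex: "\<exists>g. arc g \<and> pathstart g = p a \<and> pathfinish g = p b \<and> p ` set ws \<subseteq> path_image g \<and> path_image g \<subseteq> I ws"
    if "ws \<noteq> []" "distinct (a # b # ws)" "successively (adjacent G) (a # ws @ [b])" for ws
    using drawn_path[OF G pl, of a ws b] that unfolding I_def by auto
  obtain c1 where c1: "arc c1" "pathstart c1 = p a" "pathfinish c1 = p b" "p ` set xs \<subseteq> path_image c1" "path_image c1 \<subseteq> I xs"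
    using ex[of xs] ne dist suc by auto
  obtain c2 where c2: "arc c2" "pathstart c2 = p a" "pathfinish c2 = p b" "p ` set ys \<subseteq> path_image c2" "path_image c2 \<subseteq> I ys"
    using ex[of ys] ne dist suc by auto
  obtain c3 where c3: "arc c3" "pathstart c3 = p a" "pathfinish c3 = p b" "p ` set zs \<subseteq> path_image c3" "path_image c3 \<subseteq> I zs"
    using ex[of zs] ne dist suc by auto
  have int: "path_image g \<inter> path_image h = {p a, p b}"
    if "set us \<inter> set vs = {}" "path_image g \<subseteq> I us" "path_image h \<subseteq> I vs"
      "pathstart g = p a" "pathfinish g = p b" "pathstart h = p a" "pathfinish h = p b" for us vs g h
  proof
    show "{p a, p b} \<subseteq> path_image g \<inter> path_image h"
      using that pathstart_in_path_image[of g] pathfinish_in_path_image[of g]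
        pathstart_in_path_image[of h] pathfinish_in_path_image[of h] by auto
    show "path_image g \<inter> path_image h \<subseteq> {p a, p b}"
    proof
      fix y assume "y \<in> path_image g \<inter> path_image h"
      then have "y \<in> I us" "y \<in> I vs" using that(2,3) by blast+
      then obtain e f where e: "e \<in> edges G" "card (ends G e) = 2" "ends G e \<subseteq> set (a # us @ [b])" "ends G e \<noteq> {a, b}" "y \<in> path_image (\<gamma> e)"
        and f: "f \<in> edges G" "card (ends G f) = 2" "ends G f \<subseteq> set (a # vs @ [b])" "y \<in> path_image (\<gamma> f)"
        unfolding I_def by fast
      have "e \<noteq> f"
      proof
        assume "e = f"
        then have "ends G e \<subseteq> {a, b}" using e(3) f(3) that(1) by auto
        then have "ends G e = {a, b}" using e(2) dist by (intro card_seteq) auto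
        then show False using e(4) by simp
      qed
      then have "y \<in> p ` (ends G e \<inter> ends G f)"
        using planar_drawing_Int[OF pl e(1) f(1)] e f by auto
      then show "y \<in> {p a, p b}" using e(3) f(3) that(1) by auto
    qed
  qed
  obtain x y z where xyz: "x \<in> set xs" "y \<in> set ys" "z \<in> set zs" using ne by (meson hd_in_set)
  have V: "set (a # xs @ [b]) \<subseteq> verts G" "set ys \<subseteq> verts G" "set zs \<subseteq> verts G"
    using successively_adjacent_verts[OF G suc(1)] successively_adjacent_verts[OF G suc(2)]
      successively_adjacent_verts[OF G suc(3)] by auto
  have inj: "p u = p v \<longleftrightarrow> u = v" if "u \<in> verts G" "v \<in> verts G" for u v
    using pl that unfolding planar_drawing_def inj_on_def by auto
  have xyzV: "{x, y, z} \<subseteq> verts G" "{a, b} \<subseteq> verts G" "{x, y, z} \<inter> {a, b} = {}"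
    using V xyz dist by auto
  with xyzV(1) have neq: "p x \<noteq> p a" "p x \<noteq> p b" "p y \<noteq> p a" "p y \<noteq> p b" "p z \<noteq> p a" "p z \<noteq> p b"
    by (auto simp: inj)
  have mem: "p x \<in> path_image c1 - {p a, p b}" "p y \<in> path_image c2 - {p a, p b}" "p z \<in> path_image c3 - {p a, p b}"
    using c1(4) c2(4) c3(4) xyz neq by blast+
  have I: "I ws \<subseteq> (\<Union>e\<in>edges G. path_image (\<gamma> e))" for ws
    unfolding I_def by (rule UN_mono) auto
  have sub: "path_image c1 \<union> path_image c2 \<union> path_image c3 \<subseteq> drawing_image G p \<gamma>"
    using order_trans[OF c1(5) I] order_trans[OF c2(5) I] order_trans[OF c3(5) I]
    unfolding drawing_image_def by blast
  have cl: "{p x, p y, p z} \<subseteq> closure (outside (drawing_image G p \<gamma>))"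
    using fr xyzV(1) unfolding frontier_def by blast
  show False
    by (rule three_arcs_not_all_on_outer_face[OF c1(1) c2(1) c3(1) c1(2) c2(2) c3(2) c1(3) c2(3) c3(3)
          int[OF _ c1(5) c2(5) c1(2,3) c2(2,3)] int[OF _ c1(5) c3(5) c1(2,3) c3(2,3)]
          int[OF _ c2(5) c3(5) c2(2,3) c3(2,3)] mem sub cl]) (use dist in auto)
qed


section \<open>Colorings of systems of claws\<close>

datatype color = Red | Green | Blue

lemma color_exhausted:
  fixes w x y z :: color
  assumes "x \<noteq> y" "x \<noteq> z" "y \<noteq> z"
  shows "w = x \<or> w = y \<or> w = z"
  using assms by (cases w; cases x; cases y; cases z) auto

lemma color_avoiding: "\<exists>z :: color. z \<noteq> x \<and> z \<noteq> y"
  by (cases x; cases y) auto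

lemma color_third_unique:
  fixes x y z w :: color
  assumes "x \<noteq> y" "z \<noteq> x" "z \<noteq> y" "w \<noteq> x" "w \<noteq> y"
  shows "w = z"
  using assms by (cases w; cases x; cases y; cases z) auto

text \<open>Two triples of distinct colors with a common first entry differ at most by exchanging
  the other two entries. Every \<open>eq_iff\<close> below comes from this.\<close>

lemma color_swap:
  fixes a b c b' c' :: color
  assumes "a \<noteq> b" "a \<noteq> c" "b \<noteq> c" "a \<noteq> b'" "a \<noteq> c'" "b' \<noteq> c'"
  shows "b = b' \<longleftrightarrow> c = c'"
  using assms by (cases a; cases b; cases c; cases b'; cases c') simp_all

lemma color_pair:
  fixes a b c b' c' :: color
  assumes "a \<noteq> b" "a \<noteq> c" "b \<noteq> c" "a \<noteq> b'" "a \<noteq> c'" "b' \<noteq> c'"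
  shows "b' = b \<and> c' = c \<or> b' = c \<and> c' = b"
  using assms by (cases a; cases b; cases c; cases b'; cases c') simp_all

text \<open>Exactly two, not at least two: the equations derived in
  \<open>half_edge_determines_evaluation\<close> tolerate three equal colors, but not exactly
  two.\<close>

definition two_equal :: "color \<Rightarrow> color \<Rightarrow> color \<Rightarrow> bool" where
  "two_equal x y z \<longleftrightarrow> x = y \<and> y \<noteq> z \<or> x = z \<and> x \<noteq> y \<or> y = z \<and> x \<noteq> y"

text \<open>A cubic graph is represented by the set \<open>V\<close> of its claws, the triples of edges at its vertices.
  A coloring of the coloring complex of the line graph is a labelling \<open>F\<close> of the color classes
  that is \<open>valid\<close>; it is a dictatorship of the claw \<open>K\<close> if the label of a class depends only on the
  edge of \<open>K\<close> that the class contains.\<close>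

definition proper :: "'e set set \<Rightarrow> ('e \<Rightarrow> color) \<Rightarrow> bool" where
  "proper V c \<longleftrightarrow> (\<forall>K\<in>V. inj_on c K)"

definition cls :: "'e set set \<Rightarrow> ('e \<Rightarrow> color) \<Rightarrow> color \<Rightarrow> 'e set" where
  "cls V c i = {e \<in> \<Union>V. c e = i}"

definition valid :: "'e set set \<Rightarrow> ('e set \<Rightarrow> color) \<Rightarrow> bool" where
  "valid V F \<longleftrightarrow> (\<forall>c. proper V c \<longrightarrow> inj (\<lambda>i. F (cls V c i)))"

definition evaluates :: "'e set set \<Rightarrow> ('e set \<Rightarrow> color) \<Rightarrow> 'e set \<Rightarrow> ('e \<Rightarrow> color) \<Rightarrow> bool" where
  "evaluates V F K g \<longleftrightarrow> (\<forall>c. proper V c \<longrightarrow> (\<forall>e\<in>K. F (cls V c (c e)) = g e))"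

text \<open>The first separation clause makes the canonical map injective, and the last clause
  leaves no colorings of the complex but the expected ones. The clauses on equal pairs and on
  triples serve the induction: the former provides colorings that coincide on two half-edges, the
  latter characterizes claws as the triples that never receive exactly two colors.\<close>

definition dictatorial :: "'e set set \<Rightarrow> bool" where
  "dictatorial V \<longleftrightarrow>
     (\<forall>K\<in>V. card K = 3) \<and> (\<exists>c. proper V c) \<and>
     (\<forall>e\<in>\<Union>V. \<forall>f\<in>\<Union>V. e \<noteq> f \<longrightarrow> (\<exists>c. proper V c \<and> c e \<noteq> c f)) \<and>
     (\<forall>e\<in>\<Union>V. \<forall>f\<in>\<Union>V. (\<forall>K\<in>V. e \<notin> K \<or> f \<notin> K) \<longrightarrow> (\<exists>c. proper V c \<and> c e = c f)) \<and>
     (\<forall>e\<in>\<Union>V. \<forall>f\<in>\<Union>V. \<forall>g\<in>\<Union>V. distinct [e, f, g] \<and> {e, f, g} \<notin> V \<longrightarrow>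
        (\<exists>c. proper V c \<and> two_equal (c e) (c f) (c g))) \<and>
     (\<forall>F. valid V F \<longrightarrow> (\<exists>K\<in>V. \<exists>g. evaluates V F K g))"

lemma dictatorialI:
  assumes "\<And>K. K \<in> V \<Longrightarrow> card K = 3" "\<exists>c. proper V c"
    "\<And>e f. e \<in> \<Union>V \<Longrightarrow> f \<in> \<Union>V \<Longrightarrow> e \<noteq> f \<Longrightarrow> \<exists>c. proper V c \<and> c e \<noteq> c f"
    "\<And>e f. e \<in> \<Union>V \<Longrightarrow> f \<in> \<Union>V \<Longrightarrow> (\<And>K. K \<in> V \<Longrightarrow> e \<in> K \<Longrightarrow> f \<notin> K) \<Longrightarrow> \<exists>c. proper V c \<and> c e = c f"
    "\<And>e f g. e \<in> \<Union>V \<Longrightarrow> f \<in> \<Union>V \<Longrightarrow> g \<in> \<Union>V \<Longrightarrow> distinct [e, f, g] \<Longrightarrow> {e, f, g} \<notin> V \<Longrightarrow>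
        \<exists>c. proper V c \<and> two_equal (c e) (c f) (c g)"
    "\<And>F. valid V F \<Longrightarrow> \<exists>K\<in>V. \<exists>g. evaluates V F K g"
  shows "dictatorial V"
  unfolding dictatorial_def by (intro conjI ballI impI allI; (elim conjE)?; rule assms; blast)

lemma
  assumes "dictatorial V"
  shows dictatorial_card: "\<And>K. K \<in> V \<Longrightarrow> card K = 3"
    and dictatorial_ex: "\<exists>c. proper V c"
    and dictatorial_sep: "\<And>e f. e \<in> \<Union>V \<Longrightarrow> f \<in> \<Union>V \<Longrightarrow> e \<noteq> f \<Longrightarrow> \<exists>c. proper V c \<and> c e \<noteq> c f"
    and dictatorial_join: "\<And>e f. e \<in> \<Union>V \<Longrightarrow> f \<in> \<Union>V \<Longrightarrow> (\<And>K. K \<in> V \<Longrightarrow> e \<in> K \<Longrightarrow> f \<notin> K) \<Longrightarrow>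
      \<exists>c. proper V c \<and> c e = c f"
    and dictatorial_triple: "\<And>e f g. e \<in> \<Union>V \<Longrightarrow> f \<in> \<Union>V \<Longrightarrow> g \<in> \<Union>V \<Longrightarrow> distinct [e, f, g] \<Longrightarrow>
      {e, f, g} \<notin> V \<Longrightarrow> \<exists>c. proper V c \<and> two_equal (c e) (c f) (c g)"
    and dictatorial_dict: "\<And>F. valid V F \<Longrightarrow> \<exists>K\<in>V. \<exists>g. evaluates V F K g"
proof -
  note d = assms[unfolded dictatorial_def]
  note d1 = conjunct1[OF d] conjunct2[OF d]
  note d2 = conjunct1[OF d1(2)] conjunct2[OF d1(2)]
  note d3 = conjunct1[OF d2(2)] conjunct2[OF d2(2)]
  note d4 = conjunct1[OF d3(2)] conjunct2[OF d3(2)]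
  note d5 = conjunct1[OF d4(2)] conjunct2[OF d4(2)]
  show "\<And>K. K \<in> V \<Longrightarrow> card K = 3" by (rule d1(1)[rule_format])
  show "\<exists>c. proper V c" by (rule d2(1))
  show "\<And>e f. e \<in> \<Union>V \<Longrightarrow> f \<in> \<Union>V \<Longrightarrow> e \<noteq> f \<Longrightarrow> \<exists>c. proper V c \<and> c e \<noteq> c f"
    by (rule d3(1)[rule_format])
  show "\<And>e f. e \<in> \<Union>V \<Longrightarrow> f \<in> \<Union>V \<Longrightarrow> (\<And>K. K \<in> V \<Longrightarrow> e \<in> K \<Longrightarrow> f \<notin> K) \<Longrightarrow>
      \<exists>c. proper V c \<and> c e = c f"
    by (rule d4(1)[rule_format]) blast+
  show "\<And>e f g. e \<in> \<Union>V \<Longrightarrow> f \<in> \<Union>V \<Longrightarrow> g \<in> \<Union>V \<Longrightarrow> distinct [e, f, g] \<Longrightarrow>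
      {e, f, g} \<notin> V \<Longrightarrow> \<exists>c. proper V c \<and> two_equal (c e) (c f) (c g)"
    by (rule d5(1)[rule_format]) (assumption+, rule conjI)
  show "\<And>F. valid V F \<Longrightarrow> \<exists>K\<in>V. \<exists>g. evaluates V F K g"
    by (rule d5(2)[rule_format])
qed

lemma validD: "valid V F \<Longrightarrow> proper V c \<Longrightarrow> F (cls V c i) = F (cls V c j) \<longleftrightarrow> i = j"
  unfolding valid_def inj_def by blast

lemma evaluatesD: "evaluates V F K g \<Longrightarrow> proper V c \<Longrightarrow> e \<in> K \<Longrightarrow> F (cls V c (c e)) = g e"
  unfolding evaluates_def by blast

lemma inj_on_triple:
  "distinct [x, y, z] \<Longrightarrow> inj_on c {x, y, z} \<longleftrightarrow> c x \<noteq> c y \<and> c x \<noteq> c z \<and> c y \<noteq> c z"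
  by auto

lemma triple_containingE:
  assumes "card T = 3" "x \<in> T"
  obtains y z where "T = {x, y, z}" "distinct [x, y, z]"
proof -
  obtain a b c where "T = {a, b, c}" "distinct [a, b, c]" using assms(1) by (auto simp: card_3_iff)
  then show thesis using assms(2) that[of b c] that[of a c] that[of a b] by auto
qed

lemma proper_insert: "proper (insert K V) c \<longleftrightarrow> inj_on c K \<and> proper V c"
  by (simp add: proper_def)

lemma proper_cong: "(\<And>e. e \<in> \<Union>V \<Longrightarrow> c e = c' e) \<Longrightarrow> proper V c \<longleftrightarrow> proper V c'"
  unfolding proper_def by (metis UnionI inj_on_cong)

lemma cls_cong: "(\<And>e. e \<in> \<Union>V \<Longrightarrow> c e = c' e) \<Longrightarrow> cls V c i = cls V c' i"
  unfolding cls_def by (intro Collect_cong) metis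

lemma inj_on_claw_surj:
  fixes c :: "'e \<Rightarrow> color"
  assumes "inj_on c K" "card K = 3"
  shows "\<exists>e\<in>K. c e = i"
proof -
  obtain x y z where "K = {x, y, z}" "distinct [x, y, z]"
    using assms(2) by (auto simp: card_3_iff)
  then show ?thesis using assms(1) color_exhausted[of "c x" "c y" "c z" i] by auto
qed

lemma proper_surj:
  assumes "proper V c" "K \<in> V" "card K = 3"
  shows "\<exists>e\<in>K. c e = i"
  using assms inj_on_claw_surj unfolding proper_def by blast

lemma evaluates_inj:
  assumes "evaluates V F K g" "valid V F" "proper V c" "K \<in> V"
  shows "inj_on g K"
proof (rule inj_onI)
  fix x y assume xy: "x \<in> K" "y \<in> K" "g x = g y"
  then have "F (cls V c (c x)) = F (cls V c (c y))" using assms by (simp add: evaluatesD)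
  then have "c x = c y" using validD assms by metis
  then show "x = y" using assms xy unfolding proper_def inj_on_def by blast
qed

text \<open>Otherwise let \<open>e\<close> be the edge of \<open>K\<close> with label
  \<open>i\<close> and take a coloring that separates \<open>e\<close> from \<open>h\<close>. The
  edge of \<open>K\<close> colored like \<open>h\<close> then has label \<open>i\<close> as well,
  although \<open>g\<close> is injective on \<open>K\<close>.\<close>

lemma constant_edge_in_dictator:
  assumes V: "dictatorial V" and ev: "evaluates V F K g" "valid V F" "K \<in> V"
    and h: "h \<in> \<Union>V" and const: "\<And>c. proper V c \<Longrightarrow> F (cls V c (c h)) = i"
  shows "h \<in> K"
proof (rule ccontr)
  assume "h \<notin> K"
  obtain c0 where "proper V c0" using dictatorial_ex[OF V] by blast
  then have inj: "inj_on g K" using evaluates_inj ev by blast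
  then obtain e where e: "e \<in> K" "g e = i" using inj_on_claw_surj dictatorial_card[OF V] ev by metis
  then obtain c where c: "proper V c" "c e \<noteq> c h"
    using dictatorial_sep[OF V, of e h] ev h \<open>h \<notin> K\<close> by blast
  then obtain e' where e': "e' \<in> K" "c e' = c h" using proper_surj dictatorial_card[OF V] ev by metis
  then have "g e' = i" using const c evaluatesD ev by metis
  then show False using inj e e' c unfolding inj_on_def by metis
qed

text \<open>The tool for comparing the dictators of two copies: agreement has to be checked only on
  the class of the half-edge \<open>h\<close>.\<close>

lemma half_edge_determines_evaluation:
  assumes V: "dictatorial V"
    and u: "u \<in> V" "h \<in> u" and half: "\<And>L. L \<in> V \<Longrightarrow> h \<in> L \<Longrightarrow> L = u"
    and f: "evaluates V f K g" "valid V f" "K \<in> V" "K \<noteq> u"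
    and f': "evaluates V f' K' g'" "valid V f'" "K' \<in> V"
    and agree: "\<And>c. proper V c \<Longrightarrow> f (cls V c (c h)) = f' (cls V c (c h))"
    and c: "proper V c"
  shows "f (cls V c i) = f' (cls V c i)"
proof -
  obtain s t where ust: "u = {h, s, t}" "distinct [h, s, t]"
    using triple_containingE[OF dictatorial_card[OF V u(1)] u(2)] .
  have hV: "h \<in> \<Union>V" "s \<in> \<Union>V" "t \<in> \<Union>V" using u ust by auto
  have col: "c h \<noteq> c s" "c h \<noteq> c t" "c s \<noteq> c t" if "proper V c" for c
  proof -
    have "inj_on c u" using that u(1) unfolding proper_def by blast
    then show "c h \<noteq> c s" "c h \<noteq> c t" "c s \<noteq> c t" unfolding ust(1) inj_on_triple[OF ust(2)] by simp_all
  qed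
  have colx: "i = c h \<or> i = c s \<or> i = c t" if "proper V c" for c i
    using color_exhausted[OF col[OF that]] .
  \<comment> \<open>Twist the evaluation at \<open>u\<close>: swap the labels of the two classes avoiding \<open>h\<close> whenever \<open>f\<close> and \<open>f'\<close>
    disagree there. The dictator of the twist must be \<open>u\<close>, so they disagree always or never.\<close>
  define \<Phi> where "\<Phi> C = (if h \<in> C then Red else if (s \<in> C) = (f C = f' C) then Green else Blue)" for C
  have mem: "h \<in> cls V c i \<longleftrightarrow> c h = i" "s \<in> cls V c i \<longleftrightarrow> c s = i" for c i
    using hV unfolding cls_def by auto
  have st: "f (cls V c (c s)) = f' (cls V c (c s)) \<longleftrightarrow> f (cls V c (c t)) = f' (cls V c (c t))"
    if "proper V c" for c
  proof -
    note inj = validD[OF f(2) that] validD[OF f'(2) that]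
    show ?thesis
      by (rule color_swap[of "f (cls V c (c h))"]) (simp_all add: inj col[OF that], simp_all add: agree[OF that] inj col[OF that])
  qed
  have \<Phi>: "\<Phi> (cls V c (c h)) = Red"
      "\<Phi> (cls V c (c s)) = (if f (cls V c (c s)) = f' (cls V c (c s)) then Green else Blue)"
      "\<Phi> (cls V c (c t)) = (if f (cls V c (c t)) = f' (cls V c (c t)) then Blue else Green)"
    if "proper V c" for c
    using col[OF that] unfolding \<Phi>_def mem by auto
  have "valid V \<Phi>"
    unfolding valid_def
  proof (intro allI impI injI)
    fix c i j assume c: "proper V c" and eq: "\<Phi> (cls V c i) = \<Phi> (cls V c j)"
    have "\<Phi> (cls V c (c h)) \<noteq> \<Phi> (cls V c (c s))" "\<Phi> (cls V c (c h)) \<noteq> \<Phi> (cls V c (c t))"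
       "\<Phi> (cls V c (c s)) \<noteq> \<Phi> (cls V c (c t))"
      using st[OF c] by (auto simp: \<Phi>[OF c])
    then show "i = j" using colx[OF c, of i] colx[OF c, of j] eq by auto
  qed
  then obtain L k where L: "L \<in> V" "evaluates V \<Phi> L k" using dictatorial_dict[OF V] by blast
  have "h \<in> L"
    using constant_edge_in_dictator[OF V L(2) \<open>valid V \<Phi>\<close> L(1) hV(1) \<Phi>(1)] by blast
  then have "L = u" using half L by blast
  have ks: "\<Phi> (cls V c (c s)) = k s" if "proper V c" for c
    using evaluatesD[OF L(2) that] \<open>L = u\<close> ust by auto
  show ?thesis
  proof (cases "f (cls V c (c s)) = f' (cls V c (c s))")
    case True
    then show ?thesis using st[OF c] agree[OF c] colx[OF c, of i] by auto
  next
    case False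
    then have "k s = Blue" using ks[OF c] \<Phi>(2)[OF c] by simp
    then have ne: "f (cls V c (c s)) \<noteq> f' (cls V c (c s))" if "proper V c" for c
      using ks[OF that] \<Phi>(2)[OF that] by (auto split: if_splits)
    have only_h: "i = c h" if "proper V c" "f (cls V c i) = f' (cls V c i)" for c i
      using ne[OF that(1)] st[OF that(1)] colx[OF that(1), of i] that(2) by auto
    \<comment> \<open>In this case \<open>f\<close> and \<open>f'\<close> agree on the class of
      \<open>h\<close> and on no other class. If \<open>e'\<close> is the edge of \<open>K'\<close>
      with the same label as \<open>e\<close>, then no coloring gives exactly two of
      \<open>h\<close>, \<open>e\<close>, \<open>e'\<close> the same color, so these three form a
      claw, which must be \<open>u\<close>. Hence all of \<open>K\<close> would lie in
      \<open>{s, t}\<close>.\<close>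
    have "e \<in> {s, t}" if e: "e \<in> K" for e
    proof -
      have "inj_on g' K'" using evaluates_inj f' c by blast
      then obtain e' where e': "e' \<in> K'" "g' e' = g e"
        using inj_on_claw_surj dictatorial_card[OF V] f' by metis
      have eV: "e \<in> \<Union>V" "e' \<in> \<Union>V" using f f' e e' by auto
      have vals: "f (cls V c (c e)) = g e" "f' (cls V c (c e')) = g e" if "proper V c" for c
        using evaluatesD[OF f(1) that e] evaluatesD[OF f'(1) that e'(1)] e' by auto
      have iff: "c e = c h \<longleftrightarrow> c e' = c h" if "proper V c" for c
        using vals[OF that] agree[OF that] validD[OF f(2) that] validD[OF f'(2) that] by metis
      have eq: "c e = c h" if "proper V c" "c e = c e'" for c
        using vals[OF that(1)] only_h[OF that(1)] that(2) by metis
      have "e \<noteq> h" using e f half by blast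
      then obtain d where d: "proper V d" "d e \<noteq> d h" using dictatorial_sep[OF V] eV hV by blast
      then have "e' \<noteq> h" "e \<noteq> e'" using iff eq by metis+
      then have dist: "distinct [h, e, e']" using \<open>e \<noteq> h\<close> by auto
      have "{h, e, e'} \<in> V"
        using dictatorial_triple[OF V hV(1) eV dist] iff eq unfolding two_equal_def by metis
      then have "{h, e, e'} = u" using half by blast
      then show ?thesis using ust dist by auto
    qed
    then have "card K \<le> card {s, t}" by (intro card_mono) auto
    then show ?thesis using dictatorial_card[OF V f(3)] card_insert_le_m1[of 2 "{t}" s] by simp
  qed
qed

text \<open>Every class is a single edge, so each labelling is already an evaluation. This starts
  the growth process.\<close>

lemma dictatorial_single:
  assumes "card K = 3"
  shows "dictatorial {K}"
proof (rule dictatorialI)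
  obtain x y z where K: "K = {x, y, z}" "distinct [x, y, z]"
    using assms by (auto simp: card_3_iff)
  define c0 where "c0 = (\<lambda>e. if e = x then Red else if e = y then Green else Blue)"
  have c0: "proper {K} c0" using K(2) unfolding proper_def K(1) by (auto simp: c0_def inj_on_def)
  then show "\<exists>c. proper {K} c" by blast
  show "card L = 3" if "L \<in> {K}" for L using that assms by simp
  show "\<exists>c. proper {K} c \<and> c e \<noteq> c f" if "e \<in> \<Union>{K}" "f \<in> \<Union>{K}" "e \<noteq> f" for e f
    using that c0 unfolding proper_def inj_on_def by auto
  show "\<exists>c. proper {K} c \<and> c e = c f"
    if "e \<in> \<Union>{K}" "f \<in> \<Union>{K}" "\<And>L. L \<in> {K} \<Longrightarrow> e \<in> L \<Longrightarrow> f \<notin> L" for e f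
    using that by auto
  show "\<exists>c. proper {K} c \<and> two_equal (c e) (c f) (c g)"
    if "e \<in> \<Union>{K}" "f \<in> \<Union>{K}" "g \<in> \<Union>{K}" "distinct [e, f, g]" "{e, f, g} \<notin> {K}" for e f g
  proof -
    have "{e, f, g} = K" using that assms by (intro card_seteq) (auto simp: K)
    then show ?thesis using that by simp
  qed
  show "\<exists>L\<in>{K}. \<exists>g. evaluates {K} F L g" for F
  proof -
    have "cls {K} c (c e) = {e}" if "proper {K} c" "e \<in> K" for c e
      using that unfolding cls_def proper_def inj_on_def by auto
    then have "evaluates {K} F K (\<lambda>e. F {e})" unfolding evaluates_def by simp
    then show ?thesis by blast
  qed
qed

section \<open>Pulling colorings and labellings back along claw maps\<close>

definition claw_map :: "'e set set \<Rightarrow> 'e set set \<Rightarrow> ('e \<Rightarrow> 'e) \<Rightarrow> bool" where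
  "claw_map V' V \<kappa> \<longleftrightarrow> (\<forall>K\<in>V'. \<kappa> ` K \<in> V \<and> inj_on \<kappa> K)"

lemma claw_map_insert:
  "claw_map (insert K V') V \<kappa> \<longleftrightarrow> \<kappa> ` K \<in> V \<and> inj_on \<kappa> K \<and> claw_map V' V \<kappa>"
  unfolding claw_map_def by simp

lemma claw_map_identity:
  assumes "\<And>e. e \<in> \<Union>V' \<Longrightarrow> \<kappa> e = e" "V' \<subseteq> V"
  shows "claw_map V' V \<kappa>"
  unfolding claw_map_def
proof
  fix K assume "K \<in> V'"
  then have "\<kappa> e = e" if "e \<in> K" for e using assms(1) that by blast
  then have "\<kappa> ` K = K" "inj_on \<kappa> K" by (simp_all add: inj_on_def)
  then show "\<kappa> ` K \<in> V \<and> inj_on \<kappa> K" using \<open>K \<in> V'\<close> assms(2) by auto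
qed

definition pull :: "'e set set \<Rightarrow> ('e \<Rightarrow> 'e) \<Rightarrow> 'e set \<Rightarrow> 'e set" where
  "pull V' \<kappa> C = {e \<in> \<Union>V'. \<kappa> e \<in> C}"

lemma proper_pull: "claw_map V' V \<kappa> \<Longrightarrow> proper V c \<Longrightarrow> proper V' (\<lambda>e. c (\<kappa> e))"
  unfolding claw_map_def proper_def inj_on_def by (metis imageI)

lemma cls_pull: "claw_map V' V \<kappa> \<Longrightarrow> cls V' (\<lambda>e. c (\<kappa> e)) i = pull V' \<kappa> (cls V c i)"
  unfolding claw_map_def cls_def pull_def by auto

lemma valid_pull:
  assumes "claw_map V' V \<kappa>" "valid V' F"
  shows "valid V (\<lambda>C. F (pull V' \<kappa> C))"
  unfolding valid_def
proof (intro allI impI)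
  fix c assume "proper V c"
  then have "inj (\<lambda>i. F (cls V' (\<lambda>e. c (\<kappa> e)) i))"
    using proper_pull[OF assms(1)] assms(2) unfolding valid_def by blast
  then show "inj (\<lambda>i. F (pull V' \<kappa> (cls V c i)))" by (simp add: cls_pull[OF assms(1)])
qed

lemma dictator_pull:
  assumes "dictatorial V" "claw_map V' V \<kappa>" "valid V' F"
  obtains K g where "K \<in> V" "evaluates V (\<lambda>C. F (pull V' \<kappa> C)) K g"
  using dictatorial_dict[OF assms(1) valid_pull[OF assms(2,3)]] by blast

lemma two_equal_iff_card: "two_equal x y z \<longleftrightarrow> card {x, y, z} = 2"
  unfolding two_equal_def by (cases x; cases y; cases z) (auto simp: card_insert_if)

lemma dictatorial_triple_set:
  assumes "dictatorial V" "T \<subseteq> \<Union>V" "card T = 3" "T \<notin> V"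
  shows "\<exists>c. proper V c \<and> card (c ` T) = 2"
proof -
  obtain x y z where T: "T = {x, y, z}" "distinct [x, y, z]" using assms(3) by (auto simp: card_3_iff)
  have "x \<in> \<Union>V" "y \<in> \<Union>V" "z \<in> \<Union>V" "{x, y, z} \<notin> V" using assms(2,4) unfolding T(1) by simp_all
  then obtain c where "proper V c" "two_equal (c x) (c y) (c z)"
    using dictatorial_triple[OF assms(1)] T(2) by metis
  then show ?thesis unfolding T(1) two_equal_iff_card by auto
qed

lemma image_two_equal_iff: "two_equal (c x) (c y) (c z) \<longleftrightarrow> card (c ` {x, y, z}) = 2"
  unfolding two_equal_iff_card by simp

lemma proper_neq: "proper V c \<Longrightarrow> K \<in> V \<Longrightarrow> e \<in> K \<Longrightarrow> f \<in> K \<Longrightarrow> e \<noteq> f \<Longrightarrow> c e \<noteq> c f"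
  unfolding proper_def inj_on_def by blast

lemma triple_eqI:
  assumes "card T = 3" "x \<in> T" "y \<in> T" "z \<in> T" "distinct [x, y, z]"
  shows "T = {x, y, z}"
proof -
  have "finite T" using assms(1) by (intro card_ge_0_finite) simp
  moreover have "{x, y, z} \<subseteq> T" "card {x, y, z} = card T" using assms by simp_all
  ultimately show ?thesis by (intro card_subset_eq[symmetric])
qed

lemma image_tripleE:
  assumes "card T = 3" "\<kappa> ` T = {a, b, c}" "distinct [a, b, c]"
  obtains x y z where "T = {x, y, z}" "\<kappa> x = a" "\<kappa> y = b" "\<kappa> z = c"
proof -
  have im: "a \<in> \<kappa> ` T" "b \<in> \<kappa> ` T" "c \<in> \<kappa> ` T" using assms(2) by simp_all
  obtain x where x: "x \<in> T" "\<kappa> x = a" using im(1) by (metis imageE)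
  obtain y where y: "y \<in> T" "\<kappa> y = b" using im(2) by (metis imageE)
  obtain z where z: "z \<in> T" "\<kappa> z = c" using im(3) by (metis imageE)
  have "distinct [x, y, z]" using x y z assms(3) by auto
  then show thesis using that[OF triple_eqI[OF assms(1) x(1) y(1) z(1)] x(2) y(2) z(2)] by blast
qed

lemma claw_map_Union: "claw_map V' V \<kappa> \<Longrightarrow> e \<in> \<Union>V' \<Longrightarrow> \<kappa> e \<in> \<Union>V"
  unfolding claw_map_def by blast

lemma sep_pull:
  assumes "dictatorial V" "claw_map V' V \<kappa>" "e \<in> \<Union>V'" "f \<in> \<Union>V'" "\<kappa> e \<noteq> \<kappa> f"
  shows "\<exists>c. proper V' c \<and> c e \<noteq> c f"
  using dictatorial_sep[OF assms(1) claw_map_Union[OF assms(2,3)] claw_map_Union[OF assms(2,4)] assms(5)]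
    proper_pull[OF assms(2)] by blast

lemma join_pull:
  assumes "dictatorial V" "claw_map V' V \<kappa>" "e \<in> \<Union>V'" "f \<in> \<Union>V'" "\<And>K. K \<in> V \<Longrightarrow> \<kappa> e \<in> K \<Longrightarrow> \<kappa> f \<notin> K"
  shows "\<exists>c. proper V' c \<and> c e = c f"
  using dictatorial_join[OF assms(1) claw_map_Union[OF assms(2,3)] claw_map_Union[OF assms(2,4)] assms(5)]
    proper_pull[OF assms(2)] by blast

text \<open>If \<open>\<kappa>\<close> is injective on \<open>T\<close>, the triple clause for the
  old system applies. Otherwise exactly two elements of \<open>T\<close> are identified, and any
  coloring that separates their image from the third one will do. What remains for the callers are
  the triples mapped bijectively onto a claw.\<close>

lemma triple_pull:
  assumes D: "dictatorial V" and \<kappa>: "claw_map V' V \<kappa>" and T: "T \<subseteq> \<Union>V'" "card T = 3"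
    and no_claw: "inj_on \<kappa> T \<Longrightarrow> \<kappa> ` T \<notin> V"
    and fibres: "\<And>x y z. \<lbrakk>x \<in> T; y \<in> T; z \<in> T; distinct [x, y, z]; \<kappa> x = \<kappa> y\<rbrakk> \<Longrightarrow> \<kappa> x \<noteq> \<kappa> z"
  shows "\<exists>c. proper V' c \<and> card (c ` T) = 2"
proof -
  have "\<exists>c. proper V c \<and> card (c ` (\<kappa> ` T)) = 2"
  proof (cases "inj_on \<kappa> T")
    case True
    have "\<kappa> ` T \<subseteq> \<Union>V" using T(1) claw_map_Union[OF \<kappa>] by blast
    then show ?thesis
      using dictatorial_triple_set[OF D _ _ no_claw[OF True]] card_image[OF True] T(2) by simp
  next
    case False
    then obtain x y where xy: "x \<in> T" "y \<in> T" "x \<noteq> y" "\<kappa> x = \<kappa> y" unfolding inj_on_def by blast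
    have "finite T" using T(2) by (intro card_ge_0_finite) simp
    then have "card (T - {x, y}) = 1" using xy T(2) by (simp add: card_Diff_subset)
    then obtain z where "T - {x, y} = {z}" using card_1_singletonE by blast
    then have z: "z \<in> T" "distinct [x, y, z]" using xy by auto
    then have "\<kappa> x \<noteq> \<kappa> z" using fibres xy by blast
    moreover have "\<kappa> x \<in> \<Union>V" "\<kappa> z \<in> \<Union>V" using T(1) xy(1) z(1) claw_map_Union[OF \<kappa>] by blast+
    ultimately obtain c where c: "proper V c" "c (\<kappa> x) \<noteq> c (\<kappa> z)" using dictatorial_sep[OF D] by blast
    have "c ` (\<kappa> ` T) = {c (\<kappa> x), c (\<kappa> z)}"
      unfolding triple_eqI[OF T(2) xy(1,2) z] using xy(4) by auto
    then have "card (c ` (\<kappa> ` T)) = 2" using c(2) by simp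
    then show ?thesis using c(1) by blast
  qed
  then show ?thesis using proper_pull[OF \<kappa>] unfolding image_image by blast
qed


section \<open>Attaching a leaf\<close>

text \<open>The new claw can be folded onto the old claw at \<open>h\<close> in two ways, and every
  coloring is pulled back along one of the two folds. Both copies agree on the class of
  \<open>h\<close>, so they coincide unless \<open>{h, s, t}\<close> rules. If it does, it rules
  both copies, and the labels of \<open>s\<close> and \<open>t\<close> match either straight, with
  the old claw as dictator, or crosswise, with the new one.\<close>

lemma dictatorial_leaf:
  assumes D: "dictatorial V" and u: "{h, s, t} \<in> V" "distinct [h, s, t]"
    and half: "\<And>L. L \<in> V \<Longrightarrow> h \<in> L \<Longrightarrow> L = {h, s, t}"
    and new: "a \<notin> \<Union>V" "b \<notin> \<Union>V" "a \<noteq> b"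
  shows "dictatorial (insert {h, a, b} V)"
proof -
  define V' where "V' = insert {h, a, b} V"
  have hV: "h \<in> \<Union>V" "s \<in> \<Union>V" "t \<in> \<Union>V" using u(1) by blast+
  then have dab: "distinct [h, a, b]" using new by auto
  have UV': "\<Union>V' = insert a (insert b (\<Union>V))" using hV unfolding V'_def by auto
  have prp: "proper V' c \<longleftrightarrow> c h \<noteq> c a \<and> c h \<noteq> c b \<and> c a \<noteq> c b \<and> proper V c" for c
    unfolding V'_def proper_insert inj_on_triple[OF dab] by blast
  have col: "c h \<noteq> c s" "c h \<noteq> c t" "c s \<noteq> c t" if "proper V c" for c
    using proper_neq[OF that u(1)] u(2) by simp_all
  have ext: "\<exists>c'. proper V' c' \<and> (\<forall>e\<in>\<Union>V. c' e = c e) \<and> c' a = i \<and> c' b = j"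
    if "proper V c" "i \<noteq> c h" "j \<noteq> c h" "i \<noteq> j" for c i j
  proof (intro exI conjI ballI)
    let ?c = "c(a := i, b := j)"
    have "?c e = c e" if "e \<in> \<Union>V" for e using that new by auto
    then show "proper V' ?c" using that new hV unfolding prp
      by (subst proper_cong[of V ?c c]) auto
    show "?c a = i" "?c b = j" using new by auto
    show "?c e = c e" if "e \<in> \<Union>V" for e using that new by auto
  qed
  have exa: "\<exists>c'. proper V' c' \<and> (\<forall>e\<in>\<Union>V. c' e = c e) \<and> c' a = i"
    if "proper V c" "i \<noteq> c h" for c i
    using ext[OF that] color_avoiding[of i "c h"] by metis
  have exb: "\<exists>c'. proper V' c' \<and> (\<forall>e\<in>\<Union>V. c' e = c e) \<and> c' b = i"
    if "proper V c" "i \<noteq> c h" for c i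
    using ext[OF that(1) _ that(2)] color_avoiding[of i "c h"] by metis
  have lift: "\<exists>c'. proper V' c' \<and> (\<forall>e\<in>\<Union>V. c' e = c e)" if "proper V c" for c
    using exa[OF that] color_avoiding[of "c h" "c h"] by metis
  have ex_new: "\<exists>c'. proper V' c' \<and> (\<forall>e\<in>\<Union>V. c' e = c e) \<and> c' x = i"
    if "x \<in> {a, b}" "proper V c" "i \<noteq> c h" for x c i
    using that(1) exa[OF that(2,3)] exb[OF that(2,3)] by (elim insertE) (simp_all del: Union_iff)
  have sep_new: "\<exists>c. proper V' c \<and> c x \<noteq> c f" if "x \<in> {a, b}" "f \<in> \<Union>V" for x f
  proof -
    obtain c where c: "proper V c" using dictatorial_ex[OF D] by blast
    obtain i where "i \<noteq> c h" "i \<noteq> c f" using color_avoiding by metis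
    then show ?thesis using ex_new[OF that(1) c] that(2) by metis
  qed
  have sep_h: "\<exists>c. proper V' c \<and> c x = c f" if x: "x \<in> {a, b}" and f: "f \<in> \<Union>V" "f \<noteq> h" for x f
  proof -
    obtain c where "proper V c" "c f \<noteq> c h" using dictatorial_sep[OF D f(1) hV(1) f(2)] by blast
    then show ?thesis using ex_new[OF x] f(1) by metis
  qed
  have trip_new: "\<exists>c. proper V' c \<and> two_equal (c x) (c f) (c g)"
    if x: "x \<in> {a, b}" and fg: "f \<in> \<Union>V" "g \<in> \<Union>V" "f \<noteq> g" for x f g
  \<comment> \<open>Edges in a common claw always differ, so it suffices to give \<open>x\<close>
    the color of one of them other than \<open>h\<close>. If there is no such claw, \<open>f\<close>
    and \<open>g\<close> are made equal and \<open>x\<close> avoids their color.\<close>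
  proof (cases "\<exists>K\<in>V. f \<in> K \<and> g \<in> K")
    case True
    then obtain K where K: "K \<in> V" "f \<in> K" "g \<in> K" by blast
    have fg_ne: "c f \<noteq> c g" if "proper V c" for c using proper_neq[OF that K fg(3)] .
    show ?thesis
    proof (cases "f = h")
      case False
      then obtain c where "proper V' c" "c x = c f" using sep_h[OF x fg(1)] by blast
      then show ?thesis using fg_ne[of c] prp[of c] unfolding two_equal_def by auto
    next
      case True
      then obtain c where "proper V' c" "c x = c g" using sep_h[OF x fg(2)] fg(3) by blast
      then show ?thesis using fg_ne[of c] prp[of c] unfolding two_equal_def by auto
    qed
  next
    case False
    then obtain c where c: "proper V c" "c f = c g" using dictatorial_join[OF D fg(1,2)] by blast
    obtain i where "i \<noteq> c h" "i \<noteq> c f" using color_avoiding by metis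
    then obtain c' where "proper V' c'" "\<forall>e\<in>\<Union>V. c' e = c e" "c' x = i" using ex_new[OF x c(1)] by blast
    then show ?thesis using c fg \<open>i \<noteq> c f\<close> unfolding two_equal_def by metis
  qed
  have trip_ab: "\<exists>c. proper V' c \<and> two_equal (c a) (c b) (c g)"
    if g: "g \<in> \<Union>V" "g \<noteq> h" for g
  proof -
    obtain c where "proper V' c" "c a = c g" using sep_h[of a g] g by blast
    then show ?thesis unfolding two_equal_def prp by metis
  qed
  have two_equal_perm: "two_equal x y z = two_equal y x z" "two_equal x y z = two_equal x z y" for x y z
    unfolding two_equal_def by auto
  have "dictatorial V'"
  proof (rule dictatorialI)
    show "card K = 3" if "K \<in> V'" for K
      using that dictatorial_card[OF D] dab unfolding V'_def by auto
    show "\<exists>c. proper V' c" using dictatorial_ex[OF D] lift by blast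
    show "\<exists>c. proper V' c \<and> c e \<noteq> c f" if ef: "e \<in> \<Union>V'" "f \<in> \<Union>V'" "e \<noteq> f" for e f
    proof -
      have old: ?thesis if "e \<in> \<Union>V" "f \<in> \<Union>V"
        using dictatorial_sep[OF D that \<open>e \<noteq> f\<close>] lift that by metis
      have ab: "\<exists>c. proper V' c \<and> c a \<noteq> c b" using \<open>\<exists>c. proper V' c\<close> prp by blast
      consider "e \<in> \<Union>V" "f \<in> \<Union>V" | "e \<in> {a, b}" "f \<in> \<Union>V" | "f \<in> {a, b}" "e \<in> \<Union>V" | "e \<in> {a, b}" "f \<in> {a, b}"
        using ef unfolding UV' by blast
      then show ?thesis
      proof cases
        case 4 then show ?thesis using ab ef(3) by (metis empty_iff insert_iff)
      qed (use old sep_new[of e f] sep_new[of f e] in \<open>blast, blast, metis\<close>)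
    qed
    show "\<exists>c. proper V' c \<and> c e = c f"
      if ef: "e \<in> \<Union>V'" "f \<in> \<Union>V'" and non: "\<And>K. K \<in> V' \<Longrightarrow> e \<in> K \<Longrightarrow> f \<notin> K" for e f
    proof -
      have nh: "\<not> (e \<in> {h, a, b} \<and> f \<in> {h, a, b})" using non[of "{h, a, b}"] unfolding V'_def by blast
      have "\<And>K. K \<in> V \<Longrightarrow> e \<in> K \<Longrightarrow> f \<notin> K" using non unfolding V'_def by blast
      then have old: ?thesis if "e \<in> \<Union>V" "f \<in> \<Union>V"
        using dictatorial_join[OF D that] lift that by metis
      consider "e \<in> \<Union>V" "f \<in> \<Union>V" | "e \<in> {a, b}" "f \<in> \<Union>V" "f \<noteq> h" | "f \<in> {a, b}" "e \<in> \<Union>V" "e \<noteq> h"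
        using ef nh unfolding UV' by blast
      then show ?thesis
        using old sep_h[of e f] sep_h[of f e] by cases (blast, blast, metis)
    qed
    show "\<exists>c. proper V' c \<and> two_equal (c e) (c f) (c g)"
      if efg: "e \<in> \<Union>V'" "f \<in> \<Union>V'" "g \<in> \<Union>V'" and dist: "distinct [e, f, g]" and claw: "{e, f, g} \<notin> V'" for e f g
    proof -
      have old: ?thesis if efg': "e \<in> \<Union>V" "f \<in> \<Union>V" "g \<in> \<Union>V"
      proof -
        obtain c where "proper V c" "two_equal (c e) (c f) (c g)"
          using dictatorial_triple[OF D efg' dist] claw unfolding V'_def by blast
        then show ?thesis using lift[of c] that by metis
      qed
      have nh: "{e, f, g} \<noteq> {h, a, b}" using claw unfolding V'_def by blast
      have d: "e \<noteq> f" "e \<noteq> g" "f \<noteq> g" using dist by auto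
      have abh: "z \<noteq> h" if "x \<in> {a, b}" "y \<in> {a, b}" "x \<noteq> y" "{e, f, g} = {x, y, z}" for x y z
        using that nh by blast
      have two: "\<exists>c. proper V' c \<and> two_equal (c x) (c y) (c z)"
        if xy: "x \<in> {a, b}" "y \<in> {a, b}" "x \<noteq> y" and z: "z \<in> \<Union>V" "{e, f, g} = {x, y, z}" for x y z
      proof -
        obtain c where "proper V' c" "two_equal (c a) (c b) (c z)"
          using trip_ab[OF z(1) abh[OF xy z(2)]] by blast
        then show ?thesis using xy two_equal_perm(1) by (metis empty_iff insert_iff)
      qed
      have mem: "e \<in> \<Union>V \<or> e \<in> {a, b}" "f \<in> \<Union>V \<or> f \<in> {a, b}" "g \<in> \<Union>V \<or> g \<in> {a, b}"
        using efg unfolding UV' by blast+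
      have "\<not> (e \<in> {a, b} \<and> f \<in> {a, b} \<and> g \<in> {a, b})" using d by blast
      then consider "e \<in> \<Union>V" "f \<in> \<Union>V" "g \<in> \<Union>V"
        | "e \<in> {a, b}" "f \<in> \<Union>V" "g \<in> \<Union>V" | "f \<in> {a, b}" "e \<in> \<Union>V" "g \<in> \<Union>V" | "g \<in> {a, b}" "e \<in> \<Union>V" "f \<in> \<Union>V"
        | "e \<in> {a, b}" "f \<in> {a, b}" "g \<in> \<Union>V" | "e \<in> {a, b}" "g \<in> {a, b}" "f \<in> \<Union>V" | "f \<in> {a, b}" "g \<in> {a, b}" "e \<in> \<Union>V"
        using mem by argo
      then show ?thesis
      proof cases
        case 1 then show ?thesis by (rule old)
      next
        case 2 then show ?thesis using trip_new d by blast
      next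
        case 3 then show ?thesis using trip_new[of f e g] d(2) two_equal_perm by metis
      next
        case 4 then show ?thesis using trip_new[of g e f] d(1) two_equal_perm by metis
      next
        case 5 then show ?thesis using two[of e f g] d by blast
      next
        case 6 then show ?thesis using two[of e g f] d two_equal_perm(2) by (metis insert_commute)
      next
        case 7 then show ?thesis using two[of f g e] d two_equal_perm by (metis insert_commute)
      qed
    qed
    show "\<exists>K\<in>V'. \<exists>g. evaluates V' F K g" if F: "valid V' F" for F
    proof -
      define \<kappa> \<kappa>' where "\<kappa> = id(a := s, b := t)" and "\<kappa>' = id(a := t, b := s)"
      have id: "\<kappa> e = e" "\<kappa>' e = e" if "e \<in> \<Union>V" for e
        using that new unfolding \<kappa>_def \<kappa>'_def by auto
      have ab: "\<kappa> a = s" "\<kappa> b = t" "\<kappa>' a = t" "\<kappa>' b = s" "\<kappa> h = h" "\<kappa>' h = h"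
        using new hV unfolding \<kappa>_def \<kappa>'_def by auto
      have cm: "claw_map V' V \<kappa>" "claw_map V' V \<kappa>'"
      proof -
        have "claw_map V V \<kappa>" "claw_map V V \<kappa>'" by (rule claw_map_identity[OF _ order_refl], rule id, assumption)+
        then show "claw_map V' V \<kappa>" "claw_map V' V \<kappa>'"
          using u dab unfolding V'_def claw_map_insert inj_on_triple[OF dab] by (auto simp: ab insert_commute)
      qed
      obtain K g where K: "K \<in> V" "evaluates V (\<lambda>C. F (pull V' \<kappa> C)) K g"
        using dictator_pull[OF D cm(1) F] .
      obtain K' g' where K': "K' \<in> V" "evaluates V (\<lambda>C. F (pull V' \<kappa>' C)) K' g'"
        using dictator_pull[OF D cm(2) F] .
      note val = valid_pull[OF cm(1) F] valid_pull[OF cm(2) F]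
      have agree: "pull V' \<kappa> (cls V c (c h)) = pull V' \<kappa>' (cls V c (c h))" if c: "proper V c" for c
      proof -
        have "c (\<kappa> e) = c h \<longleftrightarrow> c (\<kappa>' e) = c h" if "e \<in> \<Union>V'" for e
          using that unfolding UV'
          by (elim insertE) (use col[OF c] in \<open>auto simp: ab id simp del: Union_iff\<close>)
        then show ?thesis
          unfolding cls_pull[OF cm(1), symmetric] cls_pull[OF cm(2), symmetric]
          unfolding cls_def by (intro Collect_cong) blast
      qed
      have types: "proper V c \<and> (c a = c s \<and> c b = c t \<and> (\<forall>i. cls V' c i = pull V' \<kappa> (cls V c i)) \<or>
            c a = c t \<and> c b = c s \<and> (\<forall>i. cls V' c i = pull V' \<kappa>' (cls V c i)))" if "proper V' c" for c
      proof -
        have p: "proper V c" "c h \<noteq> c a" "c h \<noteq> c b" "c a \<noteq> c b" using that prp by auto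
        have "c a = c s \<and> c b = c t \<or> c a = c t \<and> c b = c s"
          by (rule color_pair[of "c h"]) (use p col[OF p(1)] in simp_all)
        moreover have "cls V' c i = pull V' \<kappa> (cls V c i)" if "c a = c s" "c b = c t" for i
          unfolding cls_pull[OF cm(1), symmetric]
          by (rule cls_cong, unfold UV', elim insertE) (use that in \<open>simp_all add: ab id del: Union_iff\<close>)
        moreover have "cls V' c i = pull V' \<kappa>' (cls V c i)" if "c a = c t" "c b = c s" for i
          unfolding cls_pull[OF cm(2), symmetric]
          by (rule cls_cong, unfold UV', elim insertE) (use that in \<open>simp_all add: ab id del: Union_iff\<close>)
        ultimately show ?thesis using p(1) by blast
      qed
      show ?thesis
      proof (cases "K = {h, s, t}")
        case False
        have same: "F (pull V' \<kappa> (cls V c i)) = F (pull V' \<kappa>' (cls V c i))" if "proper V c" for c i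
          by (rule half_edge_determines_evaluation[where h = h, OF D u(1) _ half K(2) val(1) K(1) False
                K'(2) val(2) K'(1) _ that]) (simp_all add: agree)
        have "evaluates V' F K g"
          unfolding evaluates_def using types same evaluatesD[OF K(2)] by metis
        then show ?thesis using K(1) unfolding V'_def by blast
      next
        case True
        then have gK: "F (pull V' \<kappa> (cls V c (c h))) = g h" "F (pull V' \<kappa> (cls V c (c s))) = g s"
            "F (pull V' \<kappa> (cls V c (c t))) = g t" if "proper V c" for c
          using evaluatesD[OF K(2) that] by auto
        have "h \<in> K'"
          using constant_edge_in_dictator[OF D K'(2) val(2) K'(1) hV(1)] gK(1) agree by metis
        then have "K' = {h, s, t}" using half K'(1) by blast
        then have gK': "F (pull V' \<kappa>' (cls V c (c h))) = g' h" "F (pull V' \<kappa>' (cls V c (c s))) = g' s"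
            "F (pull V' \<kappa>' (cls V c (c t))) = g' t" if "proper V c" for c
          using evaluatesD[OF K'(2) that] by auto
        obtain c0 where c0: "proper V c0" using dictatorial_ex[OF D] by blast
        have "g h = g' h" using gK(1)[OF c0] gK'(1)[OF c0] agree[OF c0] by simp
        moreover have "inj_on g {h, s, t}" "inj_on g' {h, s, t}"
          using evaluates_inj[OF K(2) val(1) c0 K(1)] evaluates_inj[OF K'(2) val(2) c0 K'(1)]
            True \<open>K' = {h, s, t}\<close> by auto
        ultimately have "g' s = g s \<and> g' t = g t \<or> g' s = g t \<and> g' t = g s"
          unfolding inj_on_triple[OF u(2)] by (intro color_pair[of "g h"]) auto
        then show ?thesis
        proof
          assume g': "g' s = g s \<and> g' t = g t"
          have "evaluates V' F {h, s, t} g"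
            unfolding evaluates_def
          proof (intro allI impI ballI)
            fix c e assume "proper V' c" "e \<in> {h, s, t}"
            then show "F (cls V' c (c e)) = g e"
              using types gK gK' g' \<open>g h = g' h\<close> by (metis empty_iff insert_iff)
          qed
          then show ?thesis using u unfolding V'_def by blast
        next
          assume g': "g' s = g t \<and> g' t = g s"
          \<comment> \<open>The class of \<open>a\<close> is labelled \<open>g s\<close> under both
            folds: \<open>a\<close> has the color of \<open>s\<close> in the first and that of
            \<open>t\<close> in the second, where \<open>g' t = g s\<close>.\<close>
          have "evaluates V' F {h, a, b} (g(a := g s, b := g t))"
            unfolding evaluates_def
          proof (intro allI impI ballI)
            fix c e assume c: "proper V' c" "e \<in> {h, a, b}"
            have "F (cls V' c (c h)) = g h \<and> F (cls V' c (c a)) = g s \<and> F (cls V' c (c b)) = g t"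
              using types[OF c(1)] gK gK' g' \<open>g h = g' h\<close> by metis
            then show "F (cls V' c (c e)) = (g(a := g s, b := g t)) e"
              using c(2) dab by auto
          qed
          then show ?thesis unfolding V'_def by blast
        qed
      qed
    qed
  qed
  then show ?thesis unfolding V'_def .
qed


section \<open>Closing a quadrangle\<close>

text \<open>The quadrangle \<open>d, hu, m, hv\<close> is closed by two new vertices with half-edges \<open>p\<close> and \<open>q\<close>. The map \<open>\<kappa>\<close>
  reflects the new vertices to the old ones. The colorings that are not pulled back along \<open>\<kappa>\<close>
  have the form \<open>alt c\<close> with \<open>c s = c t\<close>, where \<open>d\<close> can be swapped with \<open>hu\<close> and \<open>hv\<close>.\<close>

locale square =
  fixes V :: "'e set set" and d s hu t hv m p q :: 'e
  assumes D: "dictatorial V"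
    and claws: "{d, s, hu} \<in> V" "{d, t, hv} \<in> V"
    and dist: "distinct [d, s, hu, t, hv]"
    and d_only: "\<And>L. L \<in> V \<Longrightarrow> d \<in> L \<Longrightarrow> L = {d, s, hu} \<or> L = {d, t, hv}"
    and hu_only: "\<And>L. L \<in> V \<Longrightarrow> hu \<in> L \<Longrightarrow> L = {d, s, hu}"
    and hv_only: "\<And>L. L \<in> V \<Longrightarrow> hv \<in> L \<Longrightarrow> L = {d, t, hv}"
    and new: "m \<notin> \<Union>V" "p \<notin> \<Union>V" "q \<notin> \<Union>V" "distinct [m, p, q]"
begin

definition "V' = insert {hu, m, p} (insert {hv, m, q} V)"
definition "\<kappa> = id(m := d, p := s, q := t)"
text \<open>When \<open>c hu = c hv\<close>, the shared edge \<open>m\<close> may have either of the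
  other two colors. Pulling back along \<open>\<kappa>\<close> chooses \<open>c d\<close>; this is
  the other choice.\<close>

definition alt :: "('e \<Rightarrow> color) \<Rightarrow> 'e \<Rightarrow> color" where "alt c = c(m := c s, p := c d, q := c d)"
text \<open>The Kempe change on the chain \<open>hu\<close>, \<open>d\<close>, \<open>hv\<close>. It
  is two-colored if \<open>c s = c t\<close>, and it extends no further because \<open>hu\<close>
  and \<open>hv\<close> are half-edges of the old system.\<close>

definition flip :: "('e \<Rightarrow> color) \<Rightarrow> 'e \<Rightarrow> color" where "flip c = c(d := c hu, hu := c d, hv := c d)"

lemma old: "d \<in> \<Union>V" "s \<in> \<Union>V" "hu \<in> \<Union>V" "t \<in> \<Union>V" "hv \<in> \<Union>V"
  using claws by blast+

lemma neq: "d \<noteq> s" "d \<noteq> hu" "d \<noteq> t" "d \<noteq> hv" "s \<noteq> hu" "s \<noteq> t" "s \<noteq> hv" "hu \<noteq> t" "hu \<noteq> hv" "t \<noteq> hv"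
    "m \<noteq> p" "m \<noteq> q" "p \<noteq> q"
  using dist new(4) by auto

lemma old_neq: "e \<in> \<Union>V \<Longrightarrow> e \<noteq> m \<and> e \<noteq> p \<and> e \<noteq> q"
  using new by blast

lemma hneq: "hu \<noteq> m" "hu \<noteq> p" "hu \<noteq> q" "hv \<noteq> m" "hv \<noteq> p" "hv \<noteq> q" "d \<noteq> m" "d \<noteq> p" "d \<noteq> q"
   "s \<noteq> m" "s \<noteq> p" "s \<noteq> q" "t \<noteq> m" "t \<noteq> p" "t \<noteq> q"
  using old_neq old by blast+

lemma UV': "\<Union>V' = insert m (insert p (insert q (\<Union>V)))"
  unfolding V'_def using old by auto

lemma proper': "proper V' c \<longleftrightarrow> c hu \<noteq> c m \<and> c hu \<noteq> c p \<and> c m \<noteq> c p \<and> c hv \<noteq> c m \<and> c hv \<noteq> c q \<and> c m \<noteq> c q \<and> proper V c"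
proof -
  have "distinct [hu, m, p]" "distinct [hv, m, q]" using neq hneq by auto
  then show ?thesis unfolding V'_def proper_insert by (auto simp: inj_on_triple)
qed

lemma col:
  assumes "proper V c"
  shows "c d \<noteq> c s" "c d \<noteq> c hu" "c s \<noteq> c hu" "c d \<noteq> c t" "c d \<noteq> c hv" "c t \<noteq> c hv"
  using proper_neq[OF assms claws(1)] proper_neq[OF assms claws(2)] neq by simp_all

lemma eq_iff: "proper V c \<Longrightarrow> c s = c t \<longleftrightarrow> c hu = c hv"
  using color_swap[of "c d" "c s" "c hu" "c t" "c hv"] col by blast

text \<open>Obtained from \<open>hu\<close> and \<open>hv\<close>, which share no claw because they
  are half-edges at different claws. For \<open>s\<close> and \<open>t\<close> this is not yet
  known; it follows in \<open>not_both\<close>.\<close>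

lemma ex_eq: "\<exists>c. proper V c \<and> c s = c t"
proof -
  have "\<exists>c. proper V c \<and> c hu = c hv"
  proof (rule dictatorial_join[OF D old(3) old(5)])
    fix K assume "K \<in> V" "hu \<in> K"
    then show "hv \<notin> K" using hu_only neq by blast
  qed
  then show ?thesis using eq_iff by blast
qed

lemma ex_neq: "\<exists>c. proper V c \<and> c s \<noteq> c t"
  using dictatorial_sep[OF D old(2) old(4)] neq by blast

lemma \<kappa>_simps: "\<kappa> m = d" "\<kappa> p = s" "\<kappa> q = t" "e \<in> \<Union>V \<Longrightarrow> \<kappa> e = e"
  "\<kappa> hu = hu" "\<kappa> hv = hv" "\<kappa> d = d" "\<kappa> s = s" "\<kappa> t = t"
  using old_neq[of e] neq hneq unfolding \<kappa>_def by auto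

lemma alt_simps: "alt c m = c s" "alt c p = c d" "alt c q = c d" "e \<in> \<Union>V \<Longrightarrow> alt c e = c e"
  "alt c hu = c hu" "alt c hv = c hv" "alt c d = c d" "alt c s = c s" "alt c t = c t"
  using old_neq[of e] neq hneq unfolding alt_def by auto

lemma flip_simps: "flip c d = c hu" "flip c hu = c d" "flip c hv = c d" "flip c s = c s" "flip c t = c t"
  "e \<noteq> d \<Longrightarrow> e \<noteq> hu \<Longrightarrow> e \<noteq> hv \<Longrightarrow> flip c e = c e"
  using neq unfolding flip_def by auto

lemma claw_map_\<kappa>: "claw_map V' V \<kappa>"
proof -
  have "distinct [hu, m, p]" "distinct [hv, m, q]" using neq hneq by auto
  moreover have "claw_map V V \<kappa>" by (rule claw_map_identity[OF _ order_refl]) (rule \<kappa>_simps)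
  ultimately show ?thesis
    using claws neq unfolding V'_def claw_map_insert by (auto simp: inj_on_triple \<kappa>_simps insert_commute)
qed

lemma proper_alt: "proper V c \<Longrightarrow> c s = c t \<Longrightarrow> proper V' (alt c)"
  using col[of c] eq_iff[of c] proper_cong[of V "alt c" c] alt_simps(4)
  unfolding proper' by (simp add: alt_simps(1-3,5-) del: Union_iff)

lemma proper_flip:
  assumes "proper V c" "c s = c t"
  shows "proper V (flip c)"
  unfolding proper_def
proof
  fix L assume L: "L \<in> V"
  have ineq: "distinct [d, s, hu]" "distinct [d, t, hv]" using neq by auto
  note cc = col[OF assms(1)] eq_iff[OF assms(1)] assms(2)
  consider "L = {d, s, hu}" | "L = {d, t, hv}" | "d \<notin> L" "hu \<notin> L" "hv \<notin> L"
    using d_only hu_only hv_only L by blast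
  then show "inj_on (flip c) L"
  proof cases
    case 1 then show ?thesis using cc by (auto simp: inj_on_triple[OF ineq(1)] flip_simps(1-5))
  next
    case 2 then show ?thesis using cc by (auto simp: inj_on_triple[OF ineq(2)] flip_simps(1-5))
  next
    case 3
    then have "flip c e = c e" if "e \<in> L" for e using that by (intro flip_simps) auto
    then show ?thesis using assms(1) L inj_on_cong[of L "flip c" c] unfolding proper_def by blast
  qed
qed

lemma flip_flip: "proper V c \<Longrightarrow> c s = c t \<Longrightarrow> flip (flip c) = c"
  using eq_iff[of c] neq unfolding flip_def by auto

lemma not_both: "K \<in> V \<Longrightarrow> s \<in> K \<Longrightarrow> t \<notin> K"
  using ex_eq proper_neq neq by metis

lemma fibre:
  assumes "e \<in> \<Union>V'" "f \<in> \<Union>V'" "\<kappa> e = \<kappa> f" "e \<noteq> f"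
  shows "{e, f} = {m, d} \<or> {e, f} = {p, s} \<or> {e, f} = {q, t}"
proof -
  have "x = m \<or> x = p \<or> x = q \<or> x \<in> \<Union>V" if "x \<in> \<Union>V'" for x using that unfolding UV' by blast
  then show ?thesis
    using assms \<kappa>_simps neq by (smt (verit, ccfv_SIG) insert_commute)
qed

lemma preimage:
  assumes "x \<in> \<Union>V'"
  shows "\<kappa> x = d \<Longrightarrow> x = d \<or> x = m" "\<kappa> x = s \<Longrightarrow> x = s \<or> x = p" "\<kappa> x = t \<Longrightarrow> x = t \<or> x = q"
    "\<kappa> x = hu \<Longrightarrow> x = hu" "\<kappa> x = hv \<Longrightarrow> x = hv"
proof -
  have "x = m \<or> x = p \<or> x = q \<or> x \<in> \<Union>V" using assms unfolding UV' by blast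
  then show "\<kappa> x = d \<Longrightarrow> x = d \<or> x = m" "\<kappa> x = s \<Longrightarrow> x = s \<or> x = p" "\<kappa> x = t \<Longrightarrow> x = t \<or> x = q"
    "\<kappa> x = hu \<Longrightarrow> x = hu" "\<kappa> x = hv \<Longrightarrow> x = hv"
    using neq by (elim disjE; simp add: \<kappa>_simps del: Union_iff)+
qed

lemma sep':
  assumes "e \<in> \<Union>V'" "f \<in> \<Union>V'" "e \<noteq> f"
  shows "\<exists>c. proper V' c \<and> c e \<noteq> c f"
proof (cases "\<kappa> e = \<kappa> f")
  case True
  obtain c where c: "proper V c" "c s = c t" using ex_eq by blast
  \<comment> \<open>The pairs identified by \<open>\<kappa>\<close> are \<open>m, d\<close>, then
    \<open>p, s\<close>, and \<open>q, t\<close>; in \<open>alt c\<close> the first member of each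
    pair has left the color that it would inherit through \<open>\<kappa>\<close>.\<close>
  have "alt c e \<noteq> alt c f"
    using fibre[OF assms(1,2) True assms(3)] col[OF c(1)] c(2) 
    by (auto simp: doubleton_eq_iff alt_simps(1-3,5-))
  then show ?thesis using proper_alt[OF c] by blast
next
  case False
  then show ?thesis by (rule sep_pull[OF D claw_map_\<kappa> assms(1,2)])
qed

text \<open>Exchanging the two ends of \<open>d\<close> preserves both the new system and
  \<open>\<kappa>\<close>, so that only the side of \<open>{d, s, hu}\<close> has to be
  treated.\<close>

lemma mirror: "square V d t hv s hu m q p"
  by (rule square.intro) (fact D, fact claws(2), fact claws(1), use dist in fastforce, use d_only in blast,
      fact hv_only, fact hu_only, fact new(1), fact new(3), fact new(2), use new(4) in fastforce)

lemma mirror_V': "square.V' V hv hu m q p = V'"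
  unfolding V'_def square.V'_def[OF mirror] by (simp add: insert_commute)

lemma mirror_\<kappa>: "square.\<kappa> d t s m q p = \<kappa>"
  using neq unfolding \<kappa>_def square.\<kappa>_def[OF mirror] by (auto simp: fun_upd_twist)

lemma new_claws: "{hu, m, p} \<in> V'" "{hv, m, q} \<in> V'" "V \<subseteq> V'"
  unfolding V'_def by auto

lemma ex_alt: "\<exists>c. proper V' c \<and> c m = c s \<and> c m = c t \<and> c p = c d \<and> c q = c d"
  using ex_eq proper_alt alt_simps by metis

lemma join_same: "\<kappa> e = \<kappa> f \<Longrightarrow> \<exists>c. proper V' c \<and> c e = c f"
  using ex_eq proper_pull[OF claw_map_\<kappa>] by metis

lemma join_m:
  assumes f: "f \<in> \<Union>V'" "f \<notin> {hu, hv, p, q}"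
  shows "\<exists>c. proper V' c \<and> c m = c f"
proof -
  consider "f = m" | "f = d" | "f = s" | "f = t" | "f \<in> \<Union>V" "f \<notin> {d, s, t, hu, hv}"
    using f unfolding UV' by blast
  then show ?thesis
  proof cases
    case 5
    have "m \<in> \<Union>V'" unfolding UV' by blast
    moreover have "\<kappa> f \<notin> K" if "K \<in> V" "\<kappa> m \<in> K" for K
      using d_only[of K] that 5(2) unfolding \<kappa>_simps(1) \<kappa>_simps(4)[OF 5(1)] by blast
    ultimately show ?thesis using f(1) by (intro join_pull[OF D claw_map_\<kappa>])
  qed (use ex_alt join_same \<kappa>_simps in metis)+
qed

text \<open>Pulling back along \<open>\<kappa>\<close> gives \<open>p\<close> the color of
  \<open>s\<close> and fails if \<open>f\<close> shares a claw with \<open>s\<close>. For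
  \<open>c s = c t\<close> the edge \<open>f\<close> then has color \<open>c d\<close> or
  \<open>c hu\<close>, and \<open>alt c\<close> or \<open>alt (flip c)\<close> gives
  \<open>p\<close> exactly that color.\<close>

lemma join_p:
  assumes f: "f \<in> \<Union>V'" "f \<notin> {hu, m}"
  shows "\<exists>c. proper V' c \<and> c p = c f"
proof -
  consider "f = p \<or> f = s" | "f = q \<or> f = d" | "f \<in> \<Union>V" "f \<noteq> d" "f \<noteq> s" using f unfolding UV' by blast
  then show ?thesis
  proof cases
    case 1 then show ?thesis using join_same \<kappa>_simps(2,8) by metis
  next
    case 2 then show ?thesis using ex_alt by metis
  next
    case 3
    show ?thesis
    proof (cases "\<exists>K\<in>V. s \<in> K \<and> f \<in> K")
      case False
      have "p \<in> \<Union>V'" unfolding UV' by blast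
      moreover have "\<kappa> f \<notin> K" if "K \<in> V" "\<kappa> p \<in> K" for K
        using False that unfolding \<kappa>_simps(2) \<kappa>_simps(4)[OF 3(1)] by blast
      ultimately show ?thesis using f(1) by (intro join_pull[OF D claw_map_\<kappa>])
    next
      case True
      then obtain K where K: "K \<in> V" "s \<in> K" "f \<in> K" by blast
      have fh: "f \<noteq> hu" "f \<noteq> hv" using f(2) hv_only[of K] K neq by auto
      obtain c where c: "proper V c" "c s = c t" using ex_eq by blast
      have "c f \<noteq> c s" using proper_neq[OF c(1) K(1,3,2) 3(3)] .
      then consider "c f = c d" | "c f = c hu"
        using color_third_unique[of "c d" "c s" "c hu" "c f"] col[OF c(1)] by metis
      then show ?thesis
      proof cases
        case 1
        then have "alt c p = alt c f" using alt_simps(2) alt_simps(4)[OF 3(1)] by simp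
        then show ?thesis using proper_alt[OF c] by blast
      next
        case 2
        have "flip c f = flip c d" using 2 fh 3(2) by (simp add: flip_simps)
        then have "alt (flip c) p = alt (flip c) f" using alt_simps(2) alt_simps(4)[OF 3(1)] by simp
        moreover have "proper V' (alt (flip c))" using proper_alt[OF proper_flip[OF c]] c(2) by (simp add: flip_simps)
        ultimately show ?thesis by blast
      qed
    qed
  qed
qed

lemma join_q: "f \<in> \<Union>V' \<Longrightarrow> f \<notin> {hv, m} \<Longrightarrow> \<exists>c. proper V' c \<and> c q = c f"
  using square.join_p[OF mirror] unfolding mirror_V' .

lemma join_new:
  assumes e: "e \<in> {m, p, q}" and f: "f \<in> \<Union>V'" and non: "\<And>K. K \<in> V' \<Longrightarrow> e \<in> K \<Longrightarrow> f \<notin> K"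
  shows "\<exists>c. proper V' c \<and> c e = c f"
  using e non[OF new_claws(1)] non[OF new_claws(2)] join_m[OF f] join_p[OF f] join_q[OF f] by blast

lemma join':
  assumes e: "e \<in> \<Union>V'" and f: "f \<in> \<Union>V'" and non: "\<And>K. K \<in> V' \<Longrightarrow> e \<in> K \<Longrightarrow> f \<notin> K"
  shows "\<exists>c. proper V' c \<and> c e = c f"
proof -
  consider "e \<in> {m, p, q}" | "f \<in> {m, p, q}" | "e \<in> \<Union>V" "f \<in> \<Union>V" using e f unfolding UV' by blast
  then show ?thesis
  proof cases
    case 1 then show ?thesis using join_new f non by blast
  next
    case 2 
    then have "\<exists>c. proper V' c \<and> c f = c e" using join_new e non by blast
    then show ?thesis by metis
  next
    case 3
    have "\<kappa> f \<notin> K" if "K \<in> V" "\<kappa> e \<in> K" for K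
      using non[OF subsetD[OF new_claws(3)]] that unfolding \<kappa>_simps(4)[OF 3(1)] \<kappa>_simps(4)[OF 3(2)] by blast
    then show ?thesis by (rule join_pull[OF D claw_map_\<kappa> e f])
  qed
qed

text \<open>Not being a claw, \<open>T\<close> mixes the two lifts of \<open>{d, s, hu}\<close>: it
  contains \<open>d, p\<close> or \<open>m, s\<close>, and \<open>alt\<close> gives either pair
  equal colors.\<close>

lemma triple_side:
  assumes T: "T \<subseteq> \<Union>V'" "card T = 3" "T \<notin> V'" and im: "\<kappa> ` T = {d, s, hu}"
  shows "\<exists>c. proper V' c \<and> card (c ` T) = 2"
proof -
  obtain c where c: "proper V c" "c s = c t" using ex_eq by blast
  obtain x y z where Txyz: "T = {x, y, z}" and k: "\<kappa> x = d" "\<kappa> y = s" "\<kappa> z = hu"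
    using image_tripleE[OF T(2) im] neq by auto
  have "x \<in> \<Union>V'" "y \<in> \<Union>V'" "z \<in> \<Union>V'" using T(1) unfolding Txyz by simp_all
  then have pre: "x = d \<or> x = m" "y = s \<or> y = p" "z = hu"
    using preimage k by metis+
  have "T \<noteq> {d, s, hu}" "T \<noteq> {hu, m, p}" using T(3) claws new_claws by auto
  then have "T = {d, p, hu} \<or> T = {m, s, hu}" using pre unfolding Txyz by (elim disjE) (simp_all add: insert_commute)
  then have "alt c ` T = {c d, c hu} \<or> alt c ` T = {c s, c hu}"
    by (elim disjE) (simp_all add: alt_simps(1-3,5-))
  then have "card (alt c ` T) = 2" using col[OF c(1)] by auto
  then show ?thesis using proper_alt[OF c] by blast
qed

text \<open>Since \<open>s\<close> and \<open>t\<close> never share a claw, \<open>T\<close>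
  consists of one of \<open>p\<close>, \<open>q\<close> and two old edges. In \<open>alt c\<close>
  the new edge has color \<open>c d\<close>, which differs from \<open>c s = c t\<close> and hence
  is the color of one of the two old edges.\<close>

lemma triple_far:
  assumes T: "T \<subseteq> \<Union>V'" "card T = 3" "T \<notin> V'" and inj: "inj_on \<kappa> T" and True: "\<kappa> ` T \<in> V" and 3: "d \<notin> \<kappa> ` T"
  shows "\<exists>c. proper V' c \<and> card (c ` T) = 2"
proof -
  obtain c where c: "proper V c" "c s = c t" using ex_eq by blast
  note cc = col[OF c(1)] eq_iff[OF c(1)] c(2)
  have "m \<notin> T" using 3 \<kappa>_simps(1) by (metis imageI)
  have "\<not> T \<subseteq> \<Union>V"
  proof
    assume "T \<subseteq> \<Union>V"
    then have "\<kappa> ` T = T" using \<kappa>_simps(4) by (force simp del: Union_iff)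
    then show False using True T(3) unfolding V'_def by simp
  qed
  then obtain x where x: "x \<in> T" "x = p \<or> x = q" using T(1) \<open>m \<notin> T\<close> unfolding UV' by blast
  obtain y z where yz: "T = {x, y, z}" "distinct [x, y, z]"
    using triple_containingE[OF T(2) x(1)] .
  have "y \<in> \<Union>V \<and> z \<in> \<Union>V"
  proof -
    have "w \<in> \<Union>V" if "w \<in> T" "w \<noteq> x" for w
    proof (rule ccontr)
      assume "w \<notin> \<Union>V"
      then have "w = p \<or> w = q" using that T(1) \<open>m \<notin> T\<close> unfolding UV' by blast
      then have "p \<in> T" "q \<in> T" using x that by auto
      then have "s \<in> \<kappa> ` T" "t \<in> \<kappa> ` T" using \<kappa>_simps(2,3) by (metis imageI)+
      then show False using not_both[OF True] by blast
    qed
    then show ?thesis using yz by auto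
  qed
  then have "y \<in> \<kappa> ` T" "z \<in> \<kappa> ` T" using \<kappa>_simps(4) yz by (metis imageI insertCI)+
  moreover have "\<kappa> x \<in> \<kappa> ` T" "\<kappa> x \<in> {s, t}" using x \<kappa>_simps(2,3) by auto
  moreover have "y \<noteq> \<kappa> x" "z \<noteq> \<kappa> x" using inj yz \<kappa>_simps(4) \<open>y \<in> \<Union>V \<and> z \<in> \<Union>V\<close>
    by (metis inj_on_def insertCI distinct_length_2_or_more)+
  ultimately have "c y \<noteq> c s" "c z \<noteq> c s" "c y \<noteq> c z"
    using proper_neq[OF c(1) True] yz(2) c(2) by (metis distinct_length_2_or_more empty_iff insert_iff)+
  then have "c d = c y \<or> c d = c z" using color_exhausted[of "c y" "c s" "c z" "c d"] cc by metis
  moreover have "alt c y = c y" "alt c z = c z" "alt c x = c d"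
    using \<open>y \<in> \<Union>V \<and> z \<in> \<Union>V\<close> x alt_simps by auto
  ultimately have "card (alt c ` T) = 2" using yz(1) \<open>c y \<noteq> c z\<close> by (auto simp: card_insert_if)
  then show ?thesis using proper_alt[OF c] by blast
qed

lemma triple':
  assumes T: "T \<subseteq> \<Union>V'" "card T = 3" "T \<notin> V'"
  shows "\<exists>c. proper V' c \<and> card (c ` T) = 2"
proof (cases "inj_on \<kappa> T \<and> \<kappa> ` T \<in> V")
  case True
  then consider "\<kappa> ` T = {d, s, hu}" | "\<kappa> ` T = {d, t, hv}" | "d \<notin> \<kappa> ` T" using d_only by blast
  then show ?thesis
  proof cases
    case 1 then show ?thesis by (rule triple_side[OF T])
  next
    case 2 then show ?thesis using square.triple_side[OF mirror, unfolded mirror_V' mirror_\<kappa>, OF T] by blast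
  next
    case 3 then show ?thesis using triple_far[OF T] True by blast
  qed
next
  case False
  show ?thesis
  proof (rule triple_pull[OF D claw_map_\<kappa> T(1,2)])
    show "\<kappa> x \<noteq> \<kappa> z" if x: "x \<in> T" "y \<in> T" "z \<in> T" "distinct [x, y, z]" "\<kappa> x = \<kappa> y" for x y z
    proof
      assume eq: "\<kappa> x = \<kappa> z"
      have V: "x \<in> \<Union>V'" "y \<in> \<Union>V'" "z \<in> \<Union>V'" using x(1-3) T(1) by blast+
      have ne: "x \<noteq> y" "x \<noteq> z" "y \<noteq> z" using x(4) by auto
      show False
        using fibre[OF V(1,2) x(5) ne(1)] fibre[OF V(1,3) eq ne(2)] ne(3) neq hneq
        unfolding doubleton_eq_iff by metis
    qed
  qed (use False in blast)
qed

section \<open>Dictators after closing a quadrangle\<close>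

lemma coloring_types:
  assumes "proper V' c"
  shows "proper V c" "c m = c d \<and> c p = c s \<and> c q = c t \<or> c s = c t \<and> c m = c s \<and> c p = c d \<and> c q = c d"
proof -
  note p' = assms[unfolded proper']
  then show pr: "proper V c" by blast
  note cc = col[OF pr]
  have u: "c m = c d \<and> c p = c s \<or> c m = c s \<and> c p = c d"
    by (rule color_pair[of "c hu"]) (use p' cc in auto)
  have v: "c m = c d \<and> c q = c t \<or> c m = c t \<and> c q = c d"
    by (rule color_pair[of "c hv"]) (use p' cc in auto)
  \<comment> \<open>The choices at the two new claws are coupled by their common edge
    \<open>m\<close>: the crossed choice at one forces it at the other, and both together force
    \<open>c s = c t\<close>.\<close>
  show "c m = c d \<and> c p = c s \<and> c q = c t \<or> c s = c t \<and> c m = c s \<and> c p = c d \<and> c q = c d"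
    using u v cc by metis
qed

lemma cls_std: "c m = c d \<Longrightarrow> c p = c s \<Longrightarrow> c q = c t \<Longrightarrow> cls V' c i = pull V' \<kappa> (cls V c i)"
  unfolding cls_pull[OF claw_map_\<kappa>, symmetric]
  by (rule cls_cong, unfold UV', elim insertE) (simp_all add: \<kappa>_simps del: Union_iff)

lemma cls_alt: "c m = c s \<Longrightarrow> c p = c d \<Longrightarrow> c q = c d \<Longrightarrow> cls V' c i = cls V' (alt c) i"
  unfolding alt_def by (rule cls_cong) simp

lemma mem_cls: "e \<in> \<Union>V \<Longrightarrow> e \<in> cls V c i \<longleftrightarrow> c e = i"
  unfolding cls_def by simp

text \<open>One class of every exceptional coloring is pulled back, so its label is already
  known.\<close>

lemma cls_alt_hu:
  assumes "proper V c" "c s = c t"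
  shows "cls V' (alt c) (c hu) = pull V' \<kappa> (cls V c (c hu))"
proof -
  note cc = col[OF assms(1)]
  have "alt c e = c hu \<longleftrightarrow> c (\<kappa> e) = c hu" if "e \<in> \<Union>V'" for e
    using that cc assms(2) unfolding UV'
    by (elim insertE) (simp_all add: alt_simps \<kappa>_simps del: Union_iff)
  then show ?thesis unfolding cls_pull[OF claw_map_\<kappa>, symmetric] unfolding cls_def by blast
qed

text \<open>Two different exceptional colorings share this class; its label thus has to avoid known
  labels from both of them.\<close>

lemma cls_alt_flip_s:
  assumes "proper V c" "c s = c t"
  shows "cls V' (alt (flip c)) (c s) = cls V' (alt c) (c s)"
proof -
  note cc = col[OF assms(1)] eq_iff[OF assms(1)]
  have "alt (flip c) e = c s \<longleftrightarrow> alt c e = c s" if e: "e \<in> \<Union>V'" for e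
  proof -
    have "flip c e = c s \<longleftrightarrow> c e = c s" for e
      using cc assms(2) unfolding flip_def by auto
    then show ?thesis
      using e cc assms(2) unfolding UV'
      by (elim insertE) (auto simp: alt_simps flip_simps(1-5) simp del: Union_iff)
  qed
  then show ?thesis unfolding cls_def by blast
qed

text \<open>Like \<open>cls_alt_flip_hu\<close>, this expresses a class of the new system through
  the old class as a set, independently of the coloring. The labelling \<open>\<Phi>\<close> in
  \<open>dict_side\<close> has to be a function of such sets.\<close>

lemma cls_alt_s:
  assumes "proper V c" "c s = c t"
  shows "cls V' (alt c) (c s) = insert m (cls V c (c s))"
proof -
  note cc = col[OF assms(1)]
  have "e \<in> cls V' (alt c) (c s) \<longleftrightarrow> e \<in> insert m (cls V c (c s))" for e
  proof (cases "e \<in> \<Union>V")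
    case True
    then show ?thesis
      using old_neq[OF True] unfolding cls_def UV' by (simp add: alt_simps(4) del: Union_iff)
  next
    case False
    then show ?thesis
      using cc assms(2) neq unfolding cls_def UV' by (auto simp: alt_simps(1-3) simp del: Union_iff)
  qed
  then show ?thesis by blast
qed

lemma cls_alt_flip_hu:
  assumes "proper V c" "c s = c t"
  shows "cls V' (alt (flip c)) (c hu) = cls V c (c hu) - {hu, hv} \<union> {d, p, q}"
proof -
  note cc = col[OF assms(1)] eq_iff[OF assms(1)]
  have fl: "flip c e = c hu \<longleftrightarrow> e = d \<or> c e = c hu \<and> e \<noteq> hu \<and> e \<noteq> hv" for e
    using cc assms(2) neq unfolding flip_def by auto
  have "e \<in> cls V' (alt (flip c)) (c hu) \<longleftrightarrow> e \<in> cls V c (c hu) - {hu, hv} \<union> {d, p, q}" for e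
  proof (cases "e \<in> \<Union>V")
    case True
    then show ?thesis
      using fl[of e] old_neq[OF True] unfolding cls_def UV' by (auto simp: alt_simps(4) simp del: Union_iff)
  next
    case False
    then have "e \<noteq> d" using old by blast
    then show ?thesis
      using False cc assms(2) neq unfolding cls_def UV'
      by (auto simp: alt_simps(1-3) flip_simps(1-5) simp del: Union_iff)
  qed
  then show ?thesis by blast
qed

lemma valid_alt:
  assumes F: "valid V' F" and c: "proper V c" "c s = c t"
  shows "F (cls V' (alt c) (c d)) \<noteq> F (cls V' (alt c) (c s))"
    "F (cls V' (alt c) (c d)) \<noteq> F (pull V' \<kappa> (cls V c (c hu)))"
    "F (cls V' (alt c) (c s)) \<noteq> F (pull V' \<kappa> (cls V c (c hu)))"
  using validD[OF F proper_alt[OF c]] col[OF c(1)] unfolding cls_alt_hu[OF c, symmetric] by simp_all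

text \<open>Such a \<open>K\<close> avoids \<open>d\<close>, \<open>hu\<close> and
  \<open>hv\<close>, so \<open>flip\<close> does not recolor it. Let \<open>x\<close>,
  \<open>y\<close>, \<open>z\<close> be its edges with the colors of \<open>hu\<close>,
  \<open>d\<close>, \<open>s\<close>. In \<open>alt c\<close> the class of \<open>hu\<close> has
  label \<open>g x\<close>; the class of \<open>s\<close> is shared with
  \<open>alt (flip c)\<close>, where the class of \<open>hu\<close> has label \<open>g y\<close>.
  Hence its label is \<open>g z\<close>, and \<open>g y\<close> is left for the class of
  \<open>d\<close>.\<close>

lemma dict_generic:
  assumes F: "valid V' F" and K: "K \<in> V" "evaluates V (\<lambda>C. F (pull V' \<kappa> C)) K g"
    and neither: "K \<noteq> {d, s, hu}" "K \<noteq> {d, t, hv}"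
  shows "evaluates V' F K g"
  unfolding evaluates_def
proof (intro allI impI ballI)
  fix c e assume c': "proper V' c" and e: "e \<in> K"
  note ty = coloring_types[OF c']
  have out: "d \<notin> K" "hu \<notin> K" "hv \<notin> K" using d_only hu_only hv_only K(1) neither by blast+
  have ev: "F (pull V' \<kappa> (cls V c (c x))) = g x" if "proper V c" "x \<in> K" for c x
    using evaluatesD[OF K(2) that] .
  show "F (cls V' c (c e)) = g e"
    using ty(2)
  proof
    assume "c m = c d \<and> c p = c s \<and> c q = c t"
    then have "cls V' c (c e) = pull V' \<kappa> (cls V c (c e))" using cls_std by blast
    then show ?thesis using ev[OF ty(1) e] by simp
  next
    assume a: "c s = c t \<and> c m = c s \<and> c p = c d \<and> c q = c d"
    then have cls: "cls V' c i = cls V' (alt c) i" for i using cls_alt by blast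
    have eq: "c s = c t" using a by blast
    note c = ty(1) eq
    have card: "card K = 3" using dictatorial_card[OF D K(1)] .
    obtain x where x: "x \<in> K" "c x = c hu" using proper_surj[OF c(1) K(1) card] by blast
    obtain y where y: "y \<in> K" "c y = c d" using proper_surj[OF c(1) K(1) card] by blast
    obtain z where z: "z \<in> K" "c z = c s" using proper_surj[OF c(1) K(1) card] by blast
    note cc = col[OF c(1)]
    have ne: "x \<noteq> y" "x \<noteq> z" "y \<noteq> z" using x y z cc by metis+
    have inj: "inj_on g K" using evaluates_inj[OF K(2) valid_pull[OF claw_map_\<kappa> F] c(1) K(1)] .
    have gne: "g x \<noteq> g y" "g x \<noteq> g z" "g y \<noteq> g z"
      using ne inj_on_eq_iff[OF inj] x(1) y(1) z(1) by simp_all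
    have hu: "F (pull V' \<kappa> (cls V c (c hu))) = g x" using ev[OF c(1) x(1)] x(2) by simp
    have fy: "flip c y = flip c hu"
      using flip_simps(2) flip_simps(6)[of y c] y out by metis
    have pf: "proper V (flip c)" "flip c s = flip c t" using proper_flip[OF c] c(2) by (simp_all add: flip_simps)
    have hu': "F (pull V' \<kappa> (cls V (flip c) (flip c hu))) = g y" using ev[OF pf(1) y(1)] fy by simp
    have "F (cls V' (alt c) (c s)) \<noteq> g x" using valid_alt[OF F c] hu by simp
    moreover have "F (cls V' (alt c) (c s)) \<noteq> g y"
      using valid_alt[OF F pf] hu' cls_alt_flip_s[OF c] by (simp add: flip_simps)
    ultimately have s: "F (cls V' (alt c) (c s)) = g z" using color_third_unique gne by metis
    then have "F (cls V' (alt c) (c d)) = g y"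
      using valid_alt[OF F c] hu color_third_unique[of "g x" "g z" "g y"] gne by metis
    moreover have "c e = c x \<or> c e = c y \<or> c e = c z" using x y z cc color_exhausted by metis
    then have "e = x \<or> e = y \<or> e = z" using proper_neq[OF c(1) K(1) e] x(1) y(1) z(1) by metis
    ultimately show ?thesis
      unfolding cls using s hu cls_alt_hu[OF c] x y z by (elim disjE) simp_all
  qed
qed

lemma dict_side:
  assumes F: "valid V' F" and K: "evaluates V (\<lambda>C. F (pull V' \<kappa> C)) {d, s, hu} g"
  shows "\<exists>K\<in>V'. \<exists>g. evaluates V' F K g"
proof -
  have ev: "F (pull V' \<kappa> (cls V c (c d))) = g d" "F (pull V' \<kappa> (cls V c (c s))) = g s"
    "F (pull V' \<kappa> (cls V c (c hu))) = g hu" if "proper V c" for c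
    using evaluatesD[OF K that] by simp_all
  obtain c0 where c0: "proper V c0" "c0 s \<noteq> c0 t" using ex_neq by blast
  obtain c1 where c1: "proper V c1" "c1 s = c1 t" using ex_eq by blast
  have "inj_on g {d, s, hu}"
    using evaluates_inj[OF K valid_pull[OF claw_map_\<kappa> F] c0(1) claws(1)] .
  then have gne: "g d \<noteq> g s" "g d \<noteq> g hu" "g s \<noteq> g hu" using neq by (simp_all add: inj_on_eq_iff)
  have pf: "proper V (flip c)" "flip c s = flip c t" if "proper V c" "c s = c t" for c
    using proper_flip[OF that] that(2) by (simp_all add: flip_simps)
  \<comment> \<open>Obtained from \<open>F\<close> on the classes of \<open>alt (flip c)\<close> when \<open>c s = c t\<close>; its dictator contains \<open>d\<close>, which
    leaves the old vertex and the new vertex at \<open>hu\<close> as the only dictators of \<open>F\<close>.\<close>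
  define \<Phi> where "\<Phi> C = (if d \<in> C then g hu else if s \<in> C \<and> t \<in> C then F (insert m C)
     else if hu \<in> C \<and> hv \<in> C then F (C - {hu, hv} \<union> {d, p, q}) else if hu \<in> C then g d else g s)" for C
  have \<Phi>_eq: "\<Phi> (cls V c (c d)) = g hu" "\<Phi> (cls V c (c s)) = F (cls V' (alt c) (c s))"
      "\<Phi> (cls V c (c hu)) = F (cls V' (alt (flip c)) (c hu))" if c: "proper V c" "c s = c t" for c
    using col[OF c(1)] eq_iff[OF c(1)] c(2) unfolding cls_alt_s[OF c] cls_alt_flip_hu[OF c] \<Phi>_def
    by (simp_all add: mem_cls old del: Union_iff Un_insert_right)
  have neq_case: "c hu = c t \<and> c hv = c s" if "proper V c" "c s \<noteq> c t" for c
  proof -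
    have "c t = c s \<and> c hv = c hu \<or> c t = c hu \<and> c hv = c s"
      by (rule color_pair[of "c d"]) (use col[OF that(1)] in auto)
    then show ?thesis using that(2) by metis
  qed
  \<comment> \<open>Where \<open>c s \<noteq> c t\<close>, the labels are prescribed by exchanging
    those of \<open>d\<close> and \<open>hu\<close>, as the flip does. Then \<open>d\<close> has the
    constant label \<open>g hu\<close>, and one such coloring, \<open>c0\<close>, is enough to read
    off the values of the dictator.\<close>
  have \<Phi>_neq: "\<Phi> (cls V c (c d)) = g hu" "\<Phi> (cls V c (c s)) = g s" "\<Phi> (cls V c (c hu)) = g d"
    if c: "proper V c" "c s \<noteq> c t" for c
    using col[OF c(1)] neq_case[OF c] c(2) unfolding \<Phi>_def
    by (auto simp: mem_cls old simp del: Union_iff)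
  have fl_hu: "flip c d = c hu" "flip c s = c s" for c by (simp_all add: flip_simps)
  have distinct: "\<Phi> (cls V c (c d)) \<noteq> \<Phi> (cls V c (c s)) \<and> \<Phi> (cls V c (c d)) \<noteq> \<Phi> (cls V c (c hu)) \<and>
      \<Phi> (cls V c (c s)) \<noteq> \<Phi> (cls V c (c hu))" if c: "proper V c" for c
  proof (cases "c s = c t")
    case True
    note va = valid_alt[OF F pf[OF c True], unfolded ev(3)[OF pf(1)[OF c True]] fl_hu cls_alt_flip_s[OF c True]]
    show ?thesis unfolding \<Phi>_eq[OF c True] using va by auto
  next
    case False
    show ?thesis unfolding \<Phi>_neq[OF c False] using gne by auto
  qed
  have "valid V \<Phi>"
    unfolding valid_def
  proof (intro allI impI injI)
    fix c i j assume c: "proper V c" and eq: "\<Phi> (cls V c i) = \<Phi> (cls V c j)"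
    have ex: "k = c d \<or> k = c s \<or> k = c hu" for k using color_exhausted[of "c d" "c s" "c hu" k] col[OF c] by blast
    show "i = j" using ex[of i] ex[of j] distinct[OF c] eq by metis
  qed
  then obtain L k where L: "L \<in> V" "evaluates V \<Phi> L k" using dictatorial_dict[OF D] by blast
  have "\<Phi> (cls V c (c d)) = g hu" if "proper V c" for c
    using \<Phi>_eq(1) \<Phi>_neq(1) that by blast
  then have "d \<in> L" using constant_edge_in_dictator[OF D L(2) \<open>valid V \<Phi>\<close> L(1) old(1)] by blast
  then have L_cases: "L = {d, s, hu} \<or> L = {d, t, hv}" using d_only L(1) by blast
  \<comment> \<open>\<open>flip\<close> is an involution exchanging the colors of \<open>d\<close>
    and \<open>hu\<close>, so a label for the class of \<open>hu\<close> in
    \<open>alt (flip c)\<close> is one for the class of \<open>d\<close> in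
    \<open>alt c\<close>.\<close>
  have flipped: "F (cls V' (alt c) (c d)) = j"
    if j: "\<And>c. proper V c \<Longrightarrow> c s = c t \<Longrightarrow> F (cls V' (alt (flip c)) (c hu)) = j"
      and c: "proper V c" "c s = c t" for c j
    using j[OF pf[OF c]] flip_flip[OF c] flip_simps(2)[of c] by simp
  have classify: "F (cls V' c (c d)) = x \<and> F (cls V' c (c s)) = y \<and> F (cls V' c (c hu)) = g hu"
    if xy: "\<And>c. proper V c \<Longrightarrow> c s = c t \<Longrightarrow> F (cls V' (alt c) (c d)) = x"
      "\<And>c. proper V c \<Longrightarrow> c s = c t \<Longrightarrow> F (cls V' (alt c) (c s)) = y"
      and c: "proper V' c" "\<not> (c m = c d \<and> c p = c s \<and> c q = c t)" for c x y
  proof -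
    have a: "c s = c t \<and> c m = c s \<and> c p = c d \<and> c q = c d" using coloring_types(2)[OF c(1)] c(2) by blast
    then have eq: "c s = c t" by blast
    note pr = coloring_types(1)[OF c(1)]
    have cls: "cls V' c i = cls V' (alt c) i" for i using cls_alt a by blast
    show ?thesis unfolding cls using xy[OF pr eq] cls_alt_hu[OF pr eq] ev(3)[OF pr] by simp
  qed
  have std: "F (cls V' c (c d)) = g d \<and> F (cls V' c (c s)) = g s \<and> F (cls V' c (c hu)) = g hu"
    if "proper V' c" "c m = c d \<and> c p = c s \<and> c q = c t" for c
    using ev[OF coloring_types(1)[OF that(1)]] cls_std that(2) by simp
  show ?thesis
    using L_cases
  proof
    assume "L = {d, s, hu}"
    then have k: "\<Phi> (cls V c (c s)) = k s" "\<Phi> (cls V c (c hu)) = k hu" if "proper V c" for c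
      using evaluatesD[OF L(2) that] by simp_all
    have k': "k s = g s" "k hu = g d" using k[OF c0(1)] \<Phi>_neq[OF c0] by simp_all
    have x: "F (cls V' (alt c) (c d)) = g d" if "proper V c" "c s = c t" for c
    proof (rule flipped[OF _ that])
      show "F (cls V' (alt (flip c)) (c hu)) = g d" if "proper V c" "c s = c t" for c
        using k(2)[OF that(1)] \<Phi>_eq(3)[OF that] k'(2) by simp
    qed
    have y: "F (cls V' (alt c) (c s)) = g s" if "proper V c" "c s = c t" for c
      using k(1)[OF that(1)] \<Phi>_eq(2)[OF that] k'(1) by simp
    have "evaluates V' F {d, s, hu} g"
      unfolding evaluates_def
    proof (intro allI impI ballI)
      fix c e assume c: "proper V' c" and e: "e \<in> {d, s, hu}"
      have "F (cls V' c (c d)) = g d \<and> F (cls V' c (c s)) = g s \<and> F (cls V' c (c hu)) = g hu"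
        using std[OF c] classify[OF x y c] by blast
      then show "F (cls V' c (c e)) = g e" using e by blast
    qed
    then show ?thesis using claws unfolding V'_def by blast
  next
    \<comment> \<open>Here the exceptional colorings exchange the labels of \<open>d\<close> and
      \<open>s\<close>. They also give \<open>m\<close> and \<open>p\<close> the colors of
      \<open>s\<close> and \<open>d\<close>, so the labels stay constant along
      \<open>{hu, m, p}\<close>.\<close>
    assume "L = {d, t, hv}"
    then have k: "\<Phi> (cls V c (c t)) = k t" "\<Phi> (cls V c (c hv)) = k hv" if "proper V c" for c
      using evaluatesD[OF L(2) that] by simp_all
    have k': "k t = g d" "k hv = g s" using k[OF c0(1)] \<Phi>_neq[OF c0] neq_case[OF c0] by simp_all
    have x: "F (cls V' (alt c) (c d)) = g s" if "proper V c" "c s = c t" for c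
    proof (rule flipped[OF _ that])
      show "F (cls V' (alt (flip c)) (c hu)) = g s" if "proper V c" "c s = c t" for c
        using k(2)[OF that(1)] \<Phi>_eq(3)[OF that] k'(2) eq_iff[OF that(1)] that(2) by simp
    qed
    have y: "F (cls V' (alt c) (c s)) = g d" if "proper V c" "c s = c t" for c
      using k(1)[OF that(1)] \<Phi>_eq(2)[OF that] k'(1) that(2) by simp
    define k2 where "k2 = (\<lambda>e. if e = m then g d else if e = p then g s else g hu)"
    have "evaluates V' F {hu, m, p} k2"
      unfolding evaluates_def
    proof (intro allI impI ballI)
      fix c e assume c: "proper V' c" and e: "e \<in> {hu, m, p}"
      have "F (cls V' c (c m)) = g d \<and> F (cls V' c (c p)) = g s \<and> F (cls V' c (c hu)) = g hu"
      proof (cases "c m = c d \<and> c p = c s \<and> c q = c t")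
        case True
        then show ?thesis using std[OF c True] by simp
      next
        case False
        then have "c m = c s \<and> c p = c d" using coloring_types(2)[OF c] by blast
        then show ?thesis using classify[OF x y c False] by metis
      qed
      then show "F (cls V' c (c e)) = k2 e" using e neq hneq unfolding k2_def by auto
    qed
    then show ?thesis unfolding V'_def by blast
  qed
qed

end

lemma dictatorial_square:
  assumes "square V d s hu t hv m p q"
  shows "dictatorial (insert {hu, m, p} (insert {hv, m, q} V))"
proof -
  interpret square V d s hu t hv m p q by (fact assms)
  have "dictatorial V'"
  proof (rule dictatorialI)
    have d3: "distinct [hu, m, p]" "distinct [hv, m, q]" using neq hneq by auto
    show "card K = 3" if "K \<in> V'" for K
      using that dictatorial_card[OF D] d3 unfolding V'_def by auto
    show "\<exists>c. proper V' c" using ex_eq proper_alt by blast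
    show "\<exists>c. proper V' c \<and> c e \<noteq> c f" if "e \<in> \<Union>V'" "f \<in> \<Union>V'" "e \<noteq> f" for e f
      using sep' that .
    show "\<exists>c. proper V' c \<and> c e = c f"
      if "e \<in> \<Union>V'" "f \<in> \<Union>V'" "\<And>K. K \<in> V' \<Longrightarrow> e \<in> K \<Longrightarrow> f \<notin> K" for e f
      using join' that .
    show "\<exists>c. proper V' c \<and> two_equal (c e) (c f) (c g)"
      if "e \<in> \<Union>V'" "f \<in> \<Union>V'" "g \<in> \<Union>V'" "distinct [e, f, g]" "{e, f, g} \<notin> V'" for e f g
      unfolding image_two_equal_iff by (rule triple') (use that in auto)
    show "\<exists>K\<in>V'. \<exists>g. evaluates V' F K g" if F: "valid V' F" for F
    proof -
      obtain K g where K: "K \<in> V" "evaluates V (\<lambda>C. F (pull V' \<kappa> C)) K g"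
        using dictator_pull[OF D claw_map_\<kappa> F] .
      consider "K = {d, s, hu}" | "K = {d, t, hv}" | "K \<noteq> {d, s, hu}" "K \<noteq> {d, t, hv}" by blast
      then show ?thesis
      proof cases
        case 1 then show ?thesis using dict_side[OF F] K(2) by simp
      next
        case 2 then show ?thesis using square.dict_side[OF mirror, unfolded mirror_V' mirror_\<kappa>, OF F] K(2) by simp
      next
        case 3 then show ?thesis using dict_generic[OF F K] K(1) unfolding V'_def by blast
      qed
    qed
  qed
  then show ?thesis unfolding V'_def .
qed


section \<open>Lengthening a path\<close>

text \<open>The vertex \<open>{m, n, q}\<close> is split into \<open>{m, r, p}\<close> and \<open>{r, n, q}\<close>. Every coloring of the new graph is
  pulled back along \<open>\<kappa>a\<close> or \<open>\<kappa>b\<close>, or is \<open>hyb c\<close> for some \<open>c\<close> with \<open>c m \<noteq> c z\<close>; in the last case two of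
  its three classes are pulled back, one along each map.\<close>

locale lengthen =
  fixes V :: "'e set set" and m n q z y r p :: 'e
  assumes D: "dictatorial V"
    and claws: "{m, n, q} \<in> V" "{n, z, y} \<in> V"
    and dist: "distinct [m, n, q, z, y]"
    and n_only: "\<And>L. L \<in> V \<Longrightarrow> n \<in> L \<Longrightarrow> L = {m, n, q} \<or> L = {n, z, y}"
    and q_only: "\<And>L. L \<in> V \<Longrightarrow> q \<in> L \<Longrightarrow> L = {m, n, q}"
    and y_only: "\<And>L. L \<in> V \<Longrightarrow> y \<in> L \<Longrightarrow> L = {n, z, y}"
    and new: "r \<notin> \<Union>V" "p \<notin> \<Union>V" "r \<noteq> p"
begin

definition "V' = insert {m, r, p} (insert {r, n, q} (V - {{m, n, q}}))"
text \<open>\<open>\<kappa>a\<close> folds both parts of the split vertex onto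
  \<open>{m, n, q}\<close> and fixes \<open>{n, z, y}\<close>. The map \<open>\<kappa>b\<close>
  sends \<open>{m, r, p}\<close> to \<open>{m, n, q}\<close> and \<open>{r, n, q}\<close> to
  \<open>{n, y, z}\<close>, and therefore exchanges \<open>n\<close> and \<open>y\<close> in
  \<open>{n, z, y}\<close>.\<close>

definition "\<kappa>a = id(r := q, p := n, q := m)"
definition "\<kappa>b = id(r := n, n := y, p := q, q := z, y := n)"
definition hyb :: "('e \<Rightarrow> color) \<Rightarrow> 'e \<Rightarrow> color" where
  "hyb c = c(n := c m, r := c z, p := c n, q := c n, y := c n)"
text \<open>The Kempe change on the chain \<open>q\<close>, \<open>n\<close>, \<open>y\<close>
  between two half-edges, two-colored if \<open>c m = c z\<close>.\<close>

definition swp :: "('e \<Rightarrow> color) \<Rightarrow> 'e \<Rightarrow> color" where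
  "swp c = c(n := c y, y := c n, q := c n)"

lemma old: "m \<in> \<Union>V" "n \<in> \<Union>V" "q \<in> \<Union>V" "z \<in> \<Union>V" "y \<in> \<Union>V"
  using claws by blast+

lemma neq: "m \<noteq> n" "m \<noteq> q" "m \<noteq> z" "m \<noteq> y" "n \<noteq> q" "n \<noteq> z" "n \<noteq> y" "q \<noteq> z" "q \<noteq> y" "z \<noteq> y" "r \<noteq> p"
  using dist new(3) by auto

lemma old_neq: "e \<in> \<Union>V \<Longrightarrow> e \<noteq> r \<and> e \<noteq> p"
  using new by blast

lemma rneq: "m \<noteq> r" "m \<noteq> p" "n \<noteq> r" "n \<noteq> p" "q \<noteq> r" "q \<noteq> p" "z \<noteq> r" "z \<noteq> p" "y \<noteq> r" "y \<noteq> p"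
  using old_neq old by blast+

lemma UV': "\<Union>V' = insert r (insert p (\<Union>V))"
proof -
  have "\<Union>V = {m, n, q} \<union> \<Union>(V - {{m, n, q}})" using claws(1) by blast
  then show ?thesis unfolding V'_def by auto
qed

lemma N_in: "{n, z, y} \<in> V - {{m, n, q}}"
  using claws(2) neq by (auto simp: set_eq_iff)

lemma dist3: "distinct [m, r, p]" "distinct [r, n, q]" "distinct [m, n, q]" "distinct [n, z, y]"
  using neq rneq by auto

lemma proper': "proper V' c \<longleftrightarrow> c m \<noteq> c r \<and> c m \<noteq> c p \<and> c r \<noteq> c p \<and> c r \<noteq> c n \<and> c r \<noteq> c q \<and> c n \<noteq> c q
    \<and> proper (V - {{m, n, q}}) c"
  unfolding V'_def proper_insert inj_on_triple[OF dist3(1)] inj_on_triple[OF dist3(2)] by blast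

lemma proper_V: "proper V c \<longleftrightarrow> c m \<noteq> c n \<and> c m \<noteq> c q \<and> c n \<noteq> c q \<and> proper (V - {{m, n, q}}) c"
  using proper_insert[of "{m, n, q}" "V - {{m, n, q}}" c]
  unfolding insert_Diff[OF claws(1)] inj_on_triple[OF dist3(3)] by blast

lemma colN: "proper (V - {{m, n, q}}) c \<Longrightarrow> c n \<noteq> c z \<and> c n \<noteq> c y \<and> c z \<noteq> c y"
  unfolding proper_def inj_on_triple[OF dist3(4), symmetric] by (drule bspec[OF _ N_in])

text \<open>Among the claws other than \<open>{m, n, q}\<close>, only \<open>{n, z, y}\<close>
  contains a recolored edge.\<close>

lemma proper_rest_cong:
  assumes c: "proper (V - {{m, n, q}}) c"
    and eq: "\<And>e. e \<noteq> n \<Longrightarrow> e \<noteq> q \<Longrightarrow> e \<noteq> y \<Longrightarrow> e \<noteq> r \<Longrightarrow> e \<noteq> p \<Longrightarrow> c' e = c e"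
    and N: "c' n \<noteq> c' z" "c' n \<noteq> c' y" "c' z \<noteq> c' y"
  shows "proper (V - {{m, n, q}}) c'"
  unfolding proper_def
proof
  fix L assume L: "L \<in> V - {{m, n, q}}"
  show "inj_on c' L"
  proof (cases "L = {n, z, y}")
    case True
    then show ?thesis using N inj_on_triple[OF dist3(4)] by blast
  next
    case False
    then have "n \<notin> L" "q \<notin> L" "y \<notin> L" using L n_only q_only y_only by blast+
    moreover have "r \<notin> L" "p \<notin> L" using L new by blast+
    ultimately have "c' e = c e" if "e \<in> L" for e using that eq by metis
    then show ?thesis using c L inj_on_cong[of L c' c] unfolding proper_def by blast
  qed
qed

lemma col:
  assumes "proper V c"
  shows "c m \<noteq> c n" "c m \<noteq> c q" "c n \<noteq> c q" "c n \<noteq> c z" "c n \<noteq> c y" "c z \<noteq> c y"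
  using assms colN unfolding proper_V by blast+

lemma eq_iff: "proper V c \<Longrightarrow> c m = c z \<longleftrightarrow> c q = c y"
  using color_swap[of "c n" "c m" "c q" "c z" "c y"] col[of c] by metis

lemma neq_case: 
  assumes "proper V c" "c m \<noteq> c z"
  shows "c y = c m" "c q = c z"
proof -
  have "c z = c m \<and> c y = c q \<or> c z = c q \<and> c y = c m"
    by (rule color_pair[of "c n"]) (use col[OF assms(1)] in auto)
  then show "c y = c m" "c q = c z" using assms(2) by metis+
qed

lemma ex_eq: "\<exists>c. proper V c \<and> c m = c z"
proof -
  have "\<exists>c. proper V c \<and> c q = c y"
  proof (rule dictatorial_join[OF D old(3) old(5)])
    fix K assume "K \<in> V" "q \<in> K"
    then show "y \<notin> K" using q_only neq by blast
  qed
  then show ?thesis using eq_iff by blast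
qed

lemma ex_neq: "\<exists>c. proper V c \<and> c m \<noteq> c z"
  using dictatorial_sep[OF D old(1) old(4)] neq by blast

lemma \<kappa>a_simps: "\<kappa>a r = q" "\<kappa>a p = n" "\<kappa>a q = m" "\<kappa>a m = m" "\<kappa>a n = n" "\<kappa>a z = z" "\<kappa>a y = y"
  "e \<in> \<Union>V \<Longrightarrow> e \<noteq> q \<Longrightarrow> \<kappa>a e = e"
  using old_neq[of e] neq rneq unfolding \<kappa>a_def by auto

lemma \<kappa>b_simps: "\<kappa>b r = n" "\<kappa>b p = q" "\<kappa>b q = z" "\<kappa>b m = m" "\<kappa>b n = y" "\<kappa>b z = z" "\<kappa>b y = n"
  "e \<in> \<Union>V \<Longrightarrow> e \<noteq> q \<Longrightarrow> e \<noteq> n \<Longrightarrow> e \<noteq> y \<Longrightarrow> \<kappa>b e = e"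
  using old_neq[of e] neq rneq unfolding \<kappa>b_def by auto

lemma hyb_simps: "hyb c r = c z" "hyb c p = c n" "hyb c q = c n" "hyb c m = c m" "hyb c n = c m" "hyb c z = c z" "hyb c y = c n"
  "e \<in> \<Union>V \<Longrightarrow> e \<noteq> q \<Longrightarrow> e \<noteq> n \<Longrightarrow> e \<noteq> y \<Longrightarrow> hyb c e = c e"
  using old_neq[of e] neq rneq unfolding hyb_def by auto

lemma swp_simps: "swp c m = c m" "swp c n = c y" "swp c z = c z" "swp c y = c n" "swp c q = c n"
  "e \<noteq> q \<Longrightarrow> e \<noteq> n \<Longrightarrow> e \<noteq> y \<Longrightarrow> swp c e = c e"
  using neq unfolding swp_def by auto

lemma claw_map_a: "claw_map V' V \<kappa>a"
proof -
  have "claw_map (V - {{m, n, q}}) V \<kappa>a"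
  proof (rule claw_map_identity)
    fix e assume "e \<in> \<Union>(V - {{m, n, q}})"
    then have "e \<in> \<Union>V" "e \<noteq> q" using q_only by blast+
    then show "\<kappa>a e = e" by (rule \<kappa>a_simps)
  qed auto
  then show ?thesis
    using claws neq rneq unfolding V'_def claw_map_insert
    by (auto simp: inj_on_triple[OF dist3(1)] inj_on_triple[OF dist3(2)] \<kappa>a_simps insert_commute)
qed

lemma claw_map_b: "claw_map V' V \<kappa>b"
proof -
  have "claw_map (V - {{m, n, q}}) V \<kappa>b"
    unfolding claw_map_def
  proof
    fix L assume L: "L \<in> V - {{m, n, q}}"
    show "\<kappa>b ` L \<in> V \<and> inj_on \<kappa>b L"
    proof (cases "L = {n, z, y}")
      case True
      then show ?thesis using claws(2) neq by (auto simp: \<kappa>b_simps insert_commute)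
    next
      case False
      then have "n \<notin> L" "q \<notin> L" "y \<notin> L" using L n_only q_only y_only by blast+
      then have "\<kappa>b e = e" if "e \<in> L" for e using that L by (intro \<kappa>b_simps) auto
      then have "\<kappa>b ` L = L" "inj_on \<kappa>b L" by (simp_all add: inj_on_def)
      then show ?thesis using L by auto
    qed
  qed
  then show ?thesis
    using claws neq rneq unfolding V'_def claw_map_insert
    by (auto simp: inj_on_triple[OF dist3(1)] inj_on_triple[OF dist3(2)] \<kappa>b_simps insert_commute)
qed

lemma proper_hyb:
  assumes "proper V c" "c m \<noteq> c z"
  shows "proper V' (hyb c)"
  unfolding proper'
proof (intro conjI)
  show "proper (V - {{m, n, q}}) (hyb c)"
  proof (rule proper_rest_cong)
    show "proper (V - {{m, n, q}}) c" using assms(1) proper_V by blast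
    show "hyb c e = c e" if "e \<noteq> n" "e \<noteq> q" "e \<noteq> y" "e \<noteq> r" "e \<noteq> p" for e using that unfolding hyb_def by simp
  qed (use col[OF assms(1)] assms(2) in \<open>auto simp: hyb_simps(1-7)\<close>)
qed (use col[OF assms(1)] assms(2) in \<open>auto simp: hyb_simps(1-7)\<close>)

lemma proper_swp:
  assumes "proper V c" "c m = c z"
  shows "proper V (swp c)"
  unfolding proper_V
proof (intro conjI)
  show "proper (V - {{m, n, q}}) (swp c)"
  proof (rule proper_rest_cong)
    show "proper (V - {{m, n, q}}) c" using assms(1) proper_V by blast
    show "swp c e = c e" if "e \<noteq> n" "e \<noteq> q" "e \<noteq> y" for e using that by (intro swp_simps)
  qed (use col[OF assms(1)] assms(2) in \<open>auto simp: swp_simps(1-5)\<close>)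
qed (use col[OF assms(1)] assms(2) in \<open>auto simp: swp_simps(1-5)\<close>)

lemma swp_swp: "proper V c \<Longrightarrow> c m = c z \<Longrightarrow> swp (swp c) = c"
  using eq_iff[of c] neq unfolding swp_def by auto

text \<open>A single coloring, with classes grouping \<open>m, n\<close>, then
  \<open>p, q, z\<close>, and \<open>r, y\<close>, that handles most pairs and triples on which
  \<open>\<kappa>a\<close> is useless.\<close>

lemma ex_b: "\<exists>c. proper V' c \<and> c m = c n \<and> c q = c p \<and> c z = c p \<and> c m \<noteq> c r \<and> c p \<noteq> c r \<and> c y = c r \<and> c n \<noteq> c p \<and> c q \<noteq> c m"
proof -
  obtain c where c: "proper V c" "c m \<noteq> c z" using ex_neq by blast
  show ?thesis
    using proper_pull[OF claw_map_b c(1)] col[OF c(1)] neq_case[OF c] c(2)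
    by (intro exI[of _ "\<lambda>e. c (\<kappa>b e)"]) (auto simp: \<kappa>b_simps(1-7))
qed

lemma fibre:
  assumes "e \<in> \<Union>V'" "f \<in> \<Union>V'" "\<kappa>a e = \<kappa>a f" "e \<noteq> f"
  shows "{e, f} = {p, n} \<or> {e, f} = {q, m}"
proof -
  have "x = r \<or> x = p \<or> x = q \<or> x \<in> \<Union>V \<and> x \<noteq> q" if "x \<in> \<Union>V'" for x using that unfolding UV' by blast
  from this[OF assms(1)] this[OF assms(2)] show ?thesis
    using assms(3,4) neq by (elim disjE) (auto simp: \<kappa>a_simps simp del: Union_iff)
qed

lemma preimage:
  assumes "x \<in> \<Union>V'"
  shows "\<kappa>a x = m \<Longrightarrow> x = m \<or> x = q" "\<kappa>a x = n \<Longrightarrow> x = n \<or> x = p" "\<kappa>a x = q \<Longrightarrow> x = r"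
    "\<kappa>a x = e \<Longrightarrow> e \<noteq> m \<Longrightarrow> e \<noteq> n \<Longrightarrow> e \<noteq> q \<Longrightarrow> x = e"
proof -
  have "x = r \<or> x = p \<or> x = q \<or> x \<in> \<Union>V \<and> x \<noteq> q" using assms unfolding UV' by blast
  then show "\<kappa>a x = m \<Longrightarrow> x = m \<or> x = q" "\<kappa>a x = n \<Longrightarrow> x = n \<or> x = p" "\<kappa>a x = q \<Longrightarrow> x = r"
    "\<kappa>a x = e \<Longrightarrow> e \<noteq> m \<Longrightarrow> e \<noteq> n \<Longrightarrow> e \<noteq> q \<Longrightarrow> x = e"
    using neq by (elim disjE; auto simp: \<kappa>a_simps simp del: Union_iff)+
qed

section \<open>Separating edges after splitting a vertex\<close>

lemma sep':
  assumes "e \<in> \<Union>V'" "f \<in> \<Union>V'" "e \<noteq> f"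
  shows "\<exists>c. proper V' c \<and> c e \<noteq> c f"
proof (cases "\<kappa>a e = \<kappa>a f")
  case True
  then show ?thesis
    using fibre[OF assms(1,2) True assms(3)] ex_b unfolding doubleton_eq_iff by metis
next
  case False
  then show ?thesis by (rule sep_pull[OF D claw_map_a assms(1,2)])
qed

text \<open>\<open>\<kappa>a\<close> sends \<open>q\<close> to \<open>m\<close>, which always
  differs from \<open>f\<close>. For \<open>c m \<noteq> c z\<close> the color of \<open>f\<close>
  is \<open>c z\<close> or \<open>c n\<close>; these are the colors of \<open>q\<close> in the pull
  back along \<open>\<kappa>b\<close> and in the hybrid.\<close>

lemma join_far:
  assumes K: "K \<in> V" "m \<in> K" "f \<in> K" "f \<noteq> m" "K \<noteq> {m, n, q}" "K \<noteq> {n, z, y}"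
  shows "\<exists>c. proper V' c \<and> c q = c f"
proof -
  obtain c where c: "proper V c" "c m \<noteq> c z" using ex_neq by blast
  have f: "f \<in> \<Union>V" "f \<noteq> q" "f \<noteq> n" "f \<noteq> y" using K n_only q_only y_only by blast+
  have "c f \<noteq> c m" using proper_neq[OF c(1) K(1,3,2,4)] .
  then have "c f = c z \<or> c f = c n"
    using color_exhausted[of "c m" "c z" "c n" "c f"] c(2) col[OF c(1)] by metis
  then show ?thesis
  proof
    assume "c f = c z"
    then show ?thesis using proper_pull[OF claw_map_b c(1)] \<kappa>b_simps(3) \<kappa>b_simps(8)[OF f] by metis
  next
    assume "c f = c n"
    then show ?thesis using proper_hyb[OF c] hyb_simps(3) hyb_simps(8)[OF f] by metis
  qed
qed

lemma join':
  assumes e: "e \<in> \<Union>V'" and f: "f \<in> \<Union>V'" and non: "\<And>K. K \<in> V' \<Longrightarrow> e \<in> K \<Longrightarrow> f \<notin> K"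
  shows "\<exists>c. proper V' c \<and> c e = c f"
proof (cases "\<exists>K\<in>V. \<kappa>a e \<in> K \<and> \<kappa>a f \<in> K")
  case False
  then show ?thesis by (intro join_pull[OF D claw_map_a e f]) blast
next
  case True
  then obtain K where K: "K \<in> V" "\<kappa>a e \<in> K" "\<kappa>a f \<in> K" by blast
  obtain c0 where c0: "proper V c0" "c0 m \<noteq> c0 z" using ex_neq by blast
  have mn: "\<exists>c. proper V' c \<and> c m = c n" "\<exists>c. proper V' c \<and> c q = c p" "\<exists>c. proper V' c \<and> c p = c z"
    using ex_b by metis+
  have py: "\<exists>c. proper V' c \<and> c p = c y" using proper_hyb[OF c0] hyb_simps(2,7) by metis
  have same: ?thesis if "\<kappa>a e = \<kappa>a f" using proper_pull[OF claw_map_a c0(1)] that by metis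
  have cl: "{m, r, p} \<in> V'" "{r, n, q} \<in> V'" "{n, z, y} \<in> V'" "V - {{m, n, q}} \<subseteq> V'"
    using N_in unfolding V'_def by auto
  note adj = non[OF cl(1)] non[OF cl(2)] non[OF cl(3)]
  consider "K = {m, n, q}" | "K = {n, z, y}" | "K \<noteq> {m, n, q}" "K \<noteq> {n, z, y}" by blast
  then show ?thesis
  proof cases
    case 1
    have pre: "x = m \<or> x = q \<or> x = n \<or> x = p \<or> x = r" if "x \<in> \<Union>V'" "\<kappa>a x \<in> K" for x
      using preimage[OF that(1)] that(2) unfolding 1 by blast
    have "e = m \<and> (f = n \<or> f = q) \<or> e = n \<and> (f = m \<or> f = p) \<or> e = q \<and> (f = p \<or> f = m) \<or> e = p \<and> (f = q \<or> f = n)"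
      using pre[OF e K(2)] pre[OF f K(3)] adj(1,2) by blast
    moreover have "\<kappa>a q = \<kappa>a m" "\<kappa>a p = \<kappa>a n" by (simp_all add: \<kappa>a_simps(1-7))
    ultimately show ?thesis
      by (elim disjE conjE) (use same mn in metis)+
  next
    case 2
    have pre: "x = n \<or> x = p \<or> x = z \<or> x = y" if "x \<in> \<Union>V'" "\<kappa>a x \<in> K" for x
    proof -
      have "\<kappa>a x = n \<or> \<kappa>a x = z \<or> \<kappa>a x = y" using that(2) unfolding 2 by blast
      then show ?thesis using preimage(2)[OF that(1)] preimage(4)[OF that(1), of z] preimage(4)[OF that(1), of y] neq by metis
    qed
    have "e = p \<and> (f = p \<or> f = n \<or> f = z \<or> f = y) \<or> f = p \<and> (e = n \<or> e = z \<or> e = y)"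
      using pre[OF e K(2)] pre[OF f K(3)] adj(3) by blast
    moreover have "\<kappa>a p = \<kappa>a n" by (simp add: \<kappa>a_simps(1-7))
    ultimately show ?thesis
      by (elim disjE conjE) (use same mn py in metis)+
  next
    case 3
    then have out: "n \<notin> K" "q \<notin> K" "y \<notin> K" using n_only q_only y_only K(1) by blast+
    have pre: "x = \<kappa>a x \<or> x = q \<and> \<kappa>a x = m" if "x \<in> \<Union>V'" "\<kappa>a x \<in> K" for x
    proof -
      have "\<kappa>a x \<noteq> n" "\<kappa>a x \<noteq> q" using that(2) out by auto
      then show ?thesis using preimage(1)[OF that(1)] preimage(4)[OF that(1)] \<kappa>a_simps(3,4) by metis
    qed
    have KV': "K \<in> V'" using K(1) 3(1) unfolding V'_def by blast
    show ?thesis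
    proof (cases "\<kappa>a e = \<kappa>a f")
      case True
      then show ?thesis by (rule same)
    next
      case False
      have "\<not> (e = \<kappa>a e \<and> f = \<kappa>a f)" using non[OF KV'] K by auto
      then consider "e = q" "\<kappa>a e = m" "f = \<kappa>a f" | "f = q" "\<kappa>a f = m" "e = \<kappa>a e"
        using pre[OF e K(2)] pre[OF f K(3)] False by metis
      then show ?thesis
      proof cases
        case 1
        then show ?thesis using join_far[of K f] K 3 False by metis
      next
        case 2
        then show ?thesis using join_far[of K e] K 3 False by metis
      qed
    qed
  qed
qed

text \<open>Over \<open>{m, n, q}\<close> and \<open>{n, z, y}\<close> the coloring of
  \<open>ex_b\<close> works. Over any other claw, \<open>T\<close> contains \<open>q\<close> in
  place of \<open>m\<close>. Pulling back along \<open>\<kappa>b\<close> gives \<open>q\<close> the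
  color of \<open>z\<close>; when this differs from the color of \<open>m\<close>, it repeats the
  color of another edge of \<open>T\<close>.\<close>

lemma triple':
  assumes T: "T \<subseteq> \<Union>V'" "card T = 3" "T \<notin> V'"
  shows "\<exists>c. proper V' c \<and> card (c ` T) = 2"
proof (cases "inj_on \<kappa>a T \<and> \<kappa>a ` T \<in> V")
  case False
  show ?thesis
  proof (rule triple_pull[OF D claw_map_a T(1,2)])
    show "\<kappa>a x \<noteq> \<kappa>a w" if x: "x \<in> T" "x' \<in> T" "w \<in> T" "distinct [x, x', w]" "\<kappa>a x = \<kappa>a x'" for x x' w
    proof
      assume eq: "\<kappa>a x = \<kappa>a w"
      have V: "x \<in> \<Union>V'" "x' \<in> \<Union>V'" "w \<in> \<Union>V'" using x(1-3) T(1) by blast+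
      have ne: "x \<noteq> x'" "x \<noteq> w" "x' \<noteq> w" using x(4) by auto
      show False
        using fibre[OF V(1,2) x(5) ne(1)] fibre[OF V(1,3) eq ne(2)] ne(3) neq rneq
        unfolding doubleton_eq_iff by metis
    qed
  qed (use False in blast)
next
  case inj: True
  then have True: "\<kappa>a ` T \<in> V" by blast
  obtain c where c: "proper V' c" "c m = c n" "c q = c p" "c z = c p" "c m \<noteq> c r" "c p \<noteq> c r" "c y = c r" "c n \<noteq> c p" "c q \<noteq> c m"
    using ex_b by blast
  have cl: "{m, r, p} \<in> V'" "{r, n, q} \<in> V'" "{n, z, y} \<in> V'" "V - {{m, n, q}} \<subseteq> V'"
    using N_in unfolding V'_def by auto
  consider "\<kappa>a ` T = {m, n, q}" | "\<kappa>a ` T = {n, z, y}" | "\<kappa>a ` T \<noteq> {m, n, q}" "\<kappa>a ` T \<noteq> {n, z, y}" by blast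
  then show ?thesis
  proof cases
    case 1
    then obtain u v w where Tuvw: "T = {u, v, w}" and k: "\<kappa>a u = m" "\<kappa>a v = n" "\<kappa>a w = q"
      using image_tripleE[OF T(2) _ dist3(3)] by metis
    have "u \<in> \<Union>V'" "v \<in> \<Union>V'" "w \<in> \<Union>V'" using T(1) unfolding Tuvw by simp_all
    then have "u = m \<or> u = q" "v = n \<or> v = p" "w = r" using preimage k by metis+
    moreover have "T \<noteq> {m, r, p}" "T \<noteq> {r, n, q}" using T(3) cl by auto
    ultimately have "T = {m, n, r} \<or> T = {q, p, r}" unfolding Tuvw by (elim disjE) (simp_all add: insert_commute)
    then show ?thesis
    proof
      assume T': "T = {m, n, r}"
      have "card (c ` T) = 2" unfolding T' using c by (auto simp: card_insert_if)
      then show ?thesis using c(1) by blast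
    next
      assume T': "T = {q, p, r}"
      have "card (c ` T) = 2" unfolding T' using c by (auto simp: card_insert_if)
      then show ?thesis using c(1) by blast
    qed
  next
    case 2
    then obtain u v w where Tuvw: "T = {u, v, w}" and k: "\<kappa>a u = n" "\<kappa>a v = z" "\<kappa>a w = y"
      using image_tripleE[OF T(2) _ dist3(4)] by metis
    have uvw: "u \<in> \<Union>V'" "v \<in> \<Union>V'" "w \<in> \<Union>V'" using T(1) unfolding Tuvw by simp_all
    have "u = n \<or> u = p" "v = z" "w = y"
      using preimage(2)[OF uvw(1) k(1)] preimage(4)[OF uvw(2) k(2)] preimage(4)[OF uvw(3) k(3)] neq by metis+
    moreover have "T \<noteq> {n, z, y}" using T(3) cl by auto
    ultimately have T': "T = {p, z, y}" unfolding Tuvw by auto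
    have "card (c ` T) = 2" unfolding T' using c by (auto simp: card_insert_if)
      then show ?thesis using c(1) by blast
  next
    case 3
    define K where "K = \<kappa>a ` T"
    have K: "K \<in> V" "K \<noteq> {m, n, q}" "K \<noteq> {n, z, y}" using True 3 unfolding K_def by auto
    then have out: "n \<notin> K" "q \<notin> K" "y \<notin> K" using n_only q_only y_only by blast+
    have pre: "x = \<kappa>a x \<or> x = q \<and> \<kappa>a x = m" if "x \<in> T" for x
    proof -
      have "\<kappa>a x \<in> K" using that unfolding K_def by blast
      then have "\<kappa>a x \<noteq> n" "\<kappa>a x \<noteq> q" using out by auto
      then show ?thesis using preimage(1)[OF subsetD[OF T(1) that]] preimage(4)[OF subsetD[OF T(1) that]] \<kappa>a_simps(3,4) by metis
    qed
    have "T \<noteq> K" using K T(3) cl(4) by blast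
    have "q \<in> T"
    proof (rule ccontr)
      assume "q \<notin> T"
      then have "\<kappa>a x = x" if "x \<in> T" for x using pre that by metis
      then have "\<kappa>a ` T = T" by simp
      then show False using \<open>T \<noteq> K\<close> unfolding K_def by simp
    qed
    obtain u v where uv: "T = {q, u, v}" "distinct [q, u, v]"
      using triple_containingE[OF T(2) \<open>q \<in> T\<close>] .
    have "\<kappa>a u = u" "\<kappa>a v = v" using pre uv by (metis distinct_length_2_or_more insertCI)+
    then have Kuv: "K = {m, u, v}" unfolding K_def uv(1) by (simp add: \<kappa>a_simps(3))
    have "card K = 3" using dictatorial_card[OF D K(1)] .
    then have ne: "m \<noteq> u" "m \<noteq> v" "u \<noteq> v" unfolding Kuv by (auto simp: card_insert_if split: if_splits)
    obtain c0 where c0: "proper V c0" "c0 m \<noteq> c0 z" using ex_neq by blast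
    have cuv: "c0 m \<noteq> c0 u" "c0 m \<noteq> c0 v" "c0 u \<noteq> c0 v"
      using proper_neq[OF c0(1) K(1)] ne unfolding Kuv by auto
    then have zz: "c0 z = c0 u \<or> c0 z = c0 v" using color_exhausted[of "c0 m" "c0 u" "c0 v" "c0 z"] c0(2) by metis
    have uvV: "u \<in> \<Union>V" "u \<noteq> q" "u \<noteq> n" "u \<noteq> y" "v \<in> \<Union>V" "v \<noteq> q" "v \<noteq> n" "v \<noteq> y"
      using K(1) out unfolding Kuv by (blast, fast+)
    have "(\<lambda>e. c0 (\<kappa>b e)) ` T = {c0 z, c0 u, c0 v}"
      unfolding uv(1) using \<kappa>b_simps(8)[OF uvV(1-4)] \<kappa>b_simps(8)[OF uvV(5-8)] by (simp add: \<kappa>b_simps(3))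
    then have "card ((\<lambda>e. c0 (\<kappa>b e)) ` T) = 2" using zz cuv(3) by (auto simp: card_insert_if)
    moreover have "proper V' (\<lambda>e. c0 (\<kappa>b e))" using proper_pull[OF claw_map_b c0(1)] .
    ultimately show ?thesis by blast
  qed
qed

section \<open>Classification of the colorings after splitting a vertex\<close>

lemma cover:
  "e \<in> \<Union>V' \<Longrightarrow> e = r \<or> e = p \<or> e = q \<or> e = n \<or> e = y \<or> e \<in> \<Union>V \<and> e \<noteq> q \<and> e \<noteq> n \<and> e \<noteq> y"
  unfolding UV' by blast

text \<open>If \<open>m\<close> and \<open>n\<close> differ, giving \<open>q\<close> the color of
  \<open>r\<close> restores the claw \<open>{m, n, q}\<close> and yields type \<open>a\<close>. If
  \<open>r\<close> and \<open>z\<close> differ, undoing \<open>\<kappa>b\<close> yields type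
  \<open>b\<close>. Only \<open>c' m = c' n\<close> together with \<open>c' r = c' z\<close>
  obstructs both, and this is the hybrid type.\<close>

lemma coloring_types:
  assumes c': "proper V' c'"
  obtains (a) c where "proper V c" "\<And>e. e \<in> \<Union>V' \<Longrightarrow> c' e = c (\<kappa>a e)"
    | (b) c where "proper V c" "\<And>e. e \<in> \<Union>V' \<Longrightarrow> c' e = c (\<kappa>b e)"
    | (h) c where "proper V c" "c m \<noteq> c z" "\<And>e. e \<in> \<Union>V' \<Longrightarrow> c' e = hyb c e"
proof -
  have rest: "proper (V - {{m, n, q}}) c'" using c' unfolding proper' by blast
  have cc: "c' m \<noteq> c' r" "c' m \<noteq> c' p" "c' r \<noteq> c' p" "c' r \<noteq> c' n" "c' r \<noteq> c' q" "c' n \<noteq> c' q"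
    using c' unfolding proper' by blast+
  have cN: "c' n \<noteq> c' z" "c' n \<noteq> c' y" "c' z \<noteq> c' y" using colN[OF rest] by blast+
  consider "c' m \<noteq> c' n" | "c' r \<noteq> c' z" | "c' m = c' n" "c' r = c' z" by blast
  then show thesis
  proof cases
    case 1
    define c where "c = c'(q := c' r)"
    have cs: "c q = c' r" "\<And>e. e \<noteq> q \<Longrightarrow> c e = c' e" unfolding c_def by simp_all
    have pr: "proper V c"
      unfolding proper_V
    proof (intro conjI)
      show "proper (V - {{m, n, q}}) c"
        by (rule proper_rest_cong[OF rest]) (use cs neq cN in auto)
    qed (use cs neq cc 1 in auto)
    have "c' p = c' n" using color_third_unique[of "c' m" "c' r" "c' n" "c' p"] cc 1 by metis
    moreover have "c' q = c' m" using color_third_unique[of "c' r" "c' n" "c' m" "c' q"] cc 1 by metis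
    ultimately have "c' e = c (\<kappa>a e)" if "e \<in> \<Union>V'" for e
      using cover[OF that] neq cs by (elim disjE) (auto simp: \<kappa>a_simps simp del: Union_iff)
    then show thesis using a[OF pr] by blast
  next
    case 2
    define c where "c = c'(n := c' r, y := c' n, q := c' p)"
    have cs: "c n = c' r" "c y = c' n" "c q = c' p" "\<And>e. e \<noteq> n \<Longrightarrow> e \<noteq> y \<Longrightarrow> e \<noteq> q \<Longrightarrow> c e = c' e"
      using neq unfolding c_def by simp_all
    have pr: "proper V c"
      unfolding proper_V
    proof (intro conjI)
      show "proper (V - {{m, n, q}}) c"
        by (rule proper_rest_cong[OF rest]) (use cs neq cN cc 2 in auto)
    qed (use cs neq cc 2 in auto)
    have "c' q = c' z" using color_third_unique[of "c' r" "c' n" "c' z" "c' q"] cc cN 2 by metis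
    moreover have "c' y = c' r" using color_third_unique[of "c' n" "c' z" "c' r" "c' y"] cc cN 2 by metis
    ultimately have "c' e = c (\<kappa>b e)" if "e \<in> \<Union>V'" for e
      using cover[OF that] neq cs by (elim disjE) (auto simp: \<kappa>b_simps simp del: Union_iff)
    then show thesis using b[OF pr] by blast
  next
    case 3
    define c where "c = c'(n := c' p, y := c' m, q := c' z)"
    have cs: "c n = c' p" "c y = c' m" "c q = c' z" "\<And>e. e \<noteq> n \<Longrightarrow> e \<noteq> y \<Longrightarrow> e \<noteq> q \<Longrightarrow> c e = c' e"
      using neq unfolding c_def by simp_all
    have pr: "proper V c"
      unfolding proper_V
    proof (intro conjI)
      show "proper (V - {{m, n, q}}) c"
        by (rule proper_rest_cong[OF rest]) (use cs neq cN cc 3 in auto)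
    qed (use cs neq cc 3 in auto)
    have "c' q = c' p" using color_third_unique[of "c' r" "c' n" "c' p" "c' q"] cc cN 3 by metis
    moreover have "c' y = c' p" using color_third_unique[of "c' n" "c' z" "c' p" "c' y"] cc cN 3 by metis
    ultimately have "c' e = hyb c e" if "e \<in> \<Union>V'" for e
      using cover[OF that] neq cs 3 by (elim disjE) (auto simp: hyb_simps simp del: Union_iff)
    moreover have "c m \<noteq> c z" using cs neq cc 3 by auto
    ultimately show thesis using h[OF pr] by blast
  qed
qed

lemma cls_hyb_m:
  assumes "proper V c" "c m \<noteq> c z"
  shows "cls V' (hyb c) (c m) = pull V' \<kappa>b (cls V c (c m))"
proof -
  have "hyb c e = c m \<longleftrightarrow> c (\<kappa>b e) = c m" if "e \<in> \<Union>V'" for e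
    using cover[OF that] col[OF assms(1)] neq_case[OF assms] assms(2)
    by (elim disjE) (auto simp: \<kappa>b_simps hyb_simps simp del: Union_iff)
  then show ?thesis unfolding cls_pull[OF claw_map_b, symmetric] unfolding cls_def by blast
qed

lemma cls_hyb_z:
  assumes "proper V c" "c m \<noteq> c z"
  shows "cls V' (hyb c) (c z) = pull V' \<kappa>a (cls V c (c z))"
proof -
  have "hyb c e = c z \<longleftrightarrow> c (\<kappa>a e) = c z" if "e \<in> \<Union>V'" for e
    using cover[OF that] col[OF assms(1)] neq_case[OF assms] assms(2)
    by (elim disjE) (auto simp: \<kappa>a_simps hyb_simps simp del: Union_iff)
  then show ?thesis unfolding cls_pull[OF claw_map_a, symmetric] unfolding cls_def by blast
qed

lemma mem_cls: "e \<in> \<Union>V \<Longrightarrow> e \<in> cls V c i \<longleftrightarrow> c e = i"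
  unfolding cls_def by simp

text \<open>The one class of a hybrid that need not be pulled back, written as a function of the old
  class so that \<open>\<Phi>\<close> in \<open>remote_case\<close> can refer to it.\<close>

lemma cls_hyb_n:
  assumes "proper V c" "c m \<noteq> c z"
  shows "cls V' (hyb c) (c n) = cls V c (c n) - {n} \<union> {p, q, y}"
proof -
  have "e \<in> cls V' (hyb c) (c n) \<longleftrightarrow> e \<in> cls V c (c n) - {n} \<union> {p, q, y}" for e
  proof (cases "e = r \<or> e = p \<or> e = q \<or> e = n \<or> e = y")
    case True
    then show ?thesis
      using old neq rneq new col[OF assms(1)] unfolding cls_def UV'
      by (elim disjE) (auto simp: hyb_simps(1-7) simp del: Union_iff)
  next
    case False
    then show ?thesis unfolding cls_def UV' hyb_def by (auto simp del: Union_iff)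
  qed
  then show ?thesis by blast
qed

text \<open>For \<open>c m = c z\<close> the two copies differ only by the Kempe change, so they
  carry the same labels on swapped colorings.\<close>

lemma b_eq_swp_a:
  assumes "proper V c" "c m = c z" "e \<in> \<Union>V'"
  shows "c (\<kappa>b e) = swp c (\<kappa>a e)"
  using cover[OF assms(3)] eq_iff[OF assms(1)] assms(2)
  by (elim disjE) (auto simp: \<kappa>b_simps \<kappa>a_simps swp_simps simp del: Union_iff)

lemma pull_b_eq_pull_a:
  assumes "proper V c" "c m = c z"
  shows "pull V' \<kappa>b (cls V c i) = pull V' \<kappa>a (cls V (swp c) i)"
  unfolding cls_pull[OF claw_map_a, symmetric] cls_pull[OF claw_map_b, symmetric]
  by (rule cls_cong) (rule b_eq_swp_a[OF assms])

end

section \<open>Comparing the dictators of the two copies\<close>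

locale lengthen_coloring = lengthen +
  fixes F Ka ga Kb gb
  assumes F: "valid V' F"
    and Ka: "Ka \<in> V" "evaluates V (\<lambda>C. F (pull V' \<kappa>a C)) Ka ga"
    and Kb: "Kb \<in> V" "evaluates V (\<lambda>C. F (pull V' \<kappa>b C)) Kb gb"
begin

abbreviation "fa c i \<equiv> F (pull V' \<kappa>a (cls V c i))"
abbreviation "fb c i \<equiv> F (pull V' \<kappa>b (cls V c i))"

lemmas va = valid_pull[OF claw_map_a F]
lemmas vb = valid_pull[OF claw_map_b F]
lemmas eva = evaluatesD[OF Ka(2)]
lemmas evb = evaluatesD[OF Kb(2)]

lemma fa_inj: "proper V c \<Longrightarrow> fa c i = fa c j \<longleftrightarrow> i = j"
  using validD[OF va] .

lemma fb_inj: "proper V c \<Longrightarrow> fb c i = fb c j \<longleftrightarrow> i = j"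
  using validD[OF vb] .

lemma swapped: "proper V c \<Longrightarrow> c m = c z \<Longrightarrow> fb c i = fa (swp c) i"
  using pull_b_eq_pull_a by simp

text \<open>For \<open>c m \<noteq> c z\<close> no Kempe change links the copies; validity on the
  hybrid does, since it has one class from each of them.\<close>

lemma hyb_values:
  assumes "proper V c" "c m \<noteq> c z"
  shows "F (cls V' (hyb c) (c m)) = fb c (c m)" "F (cls V' (hyb c) (c z)) = fa c (c z)"
    "fb c (c m) \<noteq> fa c (c z)" "F (cls V' (hyb c) (c n)) \<noteq> fb c (c m)" "F (cls V' (hyb c) (c n)) \<noteq> fa c (c z)"
  using validD[OF F proper_hyb[OF assms]] col[OF assms(1)] assms(2)
  unfolding cls_hyb_m[OF assms, symmetric] cls_hyb_z[OF assms, symmetric] by simp_all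

lemma hyb_third:
  assumes "proper V c" "c m \<noteq> c z" "i \<noteq> fb c (c m)" "i \<noteq> fa c (c z)"
  shows "F (cls V' (hyb c) (c n)) = i"
  using color_third_unique[of "fb c (c m)" "fa c (c z)" i] hyb_values[OF assms(1,2)] assms(3,4) by blast

lemma evaluatesI:
  assumes K: "K \<subseteq> \<Union>V'"
    and a: "\<And>c e. proper V c \<Longrightarrow> e \<in> K \<Longrightarrow> fa c (c (\<kappa>a e)) = g e"
    and b: "\<And>c e. proper V c \<Longrightarrow> e \<in> K \<Longrightarrow> fb c (c (\<kappa>b e)) = g e"
    and h: "\<And>c e. proper V c \<Longrightarrow> c m \<noteq> c z \<Longrightarrow> e \<in> K \<Longrightarrow> F (cls V' (hyb c) (hyb c e)) = g e"
  shows "evaluates V' F K g"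
  unfolding evaluates_def
proof (intro allI impI ballI)
  fix c' e assume c': "proper V' c'" and e: "e \<in> K"
  have e': "e \<in> \<Union>V'" using e K by blast
  show "F (cls V' c' (c' e)) = g e"
    using c'
  proof (cases rule: coloring_types)
    case (a c)
    have "cls V' c' i = cls V' (\<lambda>e. c (\<kappa>a e)) i" for i using a(2) by (rule cls_cong)
    then show ?thesis using assms(2)[OF a(1) e] a(2)[OF e'] cls_pull[OF claw_map_a, of c] by simp
  next
    case (b c)
    have "cls V' c' i = cls V' (\<lambda>e. c (\<kappa>b e)) i" for i using b(2) by (rule cls_cong)
    then show ?thesis using assms(3)[OF b(1) e] b(2)[OF e'] cls_pull[OF claw_map_b, of c] by simp
  next
    case (h c)
    have "cls V' c' i = cls V' (hyb c) i" for i using h(3) by (rule cls_cong)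
    then show ?thesis using assms(4)[OF h(1,2) e] h(3)[OF e'] by simp
  qed
qed

lemma ga_inj: "inj_on ga Ka"
  using evaluates_inj[OF Ka(2) va _ Ka(1)] ex_eq by blast

lemma gb_inj: "inj_on gb Kb"
  using evaluates_inj[OF Kb(2) vb _ Kb(1)] ex_eq by blast

text \<open>The edges are listed so that a hybrid gives them the colors of \<open>m\<close>,
  \<open>z\<close>, \<open>n\<close>. The first two labels come from \<open>fb\<close> and
  \<open>fa\<close>; the third is then forced.\<close>

lemma evaluates_claw:
  assumes K: "{e1, e2, e3} \<in> V'"
    and ab: "\<And>c e. proper V c \<Longrightarrow> e \<in> {e1, e2, e3} \<Longrightarrow> fa c (c (\<kappa>a e)) = g e \<and> fb c (c (\<kappa>b e)) = g e"
    and e: "\<And>c. hyb c e1 = c m" "\<And>c. hyb c e2 = c z" "\<And>c. hyb c e3 = c n"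
    and v: "\<And>c. proper V c \<Longrightarrow> c m \<noteq> c z \<Longrightarrow> fb c (c m) = g e1 \<and> fa c (c z) = g e2"
    and g: "g e3 \<noteq> g e1" "g e3 \<noteq> g e2"
  shows "\<exists>K\<in>V'. \<exists>g. evaluates V' F K g"
proof -
  have "evaluates V' F {e1, e2, e3} g"
  proof (rule evaluatesI)
    show "{e1, e2, e3} \<subseteq> \<Union>V'" using K by blast
    fix c x assume c: "proper V c" and x: "x \<in> {e1, e2, e3}"
    show "fa c (c (\<kappa>a x)) = g x" "fb c (c (\<kappa>b x)) = g x" using ab[OF c x] by simp_all
    assume n: "c m \<noteq> c z"
    have "F (cls V' (hyb c) (c n)) = g e3" using v[OF c n] g by (intro hyb_third[OF c n]) simp_all
    then show "F (cls V' (hyb c) (hyb c x)) = g x"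
      using x v[OF c n] hyb_values(1,2)[OF c n] by (elim insertE) (simp_all add: e)
  qed
  then show ?thesis using K by blast
qed

lemma central_claw:
  assumes "K = {m, n, q} \<or> K = {n, z, y}"
  shows "n \<in> K \<and> (\<exists>w\<in>K. w \<noteq> n \<and> (w = q \<or> w = y))"
  using assms neq by auto

lemma swp_pair:
  assumes "proper V c" "c m = c z" "w = q \<or> w = y"
  shows "swp c w = c n" "c w = swp c n"
  using assms eq_iff[OF assms(1)] by (auto simp: swp_simps)

text \<open>Take \<open>c\<close> with \<open>c m = c z\<close>. A dictator away from
  \<open>n\<close>, \<open>q\<close>, \<open>y\<close> does not notice \<open>swp\<close>, so its
  edge colored \<open>c n\<close> keeps one label. A central dictator contains \<open>n\<close> and
  one of \<open>q\<close>, \<open>y\<close>, whose colors \<open>swp\<close> exchanges. If one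
  dictator were of each kind, these two edges would have equal labels.\<close>

lemma central_iff:
  "Ka = {m, n, q} \<or> Ka = {n, z, y} \<longleftrightarrow> Kb = {m, n, q} \<or> Kb = {n, z, y}"
proof -
  obtain c where c: "proper V c" "c m = c z" using ex_eq by blast
  have c2: "proper V (swp c)" "swp c m = swp c z" using proper_swp[OF c] c(2) by (simp_all add: swp_simps)
  have sw: "fb c i = fa (swp c) i" "fb (swp c) i = fa c i" for i
    using swapped[OF c] swapped[OF c2] swp_swp[OF c] by simp_all
  have out: "n \<notin> K" "q \<notin> K" "y \<notin> K" if "K \<in> V" "\<not> (K = {m, n, q} \<or> K = {n, z, y})" for K
    using that n_only q_only y_only by blast+
  show ?thesis
  proof (rule iffI; rule ccontr)
    assume A: "Ka = {m, n, q} \<or> Ka = {n, z, y}" and B: "\<not> (Kb = {m, n, q} \<or> Kb = {n, z, y})"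
    obtain w where w: "n \<in> Ka" "w \<in> Ka" "w \<noteq> n" "w = q \<or> w = y" using central_claw[OF A] by blast
    obtain e where e: "e \<in> Kb" "c e = c n" using proper_surj[OF c(1) Kb(1) dictatorial_card[OF D Kb(1)]] by blast
    have se: "swp c e = c n" using e out[OF Kb(1) B] swp_simps(6)[of e c] by metis
    have "ga n = gb e" using eva[OF c(1) w(1)] evb[OF c2(1) e(1)] sw(2) se by simp
    moreover have "ga w = gb e" using eva[OF c2(1) w(2)] evb[OF c(1) e(1)] sw(1) e(2) swp_pair(1)[OF c w(4)] by simp
    ultimately show False using ga_inj w(1-3) unfolding inj_on_def by metis
  next
    assume B: "Kb = {m, n, q} \<or> Kb = {n, z, y}" and A: "\<not> (Ka = {m, n, q} \<or> Ka = {n, z, y})"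
    obtain w where w: "n \<in> Kb" "w \<in> Kb" "w \<noteq> n" "w = q \<or> w = y" using central_claw[OF B] by blast
    obtain e where e: "e \<in> Ka" "c e = c n" using proper_surj[OF c(1) Ka(1) dictatorial_card[OF D Ka(1)]] by blast
    have se: "swp c e = c n" using e out[OF Ka(1) A] swp_simps(6)[of e c] by metis
    have "gb n = ga e" using evb[OF c(1) w(1)] eva[OF c2(1) e(1)] sw(1) se by simp
    moreover have "gb w = ga e" using evb[OF c2(1) w(2)] eva[OF c(1) e(1)] sw(2) e(2) swp_pair(1)[OF c w(4)] by simp
    ultimately show False using gb_inj w(1-3) unfolding inj_on_def by metis
  qed
qed

text \<open>The dictator is \<open>{m, r, p}\<close> if \<open>Ka\<close> and \<open>Kb\<close> are
  both \<open>{m, n, q}\<close>, it is \<open>{r, n, q}\<close> if only \<open>Ka\<close> is, and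
  \<open>{n, z, y}\<close> if neither is. The fourth combination would give the classes of
  \<open>m\<close> and \<open>z\<close> in a hybrid the same label.\<close>

lemma central_case:
  assumes "Ka = {m, n, q} \<or> Ka = {n, z, y}"
  shows "\<exists>K\<in>V'. \<exists>g. evaluates V' F K g"
proof -
  have cl: "{m, r, p} \<in> V'" "{r, n, q} \<in> V'" "{n, z, y} \<in> V'"
    using N_in unfolding V'_def by auto
  obtain c1 where c1: "proper V c1" "c1 m = c1 z" using ex_eq by blast
  have c2: "proper V (swp c1)" using proper_swp[OF c1] .
  note sw = swapped[OF c1]
  have yq: "c1 q = c1 y" using eq_iff[OF c1(1)] c1(2) by blast
  have gain: "ga e \<noteq> ga f" if "e \<in> Ka" "f \<in> Ka" "e \<noteq> f" for e f
    using ga_inj that unfolding inj_on_def by blast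
  have Kb_cases: "Kb = {m, n, q} \<or> Kb = {n, z, y}" using central_iff assms by blast
  show ?thesis
    using assms
  proof
    assume A: "Ka = {m, n, q}"
    have a: "fa c (c m) = ga m" "fa c (c n) = ga n" "fa c (c q) = ga q" if "proper V c" for c
      using eva[OF that] unfolding A by blast+
    have ne: "ga m \<noteq> ga n" "ga m \<noteq> ga q" "ga n \<noteq> ga q" using gain neq unfolding A by blast+
    show ?thesis
      using Kb_cases
    proof
      assume B: "Kb = {m, n, q}"
      have b: "fb c (c m) = gb m" "fb c (c n) = gb n" "fb c (c q) = gb q" if "proper V c" for c
        using evb[OF that] unfolding B by blast+
      have g: "gb m = ga m" "gb n = ga q" "gb q = ga n"
        using a[OF c2] b[OF c1(1)] sw yq by (simp_all add: swp_simps)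
      define k where "k = (\<lambda>e. if e = m then ga m else if e = r then ga q else ga n)"
      have k: "k m = ga m" "k r = ga q" "k p = ga n" using rneq neq unfolding k_def by simp_all
      have v: "fb c (c m) = k m \<and> fa c (c z) = k r" if c: "proper V c" "c m \<noteq> c z" for c
        using a[OF c(1)] b[OF c(1)] g k neq_case[OF c] by simp
      show ?thesis
        by (rule evaluates_claw[of m r p k]) (use cl a b g k ne v in \<open>auto simp: \<kappa>a_simps(1-7) \<kappa>b_simps(1-7) hyb_simps(1-7)\<close>)
    next
      assume B: "Kb = {n, z, y}"
      have b: "fb c (c n) = gb n" "fb c (c z) = gb z" "fb c (c y) = gb y" if "proper V c" for c
        using evb[OF that] unfolding B by blast+
      have g: "gb z = ga m" "gb n = ga q" "gb y = ga n"
        using a[OF c2] b[OF c1(1)] sw yq c1(2) by (simp_all add: swp_simps)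
      define k where "k = (\<lambda>e. if e = r then ga q else if e = n then ga n else ga m)"
      have k: "k r = ga q" "k n = ga n" "k q = ga m" using rneq neq unfolding k_def by auto
      have v: "fb c (c m) = k n \<and> fa c (c z) = k r" if c: "proper V c" "c m \<noteq> c z" for c
        using a[OF c(1)] b[OF c(1)] g k neq_case[OF c] by simp
      show ?thesis
        by (rule evaluates_claw[of n r q k]) (use cl a b g k ne v in \<open>auto simp: \<kappa>a_simps(1-7) \<kappa>b_simps(1-7) hyb_simps(1-7) insert_commute\<close>)
    qed
  next
    assume A: "Ka = {n, z, y}"
    have a: "fa c (c n) = ga n" "fa c (c z) = ga z" "fa c (c y) = ga y" if "proper V c" for c
      using eva[OF that] unfolding A by blast+
    have ne: "ga n \<noteq> ga z" "ga n \<noteq> ga y" "ga z \<noteq> ga y" using gain neq unfolding A by blast+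
    show ?thesis
      using Kb_cases
    proof
      assume B: "Kb = {m, n, q}"
      have b: "fb c (c m) = gb m" if "proper V c" for c
        using evb[OF that] unfolding B by blast
      have g: "gb m = ga z"
        using a(2)[OF c2] b[OF c1(1)] sw c1(2) by (simp add: swp_simps)
      obtain c where c: "proper V c" "c m \<noteq> c z" using ex_neq by blast
      have False using hyb_values(3)[OF c] b[OF c(1)] a(2)[OF c(1)] g by simp
      then show ?thesis ..
    next
      assume B: "Kb = {n, z, y}"
      have b: "fb c (c n) = gb n" "fb c (c z) = gb z" "fb c (c y) = gb y" if "proper V c" for c
        using evb[OF that] unfolding B by blast+
      have g: "gb z = ga z" "gb n = ga y" "gb y = ga n"
        using a[OF c2] b[OF c1(1)] sw by (simp_all add: swp_simps)
      have v: "fb c (c m) = ga n \<and> fa c (c z) = ga z" if c: "proper V c" "c m \<noteq> c z" for c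
        using a[OF c(1)] b[OF c(1)] g neq_case[OF c] by simp
      show ?thesis
        by (rule evaluates_claw[of n z y ga]) (use cl a b g ne v in \<open>auto simp: \<kappa>a_simps(1-7) \<kappa>b_simps(1-7) hyb_simps(1-7)\<close>)
    qed
  qed
qed

lemma remote_case:
  assumes A: "\<not> (Ka = {m, n, q} \<or> Ka = {n, z, y})"
  shows "\<exists>K\<in>V'. \<exists>g. evaluates V' F K g"
proof -
  have B: "\<not> (Kb = {m, n, q} \<or> Kb = {n, z, y})" using A central_iff by blast
  have outa: "n \<notin> Ka" "q \<notin> Ka" "y \<notin> Ka" using A Ka(1) n_only q_only y_only by blast+
  have surj: "\<exists>e\<in>Ka. c e = i" if "proper V c" for c i
    using proper_surj[OF that Ka(1) dictatorial_card[OF D Ka(1)]] .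
  \<comment> \<open>The Kempe change relating the copies does not recolor \<open>Ka\<close>, so the
    values are the same.\<close>
  have E: "fb c i = fa c i" if c: "proper V c" "c m = c z" for c i
  proof -
    obtain e where e: "e \<in> Ka" "c e = i" using surj[OF c(1)] by blast
    have "swp c e = i" using e outa swp_simps(6)[of e c] by metis
    then show ?thesis using swapped[OF c] eva[OF proper_swp[OF c] e(1)] eva[OF c(1) e(1)] e(2) by simp
  qed
  \<comment> \<open>A hybrid that agrees with \<open>fb\<close> on the classes containing \<open>y\<close> and with \<open>fa\<close> on those containing \<open>q\<close>;
    its dictator therefore equals both \<open>Kb\<close> and \<open>Ka\<close>.\<close>
  define \<Phi> where "\<Phi> C = (if m \<in> C \<and> z \<notin> C then F (pull V' \<kappa>b C)
      else if \<exists>c. proper V c \<and> c m \<noteq> c z \<and> C = cls V c (c n) then F (C - {n} \<union> {p, q, y})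
      else F (pull V' \<kappa>a C))" for C
  have nclass: "m \<notin> C \<and> z \<notin> C \<and> y \<notin> C \<and> q \<notin> C \<and> n \<in> C"
    if "proper V c \<and> c m \<noteq> c z \<and> C = cls V c (c n)" for c C
    using that col[of c] old by (auto simp: mem_cls simp del: Union_iff)
  have \<Phi>_neq: "\<Phi> (cls V c (c m)) = fb c (c m)" "\<Phi> (cls V c (c z)) = fa c (c z)"
    "\<Phi> (cls V c (c n)) = F (cls V' (hyb c) (c n))" if c: "proper V c" "c m \<noteq> c z" for c
  proof -
    show "\<Phi> (cls V c (c m)) = fb c (c m)"
      using c(2) old unfolding \<Phi>_def by (simp add: mem_cls del: Union_iff)
    have "z \<in> cls V c (c z)" using old(4) by (simp add: mem_cls del: Union_iff)
    then show "\<Phi> (cls V c (c z)) = fa c (c z)"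
      using nclass unfolding \<Phi>_def by (metis (no_types, lifting))
    have "m \<notin> cls V c (c n)" using nclass c by blast
    then show "\<Phi> (cls V c (c n)) = F (cls V' (hyb c) (c n))"
      unfolding cls_hyb_n[OF c] \<Phi>_def using c by auto
  qed
  \<comment> \<open>A set may be a class of a coloring with \<open>c m = c z\<close> and also the
    class of \<open>n\<close> in one with \<open>c2 m \<noteq> c2 z\<close>. The second branch of
    \<open>\<Phi>\<close> must then give the value of \<open>fa\<close>. By \<open>E\<close> both
    copies agree on this set, so injectivity excludes the other two labels of the hybrid.\<close>
  have hyb_eq: "F (cls V' (hyb c2) (c2 n)) = fa c (c n)"
    if c: "proper V c" "c m = c z" and c2: "proper V c2" "c2 m \<noteq> c2 z" and eq: "cls V c (c n) = cls V c2 (c2 n)" for c c2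
  proof (rule hyb_third[OF c2])
    show "fa c (c n) \<noteq> fb c2 (c2 m)"
      using E[OF c, of "c n"] fb_inj[OF c2(1), of "c2 n" "c2 m"] col[OF c2(1)] unfolding eq by metis
    show "fa c (c n) \<noteq> fa c2 (c2 z)"
      using fa_inj[OF c2(1), of "c2 n" "c2 z"] col[OF c2(1)] unfolding eq by metis
  qed
  have \<Phi>_eq: "\<Phi> (cls V c i) = fa c i" if c: "proper V c" "c m = c z" for c i
  proof (cases "\<exists>c'. proper V c' \<and> c' m \<noteq> c' z \<and> cls V c i = cls V c' (c' n)")
    case True
    then obtain c' where c': "proper V c'" "c' m \<noteq> c' z" "cls V c i = cls V c' (c' n)" by blast
    then have mem: "n \<in> cls V c i" "m \<notin> cls V c i" using nclass by blast+
    then have i: "i = c n" using old(2) by (simp add: mem_cls del: Union_iff)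
    have "\<Phi> (cls V c i) = F (cls V c i - {n} \<union> {p, q, y})" using mem True unfolding \<Phi>_def by simp
    also have "\<dots> = F (cls V' (hyb c') (c' n))" unfolding cls_hyb_n[OF c'(1,2)] c'(3) ..
    also have "\<dots> = fa c i" using hyb_eq[OF c c'(1,2)] c'(3) unfolding i by blast
    finally show ?thesis .
  next
    case False
    have "\<not> (m \<in> cls V c i \<and> z \<notin> cls V c i)" using c(2) old by (simp add: mem_cls del: Union_iff)
    then show ?thesis unfolding \<Phi>_def if_not_P[OF \<open>\<not> (m \<in> cls V c i \<and> z \<notin> cls V c i)\<close>] if_not_P[OF False] by simp
  qed
  have "valid V \<Phi>"
    unfolding valid_def
  proof (intro allI impI injI)
    fix c i j assume c: "proper V c" and eq: "\<Phi> (cls V c i) = \<Phi> (cls V c j)"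
    show "i = j"
    proof (cases "c m = c z")
      case True
      then show ?thesis using eq fa_inj[OF c] \<Phi>_eq[OF c] by metis
    next
      case False
      have ex: "k = c m \<or> k = c z \<or> k = c n" for k
        using color_exhausted[of "c m" "c z" "c n" k] col[OF c] False by metis
      show ?thesis
        using ex[of i] ex[of j] eq hyb_values(3-5)[OF c False] unfolding \<Phi>_neq[OF c False, symmetric] by metis
    qed
  qed
  then obtain L k where L: "L \<in> V" "evaluates V \<Phi> L k" using dictatorial_dict[OF D] by blast
  \<comment> \<open>If \<open>c m \<noteq> c z\<close>, then \<open>y\<close> has the color of
    \<open>m\<close> and \<open>q\<close> that of \<open>z\<close>; these are the classes on which
    \<open>\<Phi>\<close> follows \<open>fb\<close> and \<open>fa\<close>.\<close>
  have agree_y: "fb c (c y) = \<Phi> (cls V c (c y))" and agree_q: "fa c (c q) = \<Phi> (cls V c (c q))" if "proper V c" for c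
    using E[OF that] \<Phi>_eq[OF that] \<Phi>_neq(1,2)[OF that] neq_case[OF that] by (cases "c m = c z"; simp)+
  have ne: "Ka \<noteq> {m, n, q}" "Kb \<noteq> {n, z, y}" using A B by blast+
  have \<Phi>b: "\<Phi> (cls V c i) = fb c i" if "proper V c" for c i
    by (rule half_edge_determines_evaluation[where h = y, symmetric, OF D claws(2) _ y_only Kb(2) vb Kb(1) ne(2)
          L(2) \<open>valid V \<Phi>\<close> L(1) agree_y that]) simp
  have \<Phi>a: "\<Phi> (cls V c i) = fa c i" if "proper V c" for c i
    by (rule half_edge_determines_evaluation[where h = q, symmetric, OF D claws(1) _ q_only Ka(2) va Ka(1) ne(1)
          L(2) \<open>valid V \<Phi>\<close> L(1) agree_q that]) simp
  have same: "fb c i = fa c i" if "proper V c" for c i using \<Phi>a[OF that] \<Phi>b[OF that] by simp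
  have Ka': "Ka \<in> V'" using Ka(1) A unfolding V'_def by blast
  have old_e: "e \<in> \<Union>V" "e \<noteq> q" "e \<noteq> n" "e \<noteq> y" if "e \<in> Ka" for e using that Ka(1) outa by blast+
  have "evaluates V' F Ka ga"
  proof (rule evaluatesI)
    show "Ka \<subseteq> \<Union>V'" using Ka' by blast
    fix c e assume c: "proper V c" and e: "e \<in> Ka"
    note fixed = \<kappa>a_simps(8)[OF old_e(1,2)[OF e]] \<kappa>b_simps(8)[OF old_e[OF e]] hyb_simps(8)[OF old_e[OF e]]
    show "fa c (c (\<kappa>a e)) = ga e" "fb c (c (\<kappa>b e)) = ga e"
      using eva[OF c e] same[OF c] unfolding fixed by simp_all
    assume n: "c m \<noteq> c z"
    have "F (cls V' (hyb c) (c n)) = fa c (c n)"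
      using same[OF c] fa_inj[OF c] col[OF c] by (intro hyb_third[OF c n]) simp_all
    moreover have "c e = c m \<or> c e = c z \<or> c e = c n"
      using color_exhausted[of "c m" "c z" "c n" "c e"] col[OF c] n by metis
    ultimately have "F (cls V' (hyb c) (c e)) = fa c (c e)"
      using hyb_values(1,2)[OF c n] same[OF c] by metis
    then show "F (cls V' (hyb c) (hyb c e)) = ga e" using eva[OF c e] unfolding fixed by simp
  qed
  then show ?thesis using Ka' by blast
qed

end

lemma dictatorial_lengthen:
  assumes "lengthen V m n q z y r p"
  shows "dictatorial (insert {m, r, p} (insert {r, n, q} (V - {{m, n, q}})))"
proof -
  interpret lengthen V m n q z y r p by (fact assms)
  have "dictatorial V'"
  proof (rule dictatorialI)
    show "card K = 3" if "K \<in> V'" for K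
      using that dictatorial_card[OF D] dist3(1,2) unfolding V'_def by auto
    show "\<exists>c. proper V' c" using ex_b by blast
    show "\<exists>c. proper V' c \<and> c e \<noteq> c f" if "e \<in> \<Union>V'" "f \<in> \<Union>V'" "e \<noteq> f" for e f
      using sep' that .
    show "\<exists>c. proper V' c \<and> c e = c f"
      if "e \<in> \<Union>V'" "f \<in> \<Union>V'" "\<And>K. K \<in> V' \<Longrightarrow> e \<in> K \<Longrightarrow> f \<notin> K" for e f
      using join' that .
    show "\<exists>c. proper V' c \<and> two_equal (c e) (c f) (c g)"
      if "e \<in> \<Union>V'" "f \<in> \<Union>V'" "g \<in> \<Union>V'" "distinct [e, f, g]" "{e, f, g} \<notin> V'" for e f g
      unfolding image_two_equal_iff by (rule triple') (use that in auto)
    show "\<exists>K\<in>V'. \<exists>g. evaluates V' F K g" if F: "valid V' F" for F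
    proof -
      obtain Ka ga where Ka: "Ka \<in> V" "evaluates V (\<lambda>C. F (pull V' \<kappa>a C)) Ka ga"
        using dictator_pull[OF D claw_map_a F] .
      obtain Kb gb where Kb: "Kb \<in> V" "evaluates V (\<lambda>C. F (pull V' \<kappa>b C)) Kb gb"
        using dictator_pull[OF D claw_map_b F] .
      interpret lengthen_coloring V m n q z y r p F Ka ga Kb gb
        by unfold_locales (fact F Ka Kb)+
      show ?thesis using central_case remote_case by blast
    qed
  qed
  then show ?thesis unfolding V'_def .
qed


section \<open>Attaching an ear\<close>

text \<open>\<open>m\<close> and \<open>z\<close> are the edges leading into and out of the path. A
  pair \<open>(p, m')\<close> holds the third edge at a path vertex and the edge to the next vertex,
  and \<open>q\<close> is the third edge at the last vertex. A list of length k thus encodes k + 1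
  vertices.\<close>

fun ear :: "'e \<Rightarrow> ('e \<times> 'e) list \<Rightarrow> 'e \<Rightarrow> 'e \<Rightarrow> 'e set set" where
  "ear m [] q z = {{m, q, z}}"
| "ear m ((p, m') # xs) q z = insert {m, p, m'} (ear m' xs q z)"

fun ear_new :: "('e \<times> 'e) list \<Rightarrow> 'e \<Rightarrow> 'e list" where
  "ear_new [] q = [q]"
| "ear_new ((p, m') # xs) q = p # m' # ear_new xs q"

lemma Union_ear: "\<Union>(ear m xs q z) = {m, z} \<union> set (ear_new xs q)"
  by (induction m xs q z rule: ear.induct) auto

text \<open>Supplies the neighboring claw that \<open>lengthen\<close> requires: \<open>y\<close> is
  the half-edge at the first vertex of the remaining ear and \<open>w\<close> the edge by which the
  ear continues.\<close>

lemma ear_head: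
  assumes "m \<noteq> z" "m \<notin> set (ear_new ys q)" "z \<notin> set (ear_new ys q)" "distinct (ear_new ys q)"
  obtains w y where "{m, w, y} \<in> ear m ys q z" "distinct [m, w, y]" "y \<in> set (ear_new ys q)"
    "w \<in> set (ear_new ys q) \<or> w = z" "\<And>L. L \<in> ear m ys q z \<Longrightarrow> m \<in> L \<or> y \<in> L \<Longrightarrow> L = {m, w, y}"
proof (cases ys)
  case Nil
  show thesis by (rule that[of z q]) (use assms Nil in auto)
next
  case (Cons a zs)
  obtain p m' where a: "a = (p, m')" by force
  have "m \<notin> \<Union>(ear m' zs q z)" "p \<notin> \<Union>(ear m' zs q z)"
    unfolding Union_ear using assms Cons a by auto
  then show thesis
    by (intro that[of m' p]) (use assms Cons a in auto)
qed

text \<open>A list of length one is the quadrangle step. A longer ear arises from the ear without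
  its first pair by splitting \<open>{hu, m2, p2}\<close> into \<open>{hu, m1, p1}\<close> and
  \<open>{m1, m2, p2}\<close>.\<close>

lemma dictatorial_ear:
  assumes V: "dictatorial V" "{d, s, hu} \<in> V" "{d, t, hv} \<in> V" "distinct [d, s, hu, t, hv]"
    and d_only: "\<And>L. L \<in> V \<Longrightarrow> d \<in> L \<Longrightarrow> L = {d, s, hu} \<or> L = {d, t, hv}"
    and hu_only: "\<And>L. L \<in> V \<Longrightarrow> hu \<in> L \<Longrightarrow> L = {d, s, hu}"
    and hv_only: "\<And>L. L \<in> V \<Longrightarrow> hv \<in> L \<Longrightarrow> L = {d, t, hv}"
    and "xs \<noteq> []" "distinct (ear_new xs q)" "set (ear_new xs q) \<inter> \<Union>V = {}"
  shows "dictatorial (V \<union> ear hu xs q hv)"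
  using assms(8-10)
proof (induction xs rule: induct_list012)
  case (2 a)
  obtain p m where a: "a = (p, m)" by force
  have "square V d s hu t hv m p q"
  proof (rule square.intro)
    show "dictatorial V" "{d, s, hu} \<in> V" "{d, t, hv} \<in> V" "distinct [d, s, hu, t, hv]" by (fact V)+
    show "L = {d, s, hu} \<or> L = {d, t, hv}" if "L \<in> V" "d \<in> L" for L using d_only that .
    show "L = {d, s, hu}" if "L \<in> V" "hu \<in> L" for L using hu_only that .
    show "L = {d, t, hv}" if "L \<in> V" "hv \<in> L" for L using hv_only that .
    show "m \<notin> \<Union>V" "p \<notin> \<Union>V" "q \<notin> \<Union>V" "distinct [m, p, q]" using 2(2,3) unfolding a by auto
  qed
  then have "dictatorial (insert {hu, m, p} (insert {hv, m, q} V))" by (rule dictatorial_square)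
  moreover have "insert {hu, m, p} (insert {hv, m, q} V) = V \<union> ear hu [a] q hv"
    unfolding a by (auto simp: insert_commute)
  ultimately show ?case by simp
next
  case (3 a b ys)
  obtain p1 m1 p2 m2 where ab: "a = (p1, m1)" "b = (p2, m2)" by (metis surj_pair)
  have fresh: "p1 \<notin> \<Union>V" "m1 \<notin> \<Union>V" "p2 \<notin> \<Union>V" "m2 \<notin> \<Union>V" "set (ear_new ys q) \<inter> \<Union>V = {}"
    and dist: "distinct (p1 # m1 # p2 # m2 # ear_new ys q)"
    using 3 ab by auto
  have hV: "hu \<in> \<Union>V" "hv \<in> \<Union>V" using V by blast+
  define V0 where "V0 = V \<union> ear hu (b # ys) q hv"
  have "dictatorial V0"
    unfolding V0_def by (rule 3(2)) (use dist fresh ab in auto)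
  have m2: "m2 \<noteq> hv" "m2 \<notin> set (ear_new ys q)" "hv \<notin> set (ear_new ys q)" "distinct (ear_new ys q)"
    using fresh dist hV by auto
  obtain w y where wy: "{m2, w, y} \<in> ear m2 ys q hv" "distinct [m2, w, y]" "y \<in> set (ear_new ys q)"
    "w \<in> set (ear_new ys q) \<or> w = hv" "\<And>L. L \<in> ear m2 ys q hv \<Longrightarrow> m2 \<in> L \<or> y \<in> L \<Longrightarrow> L = {m2, w, y}"
    using ear_head[OF m2] by blast
  have V0: "V0 = insert {hu, m2, p2} (V \<union> ear m2 ys q hv)"
    unfolding V0_def ab by (auto simp: insert_commute)
  have U: "\<Union>(ear m2 ys q hv) = {m2, hv} \<union> set (ear_new ys q)" by (rule Union_ear)
  have UV0: "\<Union>V0 = insert p2 (insert m2 (\<Union>V \<union> set (ear_new ys q)))"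
    unfolding V0 using U hV by auto
  have p2_out: "p2 \<notin> \<Union>(V \<union> ear m2 ys q hv)" using fresh dist U hV by auto
  have yV: "y \<notin> \<Union>V" "y \<noteq> p2" "y \<noteq> hu" "y \<noteq> hv" using wy(3) fresh dist hV by auto
  have huhv: "hu \<noteq> hv" using V(4) by simp
  have hu_new: "hu \<noteq> m2" "hu \<noteq> p2" "hu \<notin> set (ear_new ys q)" "hv \<noteq> p2" using hV fresh by auto
  have "lengthen V0 hu m2 p2 w y m1 p1"
  proof (rule lengthen.intro)
    show "dictatorial V0" by fact
    show "{hu, m2, p2} \<in> V0" "{m2, w, y} \<in> V0" using wy(1) unfolding V0 by blast+
    show "distinct [hu, m2, p2, w, y]" using wy(2-4) dist hu_new huhv yV by auto
    show "L = {hu, m2, p2} \<or> L = {m2, w, y}" if "L \<in> V0" "m2 \<in> L" for L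
      using that wy(5)[of L] fresh unfolding V0 by blast
    show "L = {hu, m2, p2}" if "L \<in> V0" "p2 \<in> L" for L
      using that p2_out unfolding V0 by blast
    show "L = {m2, w, y}" if "L \<in> V0" "y \<in> L" for L
    proof -
      have "L \<noteq> {hu, m2, p2}" using that(2) yV m2(2) wy(3) by auto
      then show ?thesis using that wy(5)[of L] yV unfolding V0 by blast
    qed
    show "m1 \<notin> \<Union>V0" "p1 \<notin> \<Union>V0" "m1 \<noteq> p1" unfolding UV0 using fresh dist by auto
  qed
  then have "dictatorial (insert {hu, m1, p1} (insert {m1, m2, p2} (V0 - {{hu, m2, p2}})))"
    by (rule dictatorial_lengthen)
  moreover have "V0 - {{hu, m2, p2}} = V \<union> ear m2 ys q hv"
    unfolding V0 using p2_out by blast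
  moreover have "insert {hu, m1, p1} (insert {m1, m2, p2} (V \<union> ear m2 ys q hv)) = V \<union> ear hu (a # b # ys) q hv"
    unfolding ab by (auto simp: insert_commute)
  ultimately show ?case by simp
qed simp


section \<open>Growing a triangle-free theta-free cubic graph\<close>

definition star :: "('v, 'e) hgraph \<Rightarrow> 'v \<Rightarrow> 'e set" where
  "star G v = {e \<in> edges G. v \<in> ends G e}"

text \<open>Required of every path that leaves and returns, not only of a shortest one: the paths
  that are shortest change as the set grows.\<close>

definition tight :: "('v, 'e) hgraph \<Rightarrow> 'v set \<Rightarrow> bool" where
  "tight G A \<longleftrightarrow> (\<forall>u v ws. u \<in> A \<longrightarrow> v \<in> A \<longrightarrow> u \<noteq> v \<longrightarrow> ws \<noteq> [] \<longrightarrow> distinct ws \<longrightarrow> set ws \<inter> A = {} \<longrightarrow>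
     successively (adjacent G) (u # ws @ [v]) \<longrightarrow> adjacent G u v)"

locale cubic =
  fixes G :: "('v, 'e) hgraph"
  assumes cubic: "cubic_graph G"
begin

lemma half_edge: "half_edge_graph G"
  using cubic unfolding cubic_graph_def by blast

lemma card_star: "v \<in> verts G \<Longrightarrow> card (star G v) = 3"
  using cubic unfolding cubic_graph_def star_def by blast

lemma adj_sym: "adjacent G u v \<longleftrightarrow> adjacent G v u"
  unfolding adjacent_def by (metis insert_commute)

lemma adj_flip: "(\<lambda>x y. adjacent G y x) = adjacent G"
  using adj_sym by blast

lemma adj_verts: "adjacent G u v \<Longrightarrow> u \<in> verts G \<and> v \<in> verts G \<and> u \<noteq> v"
  using adjacentD[OF half_edge] by blast

lemma ends_eq:
  assumes "e \<in> edges G" "u \<in> ends G e" "v \<in> ends G e" "u \<noteq> v"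
  shows "ends G e = {u, v}"
proof -
  have "card (ends G e) = 1 \<or> card (ends G e) = 2"
    using half_edge assms(1) unfolding half_edge_graph_def by blast
  moreover have "{u, v} \<subseteq> ends G e" using assms by blast
  moreover have "finite (ends G e)" using calculation(1) by (intro card_ge_0_finite) auto
  ultimately have "card (ends G e) = card {u, v}"
    using card_mono[of "ends G e" "{u, v}"] assms(4) by simp
  then show ?thesis using card_subset_eq[OF \<open>finite (ends G e)\<close> \<open>{u, v} \<subseteq> ends G e\<close>] by simp
qed

lemma edge_unique:
  assumes "e \<in> edges G" "f \<in> edges G" "ends G e = {u, v}" "ends G f = {u, v}" "u \<noteq> v"
  shows "e = f"
proof -
  have "card (ends G e) = 2" using assms by simp
  then show ?thesis using half_edge assms unfolding half_edge_graph_def by metis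
qed

definition ed :: "'v \<Rightarrow> 'v \<Rightarrow> 'e" where
  "ed u v = (SOME e. e \<in> edges G \<and> ends G e = {u, v})"

lemma ed: "adjacent G u v \<Longrightarrow> ed u v \<in> edges G \<and> ends G (ed u v) = {u, v}"
  unfolding adjacent_def ed_def by (metis (mono_tags, lifting) someI_ex)

lemma ed_eq: "e \<in> edges G \<Longrightarrow> u \<in> ends G e \<Longrightarrow> v \<in> ends G e \<Longrightarrow> u \<noteq> v \<Longrightarrow> e = ed u v \<and> adjacent G u v"
proof -
  assume e: "e \<in> edges G" "u \<in> ends G e" "v \<in> ends G e" "u \<noteq> v"
  then have "adjacent G u v" using ends_eq unfolding adjacent_def by blast
  then show ?thesis using edge_unique[OF e(1)] ends_eq[OF e] ed e(4) by blast
qed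

lemma ed_commute: "ed u v = ed v u"
  unfolding ed_def by (simp add: insert_commute)

lemma in_star: "e \<in> star G v \<longleftrightarrow> e \<in> edges G \<and> v \<in> ends G e"
  unfolding star_def by blast

lemma ed_star: "adjacent G u v \<Longrightarrow> ed u v \<in> star G u \<and> ed u v \<in> star G v"
  using ed[of u v] unfolding in_star by blast

lemma star_verts: "e \<in> edges G \<Longrightarrow> v \<in> ends G e \<Longrightarrow> v \<in> verts G"
  using half_edge unfolding half_edge_graph_def by blast

lemma star_two:
  assumes "v \<in> verts G" "e \<in> star G v" "f \<in> star G v" "e \<noteq> f"
  obtains g where "star G v = {e, f, g}" "distinct [e, f, g]"
proof -
  obtain a b c where "star G v = {a, b, c}" "distinct [a, b, c]"
    using card_star[OF assms(1)] by (auto simp: card_3_iff)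
  moreover from this have "\<exists>g. {a, b, c} = {e, f, g} \<and> distinct [e, f, g]"
    using assms(2-4) by auto
  ultimately show thesis using that by metis
qed

text \<open>The last assumption says that the path is induced in \<open>B\<close>:
  \<open>last (u # as)\<close> and \<open>hd (bs @ [v])\<close> are the predecessor and the
  successor of \<open>w\<close>. So the third edge at \<open>w\<close> meets \<open>B\<close> only
  in \<open>w\<close>. The traces of the new edges on \<open>B\<close> tell them apart and keep them
  away from the old vertices.\<close>

lemma star_ear:
  assumes "ws \<noteq> []" "distinct (u # ws @ [v])" "successively (adjacent G) (u # ws @ [v])"
    "u \<in> B" "v \<in> B" "set ws \<subseteq> B"
    "\<And>as w bs b. ws = as @ w # bs \<Longrightarrow> b \<in> B \<Longrightarrow> adjacent G w b \<Longrightarrow> b = last (u # as) \<or> b = hd (bs @ [v])"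
  shows "\<exists>xs q. star G ` set ws = ear (ed u (hd ws)) xs q (ed (last ws) v) \<and> length xs = length ws - 1 \<and>
    distinct (ear_new xs q) \<and> (\<forall>e\<in>set (ear_new xs q). ends G e \<inter> B \<noteq> {} \<and> ends G e \<inter> B \<subseteq> set ws)"
  using assms
proof (induction ws arbitrary: u)
  case Nil
  then show ?case by simp
next
  case (Cons w ws)
  define y where "y = hd (ws @ [v])"
  have adj: "adjacent G u w" "adjacent G w y"
    using Cons.prems(3) unfolding y_def by (cases ws; simp)+
  have ne: "u \<noteq> y" "u \<noteq> w" "w \<noteq> y" using Cons.prems(2) unfolding y_def by (cases ws; simp)+
  have wV: "w \<in> verts G" using adj_verts[OF adj(1)] by blast
  have "ed u w \<noteq> ed w y" using ed[OF adj(1)] ed[OF adj(2)] ne by (metis doubleton_eq_iff)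
  then obtain p where p: "star G w = {ed u w, ed w y, p}" "distinct [ed u w, ed w y, p]"
    using star_two[OF wV] ed_star[OF adj(1)] ed_star[OF adj(2)] by metis
  have p_ends: "ends G p \<inter> B = {w}"
  proof
    have "p \<in> star G w" using p by blast
    then have pe: "p \<in> edges G" "w \<in> ends G p" unfolding in_star by blast+
    then show "{w} \<subseteq> ends G p \<inter> B" using Cons.prems(6) by auto
    show "ends G p \<inter> B \<subseteq> {w}"
    proof
      fix b assume b: "b \<in> ends G p \<inter> B"
      show "b \<in> {w}"
      proof (rule ccontr)
        assume "b \<notin> {w}"
        then have pb: "p = ed w b" "adjacent G w b" using ed_eq[OF pe] b by auto
        have "b = u \<or> b = y" using Cons.prems(7)[of "[]" w ws b] b pb(2) unfolding y_def by simp
        then show False using p(2) pb(1) ed_commute by auto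
      qed
    qed
  qed
  show ?case
  proof (cases ws)
    case Nil
    then have "star G ` set (w # ws) = ear (ed u (hd (w # ws))) [] p (ed (last (w # ws)) v)"
      using p(1) unfolding y_def by (auto simp: insert_commute)
    then show ?thesis using p_ends Nil by (intro exI[of _ "[]"] exI[of _ p]) auto
  next
    case (Cons w' ws')
    have "y = w'" unfolding y_def Cons by simp
    have "\<exists>xs q. star G ` set ws = ear (ed w (hd ws)) xs q (ed (last ws) v) \<and> length xs = length ws - 1 \<and>
      distinct (ear_new xs q) \<and> (\<forall>e\<in>set (ear_new xs q). ends G e \<inter> B \<noteq> {} \<and> ends G e \<inter> B \<subseteq> set ws)"
    proof (rule Cons.IH)
      show "ws \<noteq> []" using Cons by simp
      show "distinct (w # ws @ [v])" "successively (adjacent G) (w # ws @ [v])" "w \<in> B" "v \<in> B" "set ws \<subseteq> B"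
        using Cons.prems by auto
      show "b = last (w # as) \<or> b = hd (bs @ [v])" if "ws = as @ z # bs" "b \<in> B" "adjacent G z b" for as z bs b
        using Cons.prems(7)[of "w # as" z bs b] that by simp
    qed
    then obtain xs q where xs: "star G ` set ws = ear (ed w (hd ws)) xs q (ed (last ws) v)" "length xs = length ws - 1"
      "distinct (ear_new xs q)" "\<And>e. e \<in> set (ear_new xs q) \<Longrightarrow> ends G e \<inter> B \<noteq> {} \<and> ends G e \<inter> B \<subseteq> set ws"
      by blast
    have wB: "w \<in> B" "w' \<in> B" "w \<notin> set ws" using Cons.prems Cons by auto
    have "ends G (ed w w') = {w, w'}" using ed[OF adj(2)] \<open>y = w'\<close> by simp
    then have m: "ends G (ed w w') \<inter> B = {w, w'}" using wB by auto
    have "p \<notin> set (ear_new xs q)" "ed w w' \<notin> set (ear_new xs q)"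
      using xs(4) p_ends m wB by blast+
    moreover have "p \<noteq> ed w w'" using p(2) \<open>y = w'\<close> by auto
    ultimately have "distinct (ear_new ((p, ed w w') # xs) q)" using xs(3) by simp
    moreover have "star G ` set (w # ws) = ear (ed u (hd (w # ws))) ((p, ed w w') # xs) q (ed (last (w # ws)) v)"
      using xs(1) p(1) \<open>y = w'\<close> Cons by (auto simp: insert_commute)
    moreover have "\<forall>e\<in>set (ear_new ((p, ed w w') # xs) q). ends G e \<inter> B \<noteq> {} \<and> ends G e \<inter> B \<subseteq> set (w # ws)"
      using xs(4) p_ends m Cons by auto
    moreover have "length ((p, ed w w') # xs) = length (w # ws) - 1" using xs(2) Cons by simp
    ultimately show ?thesis by blast
  qed
qed

section \<open>Enlarging a vertex set with a dictatorial system of stars\<close>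

definition good :: "'v set \<Rightarrow> bool" where
  "good A \<longleftrightarrow> A \<subseteq> verts G \<and> A \<noteq> {} \<and> dictatorial (star G ` A) \<and> tight G A"

definition returning :: "'v set \<Rightarrow> 'v \<Rightarrow> 'v list \<Rightarrow> 'v \<Rightarrow> bool" where
  "returning A u ws v \<longleftrightarrow> u \<in> A \<and> v \<in> A \<and> u \<noteq> v \<and> ws \<noteq> [] \<and> distinct ws \<and> set ws \<inter> A = {} \<and>
     successively (adjacent G) (u # ws @ [v])"

lemma returning_rev: "returning A u ws v \<Longrightarrow> returning A v (rev ws) u"
proof -
  assume r: "returning A u ws v"
  have "successively (adjacent G) (rev (u # ws @ [v]))"
    unfolding successively_rev adj_flip using r unfolding returning_def by blast
  then show ?thesis using r unfolding returning_def by auto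
qed

lemma tight_iff: "tight G A \<longleftrightarrow> (\<forall>u v ws. returning A u ws v \<longrightarrow> adjacent G u v)"
  unfolding tight_def returning_def by blast

lemma star_image_insert: "star G ` insert x A = insert (star G x) (star G ` A)"
  by simp

lemma in_Union_star: "e \<in> \<Union>(star G ` A) \<longleftrightarrow> e \<in> edges G \<and> ends G e \<inter> A \<noteq> {}"
  unfolding star_def by blast

text \<open>A second edge from \<open>x\<close> to \<open>A\<close> would make \<open>[x]\<close> a
  returning path, so the other edges at \<open>x\<close> are fresh. A path returning from
  \<open>x\<close> to a vertex other than \<open>u\<close>, prolonged to start at \<open>u\<close>,
  would be a returning path for \<open>A\<close> itself.\<close>

lemma good_leaf:
  assumes A: "good A" and none: "\<And>u ws v. \<not> returning A u ws v"
    and ux: "u \<in> A" "x \<notin> A" "adjacent G u x"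
  shows "good (insert x A)"
proof -
  have uV: "u \<in> verts G" "x \<in> verts G" "u \<noteq> x" using adj_verts[OF ux(3)] by blast+
  define h where "h = ed u x"
  have h: "h \<in> edges G" "ends G h = {u, x}" "h \<in> star G u" "h \<in> star G x"
    using ed[OF ux(3)] ed_star[OF ux(3)] unfolding h_def by blast+
  obtain s t where st: "star G u = {h, s, t}" "distinct [h, s, t]" using triple_containingE[OF card_star[OF uV(1)] h(3)] .
  obtain a b where ab: "star G x = {h, a, b}" "distinct [h, a, b]" using triple_containingE[OF card_star[OF uV(2)] h(4)] .
  have fresh: "e \<notin> \<Union>(star G ` A)" if e: "e \<in> star G x" "e \<noteq> h" for e
  proof
    assume "e \<in> \<Union>(star G ` A)"
    then obtain w where w: "w \<in> A" "w \<in> ends G e" unfolding in_Union_star by blast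
    have ee: "e \<in> edges G" "x \<in> ends G e" using e(1) unfolding in_star by blast+
    have "w \<noteq> x" using w ux by blast
    then have xw: "e = ed x w" "adjacent G x w" using ed_eq[OF ee w(2)] by auto
    have "w \<noteq> u" using e(2) xw(1) ed_commute unfolding h_def by metis
    then have "returning A u [x] w" using ux w xw(2) unfolding returning_def by auto
    then show False using none by blast
  qed
  have "dictatorial (insert {h, a, b} (star G ` A))"
  proof (rule dictatorial_leaf)
    show "dictatorial (star G ` A)" using A unfolding good_def by blast
    show "{h, s, t} \<in> star G ` A" using st(1) ux(1) by blast
    show "distinct [h, s, t]" by fact
    show "L = {h, s, t}" if L: "L \<in> star G ` A" "h \<in> L" for L
    proof -
      obtain w where w: "w \<in> A" "L = star G w" using L(1) by blast
      have "w \<in> ends G h" using L(2) unfolding w(2) in_star by simp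
      then have "w = u" using h(2) w(1) ux(2) by auto
      then show ?thesis using w(2) st(1) by simp
    qed
    show "a \<notin> \<Union>(star G ` A)" "b \<notin> \<Union>(star G ` A)" "a \<noteq> b" using fresh[of a] fresh[of b] ab by auto
  qed
  then have D: "dictatorial (star G ` insert x A)" unfolding star_image_insert ab(1) .
  have x_end: "adjacent G x q" if "returning (insert x A) x ws q" for ws q
  proof (cases "q = u")
    case True
    then show ?thesis using ux(3) adj_sym by blast
  next
    case False
    have "returning A u (x # ws) q"
      using that False ux unfolding returning_def by (auto simp: successively_Cons)
    then show ?thesis using none by blast
  qed
  have "tight G (insert x A)"
    unfolding tight_iff
  proof (intro allI impI)
    fix a b ws assume r: "returning (insert x A) a ws b"
    consider "a = x" | "b = x" | "a \<in> A" "b \<in> A" using r unfolding returning_def by blast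
    then show "adjacent G a b"
    proof cases
      case 1 then show ?thesis using x_end r by blast
    next
      case 2 then show ?thesis using x_end[of "rev ws" a] returning_rev[OF r] adj_sym by blast
    next
      case 3
      then have "returning A a ws b" using r unfolding returning_def by blast
      then show ?thesis using none by blast
    qed
  qed
  then show ?thesis using A D uV(2) unfolding good_def by blast
qed

lemma good_ear:
  assumes A: "good A" and tri: "triangle_free G" and th: "theta_free G"
    and r: "returning A u ws v" and min: "\<And>u' ws' v'. returning A u' ws' v' \<Longrightarrow> length ws \<le> length ws'"
  shows "good (A \<union> set ws)"
proof -
  have no_tri: False if "adjacent G a b" "adjacent G b c" "adjacent G a c" for a b c
    using tri that adj_verts unfolding triangle_free_def by metis
  have tA: "tight G A" "A \<subseteq> verts G" using A unfolding good_def by blast+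
  have uv: "adjacent G u v" using tA(1) r unfolding tight_iff by blast
  have ruv: "u \<in> A" "v \<in> A" "u \<noteq> v" "ws \<noteq> []" "distinct ws" "set ws \<inter> A = {}"
     "successively (adjacent G) (u # ws @ [v])" using r unfolding returning_def by blast+
  have len: "length ws \<ge> 2"
  \<comment> \<open>A single interior vertex would form a triangle with the edge between
    \<open>u\<close> and \<open>v\<close>.\<close>
  proof (rule ccontr)
    assume "\<not> length ws \<ge> 2"
    then obtain w where "ws = [w]" using ruv(4) by (cases ws; cases "tl ws") auto
    then have "adjacent G u w" "adjacent G w v" using ruv(7) by auto
    then show False using no_tri uv by blast
  qed
  define B where "B = A \<union> set ws"
  have sub_u: "successively (adjacent G) (u # as @ [w])" and sub_v: "successively (adjacent G) (w # bs @ [v])"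
    if "ws = as @ w # bs" for as w bs
  proof -
    have "successively (adjacent G) ((u # as @ [w]) @ bs @ [v])" using ruv(7) that by simp
    then show "successively (adjacent G) (u # as @ [w])" unfolding successively_append_iff by blast
    have "successively (adjacent G) ((u # as) @ w # bs @ [v])" using ruv(7) that by simp
    then show "successively (adjacent G) (w # bs @ [v])" unfolding successively_append_iff by blast
  qed
  \<comment> \<open>An edge from the path into \<open>A\<close> is a shortcut: leaving along it, or
    entering along it, gives a shorter returning path unless nothing is cut off. Both shortcuts
    exist if \<open>a\<close> is neither end, and then the path would have only one interior
    vertex.\<close>
  have outer: "a = u \<and> as = [] \<or> a = v \<and> bs = []"
    if w: "ws = as @ w # bs" "a \<in> A" "adjacent G w a" for as w bs a
  proof -
    have 1: "bs = []" if "a \<noteq> u"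
    proof -
      have "successively (adjacent G) ((u # as @ [w]) @ [a])"
        using sub_u[OF w(1)] w(3) unfolding successively_append_iff by simp
      then have "returning A u (as @ [w]) a"
        using that ruv w unfolding returning_def by auto
      then show ?thesis using min w(1) by fastforce
    qed
    have 2: "as = []" if "a \<noteq> v"
    proof -
      have "successively (adjacent G) (a # (w # bs) @ [v])"
        using sub_v[OF w(1)] w(3) adj_sym by simp
      then have "returning A a (w # bs) v"
        using that ruv w unfolding returning_def by auto
      then show ?thesis using min w(1) by fastforce
    qed
    show ?thesis
    proof (cases "a = u")
      case True
      then show ?thesis using 2 ruv(3) by blast
    next
      case False
      then have "bs = []" by (rule 1)
      moreover have "a = v"
      proof (rule ccontr)
        assume "a \<noteq> v"
        then show False using 1 2 False w(1) len by simp
      qed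
      ultimately show ?thesis by blast
    qed
  qed
  \<comment> \<open>A chord of the path would shorten it.\<close>
  have inner: "bs = []" if w: "ws = as @ w # bs @ w' # cs" "adjacent G w w'" for as w bs w' cs
  proof -
    have "successively (adjacent G) (u # as @ [w])" using sub_u[of as w "bs @ w' # cs"] w(1) by simp
    moreover have "successively (adjacent G) (w' # cs @ [v])" using sub_v[of "as @ w # bs" w' cs] w(1) by simp
    ultimately have "successively (adjacent G) ((u # as @ [w]) @ (w' # cs @ [v]))"
      using w(2) unfolding successively_append_iff by simp
    then have "returning A u (as @ w # w' # cs) v"
      using ruv w unfolding returning_def by auto
    then show ?thesis using min w(1) by fastforce
  qed
  have induced: "b = last (u # as) \<or> b = hd (bs @ [v])"
    if w: "ws = as @ w # bs" "b \<in> B" "adjacent G w b" for as w bs b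
  proof -
    have "b \<noteq> w" using adj_verts[OF w(3)] by blast
    then consider "b \<in> A" | "b \<in> set bs" | "b \<in> set as" using w(1,2) unfolding B_def by auto
    then show ?thesis
    proof cases
      case 1 then show ?thesis using outer[OF w(1) _ w(3)] by auto
    next
      case 2
      then obtain cs ds where bs: "bs = cs @ b # ds" by (meson split_list)
      then have "cs = []" using inner[of as w cs b ds] w by simp
      then show ?thesis using bs by simp
    next
      case 3
      then obtain cs ds where as: "as = cs @ b # ds" by (meson split_list)
      then have "ds = []" using inner[of cs b ds w bs] w adj_sym by simp
      then show ?thesis using as by simp
    qed
  qed
  have "\<exists>xs q. star G ` set ws = ear (ed u (hd ws)) xs q (ed (last ws) v) \<and> length xs = length ws - 1 \<and>
    distinct (ear_new xs q) \<and> (\<forall>e\<in>set (ear_new xs q). ends G e \<inter> B \<noteq> {} \<and> ends G e \<inter> B \<subseteq> set ws)"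
  proof (rule star_ear)
    show "distinct (u # ws @ [v])" using ruv by auto
    show "b = last (u # as) \<or> b = hd (bs @ [v])" if "ws = as @ w # bs" "b \<in> B" "adjacent G w b" for as w bs b
      using induced that .
  qed (use ruv B_def in auto)
  then obtain xs q where xs: "star G ` set ws = ear (ed u (hd ws)) xs q (ed (last ws) v)" "length xs = length ws - 1"
    "distinct (ear_new xs q)" "\<And>e. e \<in> set (ear_new xs q) \<Longrightarrow> ends G e \<inter> B \<noteq> {} \<and> ends G e \<inter> B \<subseteq> set ws"
    by blast
  have hl: "hd ws \<in> set ws" "last ws \<in> set ws" "adjacent G u (hd ws)" "adjacent G (last ws) v"
  proof -
    show "hd ws \<in> set ws" "last ws \<in> set ws" using ruv(4) by simp_all
    show "adjacent G u (hd ws)" using ruv(4,7) by (cases ws) auto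
    have "successively (adjacent G) ((u # ws) @ [v])" using ruv(7) by simp
    then show "adjacent G (last ws) v" unfolding successively_append_iff using ruv(4) by simp
  qed
  define d hu hv where "d = ed u v" and "hu = ed u (hd ws)" and "hv = ed (last ws) v"
  have d: "d \<in> edges G" "ends G d = {u, v}" and hu: "hu \<in> edges G" "ends G hu = {u, hd ws}"
    and hv: "hv \<in> edges G" "ends G hv = {last ws, v}"
    using ed[OF uv] ed[OF hl(3)] ed[OF hl(4)] unfolding d_def hu_def hv_def by blast+
  have out: "hd ws \<notin> A" "last ws \<notin> A" using hl ruv(6) by blast+
  have uV: "u \<in> verts G" "v \<in> verts G" using ruv tA(2) by blast+
  have st: "d \<in> star G u" "hu \<in> star G u" "d \<in> star G v" "hv \<in> star G v"
    using d hu hv unfolding in_star by blast+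
  have "d \<noteq> hu" "d \<noteq> hv" "hu \<noteq> hv"
    using d hu hv out ruv(1-3) by (metis doubleton_eq_iff)+
  then obtain s t where s: "star G u = {d, hu, s}" "distinct [d, hu, s]" and t: "star G v = {d, hv, t}" "distinct [d, hv, t]"
    using star_two[OF uV(1) st(1,2)] star_two[OF uV(2) st(3,4)] by metis
  have common: "e = d" if "e \<in> star G u" "e \<in> star G v" for e
    using that ed_eq[of e u v] ruv(3) unfolding in_star d_def by blast
  have dist: "distinct [d, s, hu, t, hv]"
  proof -
    have in_star: "s \<in> star G u" "t \<in> star G v" using s(1) t(1) by simp_all
    have "d \<noteq> s" "d \<noteq> t" "hu \<noteq> s" "hv \<noteq> t" using s(2) t(2) by simp_all
    moreover from this have "s \<noteq> t" "s \<noteq> hv" "hu \<noteq> t"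
      using common in_star st by metis+
    ultimately show ?thesis using \<open>d \<noteq> hu\<close> \<open>d \<noteq> hv\<close> \<open>hu \<noteq> hv\<close> by simp
  qed
  have "dictatorial (star G ` A \<union> ear hu xs q hv)"
  proof (rule dictatorial_ear[OF _ _ _ dist])
    show "dictatorial (star G ` A)" using A unfolding good_def by blast
    show "{d, s, hu} \<in> star G ` A" "{d, t, hv} \<in> star G ` A"
      using s(1) t(1) ruv(1,2) by (auto simp: insert_commute)
    have w_in: "\<exists>w\<in>A. L = star G w \<and> w \<in> ends G e" if "L \<in> star G ` A" "e \<in> L" for L e
      using that unfolding star_def by blast
    show "L = {d, s, hu} \<or> L = {d, t, hv}" if "L \<in> star G ` A" "d \<in> L" for L
      using w_in[OF that] d(2) s(1) t(1) by (auto simp: insert_commute)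
    show "L = {d, s, hu}" if "L \<in> star G ` A" "hu \<in> L" for L
      using w_in[OF that] hu(2) s(1) out(1) by (auto simp: insert_commute)
    show "L = {d, t, hv}" if "L \<in> star G ` A" "hv \<in> L" for L
      using w_in[OF that] hv(2) t(1) out(2) by (auto simp: insert_commute)
    show "xs \<noteq> []" using xs(2) len by auto
    show "distinct (ear_new xs q)" by fact
    show "set (ear_new xs q) \<inter> \<Union>(star G ` A) = {}"
    proof (rule ccontr)
      assume "set (ear_new xs q) \<inter> \<Union>(star G ` A) \<noteq> {}"
      then obtain e where e: "e \<in> set (ear_new xs q)" "e \<in> \<Union>(star G ` A)" by blast
      then obtain w where "w \<in> A" "w \<in> ends G e" unfolding in_Union_star by blast
      then show False using xs(4)[OF e(1)] ruv(6) unfolding B_def by blast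
    qed
  qed
  then have D: "dictatorial (star G ` (A \<union> set ws))"
    unfolding image_Un xs(1) hu_def hv_def .
  have theta: False
    if "successively (adjacent G) (a # k1 @ [b])" "successively (adjacent G) (a # k2 @ [b])"
      "successively (adjacent G) (a # k3 @ [b])" "distinct (a # b # k1 @ k2 @ k3)" "k1 \<noteq> []" "k2 \<noteq> []" "k3 \<noteq> []"
    for a b k1 k2 k3
    using th that unfolding theta_free_def by blast
  have sub_u': "successively (adjacent G) (w # rev as @ [u])" if "ws = as @ w # bs" for as w bs
    using sub_u[OF that] successively_rev[of "adjacent G" "u # as @ [w]"] unfolding adj_flip by simp
  have sub_v': "successively (adjacent G) (v # rev bs @ [w])" if "ws = as @ w # bs" for as w bs
    using sub_v[OF that] successively_rev[of "adjacent G" "w # bs @ [v]"] unfolding adj_flip by simp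
  \<comment> \<open>If \<open>k\<close> is \<open>u\<close> or \<open>v\<close> and not already next
    to \<open>p\<close>, then \<open>rs\<close>, the direct part of the ear, and the way round over
    the edge between \<open>u\<close> and \<open>v\<close> form a theta. If \<open>k\<close> is
    another vertex of \<open>A\<close>, prolonging \<open>rs\<close> along the ear in both
    directions makes \<open>k\<close> adjacent to \<open>u\<close> and to \<open>v\<close>, a
    triangle.\<close>
  have one_inner: "adjacent G p k"
    if rs: "returning (A \<union> set ws) p rs k" and p: "p \<in> set ws" and k: "k \<in> A" for p rs k
  proof -
    obtain as bs where w: "ws = as @ p # bs" using p by (meson split_list)
    have rs': "successively (adjacent G) (p # rs @ [k])" "distinct rs" "set rs \<inter> (A \<union> set ws) = {}" "rs \<noteq> []"
      using rs unfolding returning_def by blast+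
    have dw: "distinct (as @ p # bs)" "set (as @ p # bs) \<inter> A = {}" using ruv(5,6) w by auto
    consider "k = u" | "k = v" | "k \<noteq> u" "k \<noteq> v" by blast
    then show ?thesis
    proof cases
      case 1
      show ?thesis
      proof (cases "as = []")
        case True
        then show ?thesis using hl(3) w 1 adj_sym by simp
      next
        case False
        have "successively (adjacent G) ((p # bs @ [v]) @ [u])"
          using sub_v[OF w] uv adj_sym unfolding successively_append_iff by simp
        then have "successively (adjacent G) (p # (bs @ [v]) @ [u])" by simp
        moreover have "distinct (p # u # rs @ rev as @ bs @ [v])"
          using rs' dw ruv(1-3) w by auto
        ultimately show ?thesis using theta[of p rs u "rev as" "bs @ [v]"] rs' sub_u'[OF w] False 1 by auto
      qed
    next
      case 2
      show ?thesis
      proof (cases "bs = []")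
        case True
        then show ?thesis using hl(4) w 2 by simp
      next
        case False
        have "successively (adjacent G) ((p # rev as @ [u]) @ [v])"
          using sub_u'[OF w] uv unfolding successively_append_iff by simp
        then have "successively (adjacent G) (p # (rev as @ [u]) @ [v])" by simp
        moreover have "distinct (p # v # rs @ bs @ rev as @ [u])"
          using rs' dw ruv(1-3) w by auto
        ultimately show ?thesis using theta[of p rs v bs "rev as @ [u]"] rs' sub_v[OF w] False 2 by auto
      qed
    next
      case 3
      have "successively (adjacent G) (rs @ [k])" "adjacent G p (hd rs)"
        using rs'(1,4) by (cases rs; simp)+
      then have "successively (adjacent G) ((u # as @ [p]) @ (rs @ [k]))" "successively (adjacent G) ((v # rev bs @ [p]) @ (rs @ [k]))"
        using sub_u[OF w] sub_v'[OF w] rs'(4) unfolding successively_append_iff by simp_all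
      then have "returning A u (as @ p # rs) k" "returning A v (rev bs @ p # rs) k"
        using 3 k ruv(1,2) rs' dw w unfolding returning_def by auto
      then have "adjacent G u k" "adjacent G v k" using tA(1) unfolding tight_iff by blast+
      then show ?thesis using no_tri[OF uv] by blast
    qed
  qed
  \<comment> \<open>Otherwise \<open>rs\<close>, the part of the ear between \<open>p\<close> and
    \<open>k\<close>, and the rest of the ear closed by the edge between \<open>u\<close> and
    \<open>v\<close> form a theta.\<close>
  have two_inner: "adjacent G p k"
    if rs: "returning (A \<union> set ws) p rs k" and w: "ws = as @ p # bs @ k # cs" for p rs k as bs cs
  proof (cases "bs = []")
    case True
    have "successively (adjacent G) ((u # as) @ p # (bs @ k # cs) @ [v])" using ruv(7) w by simp
    then show ?thesis using True unfolding successively_append_iff by simp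
  next
    case False
    have rs': "successively (adjacent G) (p # rs @ [k])" "distinct rs" "set rs \<inter> (A \<union> set ws) = {}" "rs \<noteq> []"
      using rs unfolding returning_def by blast+
    have dw: "distinct (as @ p # bs @ k # cs)" "set (as @ p # bs @ k # cs) \<inter> A = {}" using ruv(5,6) w by auto
    have "successively (adjacent G) ((u # as) @ (p # bs @ [k]) @ cs @ [v])" using ruv(7) w by simp
    then have mid: "successively (adjacent G) (p # bs @ [k])" unfolding successively_append_iff by blast
    have "successively (adjacent G) (v # rev cs @ [k])" using sub_v'[of "as @ p # bs" k cs] w by simp
    moreover have "successively (adjacent G) (p # rev as @ [u])" using sub_u'[OF w] .
    ultimately have "successively (adjacent G) ((p # rev as @ [u]) @ (v # rev cs @ [k]))"
      using uv unfolding successively_append_iff by simp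
    then have "successively (adjacent G) (p # (rev as @ u # v # rev cs) @ [k])" by simp
    moreover have "distinct (p # k # rs @ bs @ rev as @ u # v # rev cs)"
      using rs' dw ruv(1-3) w by auto
    ultimately show ?thesis using theta[of p rs k bs "rev as @ u # v # rev cs"] rs' mid False by auto
  qed
  have tight: "tight G (A \<union> set ws)"
    unfolding tight_iff
  proof (intro allI impI)
    fix a b rs assume rs: "returning (A \<union> set ws) a rs b"
    have ab: "a \<in> A \<union> set ws" "b \<in> A \<union> set ws" "a \<noteq> b" using rs unfolding returning_def by blast+
    note rev = returning_rev[OF rs]
    consider "a \<in> A" "b \<in> A" | "a \<in> set ws" "b \<in> A" | "a \<in> A" "b \<in> set ws" | "a \<in> set ws" "b \<in> set ws"
      using ab by blast
    then show "adjacent G a b"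
    proof cases
      case 1
      then have "returning A a rs b" using rs unfolding returning_def by blast
      then show ?thesis using tA(1) unfolding tight_iff by blast
    next
      case 2 then show ?thesis using one_inner[OF rs] by blast
    next
      case 3 then show ?thesis using one_inner[OF rev] adj_sym by blast
    next
      case 4
      obtain as bs where w: "ws = as @ a # bs" using 4(1) by (meson split_list)
      then consider "b \<in> set bs" | "b \<in> set as" using 4(2) ab(3) by auto
      then show ?thesis
      proof cases
        case 1
        then obtain cs ds where "bs = cs @ b # ds" by (meson split_list)
        then show ?thesis using two_inner[OF rs] w by blast
      next
        case 2
        then obtain cs ds where "as = cs @ b # ds" by (meson split_list)
        then have "ws = cs @ b # ds @ a # bs" using w by simp
        then show ?thesis using two_inner[OF rev] adj_sym by blast
      qed
    qed
  qed
  have "set ws \<subseteq> verts G"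
    using successively_adjacent_verts[OF half_edge ruv(7)] by simp
  then show ?thesis using D tight A unfolding good_def by blast
qed

lemma good_single: "v \<in> verts G \<Longrightarrow> good {v}"
  unfolding good_def tight_def using dictatorial_single[OF card_star] by auto

lemma finite_verts: "finite (verts G)"
  using half_edge unfolding half_edge_graph_def by blast

lemma good_step:
  assumes conn: "connected_graph G" and tri: "triangle_free G" and th: "theta_free G"
    and A: "good A" "A \<noteq> verts G"
  shows "\<exists>A'. good A' \<and> A \<subset> A'"
proof (cases "\<exists>u ws v. returning A u ws v")
  case True
  then obtain ws0 where "\<exists>u v. returning A u ws0 v" by blast
  then obtain ws where "\<exists>u v. returning A u ws v" and min: "\<And>ws'. \<exists>u v. returning A u ws' v \<Longrightarrow> length ws \<le> length ws'"
    using ex_has_least_nat[of "\<lambda>ws. \<exists>u v. returning A u ws v" ws0 length] by blast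
  then obtain u v where r: "returning A u ws v" by blast
  have "good (A \<union> set ws)"
  proof (rule good_ear[OF A(1) tri th r])
    show "length ws \<le> length ws'" if "returning A u' ws' v'" for u' ws' v' using min that by blast
  qed
  moreover have "hd ws \<in> set ws - A" using r unfolding returning_def by (auto simp: disjoint_iff)
  then have "A \<subset> A \<union> set ws" by (intro psubsetI) auto
  ultimately show ?thesis by (intro exI[of _ "A \<union> set ws"] conjI)
next
  case False
  have "A \<subset> verts G" "A \<noteq> {}" using A unfolding good_def by blast+
  then obtain a b where ab: "a \<in> A" "b \<in> verts G" "b \<notin> A" "a \<in> verts G" by blast
  then have "(adjacent G)\<^sup>*\<^sup>* a b" using conn unfolding connected_graph_def by blast
  then have "\<exists>u\<in>A. \<exists>x. x \<notin> A \<and> adjacent G u x"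
    using ab(1,3)
  proof (induction rule: converse_rtranclp_induct)
    case (step y z)
    then show ?case by blast
  qed simp
  then obtain u x where "u \<in> A" "x \<notin> A" "adjacent G u x" by blast
  then have "good (insert x A)" using good_leaf[OF A(1)] False by blast
  then show ?thesis using \<open>x \<notin> A\<close> by blast
qed

lemma dictatorial_graph:
  assumes "connected_graph G" "triangle_free G" "theta_free G"
  shows "dictatorial (star G ` verts G)"
proof -
  obtain v where v: "v \<in> verts G" using assms(1) unfolding connected_graph_def by blast
  have "finite {A. good A}"
    by (rule finite_subset[of _ "Pow (verts G)"]) (auto simp: good_def finite_verts)
  then obtain A where A: "good A" "\<And>A'. good A' \<Longrightarrow> \<not> A \<subset> A'"
    using finite_has_maximal[of "{A. good A}"] good_single[OF v] by blast
  then have "A = verts G" using good_step[OF assms] by blast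
  then show ?thesis using A unfolding good_def by blast
qed

end


section \<open>The line graph and its coloring complex\<close>

lemma link_coloring_complex:
  "{C, D} \<in> links (coloring_complex X) \<longleftrightarrow> C \<noteq> D \<and> (\<exists>P. three_coloring X P \<and> C \<in> P \<and> D \<in> P)"
  unfolding coloring_complex_def by (auto simp: doubleton_eq_iff)

lemma nodes_coloring_complex: "C \<in> nodes (coloring_complex X) \<longleftrightarrow> (\<exists>P. three_coloring X P \<and> C \<in> P)"
  unfolding coloring_complex_def by simp

lemma UNIV_color: "(UNIV :: color set) = {Red, Green, Blue}"
  using color.exhaust by auto

lemma range_color: "range f = {f Red, f Green, f Blue}"
  unfolding UNIV_color by simp

locale claw_graph =
  fixes V :: "'e set set" and X :: "'e sgraph"
  assumes nodes_eq: "nodes X = \<Union>V"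
    and link_iff: "{x, y} \<in> links X \<longleftrightarrow> x \<noteq> y \<and> (\<exists>K\<in>V. x \<in> K \<and> y \<in> K)"
begin

lemma three_coloring_iff: "three_coloring X P \<longleftrightarrow> (\<exists>c. proper V c \<and> P = range (cls V c))"
proof
  assume "three_coloring X P"
  then obtain V1 V2 V3 where P: "P = {V1, V2, V3}" "V1 \<union> V2 \<union> V3 = \<Union>V"
    "V1 \<inter> V2 = {}" "V1 \<inter> V3 = {}" "V2 \<inter> V3 = {}"
    "independent_set X V1" "independent_set X V2" "independent_set X V3"
    unfolding three_coloring_def nodes_eq by (elim exE conjE) (rule that)
  define c where "c e = (if e \<in> V1 then Red else if e \<in> V2 then Green else Blue)" for e
  have "cls V c Red = V1" "cls V c Green = V2" "cls V c Blue = V3"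
    using P(2-5) unfolding cls_def c_def by auto
  then have "P = range (cls V c)" unfolding range_color P(1) by simp
  moreover have "proper V c"
    unfolding proper_def
  proof (intro ballI inj_onI)
    fix K x y assume K: "K \<in> V" "x \<in> K" "y \<in> K" "c x = c y"
    then have "x \<in> \<Union>V" "y \<in> \<Union>V" by blast+
    then have "x \<in> V1 \<and> y \<in> V1 \<or> x \<in> V2 \<and> y \<in> V2 \<or> x \<in> V3 \<and> y \<in> V3"
      using K(4) P(2) unfolding c_def by (auto split: if_splits)
    then have "{x, y} \<notin> links X" using P(6-8) unfolding independent_set_def by blast
    then show "x = y" using K link_iff by blast
  qed
  ultimately show "\<exists>c. proper V c \<and> P = range (cls V c)" by blast
next
  assume "\<exists>c. proper V c \<and> P = range (cls V c)"
  then obtain c where c: "proper V c" "P = range (cls V c)" by blast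
  have ind: "independent_set X (cls V c i)" for i
    using proper_neq[OF c(1)] unfolding independent_set_def nodes_eq link_iff cls_def by fastforce
  have "cls V c Red \<union> cls V c Green \<union> cls V c Blue = nodes X"
    using color.exhaust unfolding nodes_eq cls_def by blast
  moreover have "cls V c i \<inter> cls V c j = {}" if "i \<noteq> j" for i j using that unfolding cls_def by blast
  ultimately show "three_coloring X P"
    unfolding three_coloring_def c(2) range_color using ind
    by (intro exI[of _ "cls V c Red"] exI[of _ "cls V c Green"] exI[of _ "cls V c Blue"]) simp
qed

lemma node_iff: "C \<in> nodes (coloring_complex X) \<longleftrightarrow> (\<exists>c i. proper V c \<and> C = cls V c i)"
  unfolding nodes_coloring_complex three_coloring_iff by blast

lemma canonical_map_iff: "C \<in> canonical_map X e \<longleftrightarrow> (\<exists>c i. proper V c \<and> C = cls V c i \<and> e \<in> C)"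
  unfolding canonical_map_def using node_iff by blast

end

locale dictatorial_claw_graph = claw_graph +
  assumes D: "dictatorial V" and V_ne: "V \<noteq> {}"
begin

abbreviation "B \<equiv> coloring_complex X"
abbreviation "\<phi> \<equiv> canonical_map X"

lemma card_claw: "K \<in> V \<Longrightarrow> card K = 3"
  using dictatorial_card[OF D] .

text \<open>Every claw meets all three classes, so none is empty and different colors have different
  classes.\<close>

lemma cls_eq_iff:
  assumes "proper V c"
  shows "cls V c i = cls V c j \<longleftrightarrow> i = j"
proof -
  obtain K where K: "K \<in> V" using V_ne by blast
  then obtain e where e: "e \<in> K" "c e = i" using proper_surj[OF assms K card_claw[OF K]] by blast
  then have "e \<in> \<Union>V" using K by blast
  then have "e \<in> cls V c k \<longleftrightarrow> k = i" for k using e(2) unfolding cls_def by auto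
  then show ?thesis by metis
qed

lemma complex_link: "{C, C'} \<in> links B \<longleftrightarrow> (\<exists>c i j. proper V c \<and> i \<noteq> j \<and> C = cls V c i \<and> C' = cls V c j)"
proof
  assume "{C, C'} \<in> links B"
  then obtain c where c: "C \<noteq> C'" "proper V c" "C \<in> range (cls V c)" "C' \<in> range (cls V c)"
    unfolding link_coloring_complex three_coloring_iff by blast
  obtain i j where ij: "C = cls V c i" "C' = cls V c j" using c(3,4) by (elim rangeE)
  have "i \<noteq> j" using c(1) ij by auto
  then show "\<exists>c i j. proper V c \<and> i \<noteq> j \<and> C = cls V c i \<and> C' = cls V c j"
    using c(2) ij by (intro exI conjI)
next
  assume "\<exists>c i j. proper V c \<and> i \<noteq> j \<and> C = cls V c i \<and> C' = cls V c j"
  then obtain c i j where c: "proper V c" "i \<noteq> j" "C = cls V c i" "C' = cls V c j" by blast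
  then have "C \<noteq> C'" using cls_eq_iff by simp
  then show "{C, C'} \<in> links B" unfolding link_coloring_complex three_coloring_iff
    using c by (intro conjI exI[of _ "range (cls V c)"] exI[of _ c]) simp_all
qed

lemma canonical_map_cls: "proper V c \<Longrightarrow> e \<in> \<Union>V \<Longrightarrow> cls V c i \<in> \<phi> e \<longleftrightarrow> c e = i"
  unfolding canonical_map_iff cls_def by blast

lemma canonical_map_nodes: "\<phi> e \<subseteq> nodes B"
  unfolding canonical_map_def by blast

lemma inj_canonical_map: "inj_on \<phi> (\<Union>V)"
proof (rule inj_onI, rule ccontr)
  fix x y assume xy: "x \<in> \<Union>V" "y \<in> \<Union>V" "\<phi> x = \<phi> y" "x \<noteq> y"
  then obtain c where "proper V c" "c x \<noteq> c y" using dictatorial_sep[OF D] by blast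
  then show False using canonical_map_cls[of c x "c x"] canonical_map_cls[of c y "c x"] xy by auto
qed

text \<open>Each color class contains exactly one edge of \<open>K\<close>, and two classes of a
  common coloring contain different ones.\<close>

lemma three_coloring_of_claw:
  assumes K: "K \<in> V"
  shows "three_coloring B (\<phi> ` K)"
proof -
  obtain x y z where xyz: "K = {x, y, z}" "distinct [x, y, z]"
    using card_claw[OF K] by (auto simp: card_3_iff)
  have in_V: "e \<in> \<Union>V" if "e \<in> K" for e using K that by blast
  have part: "\<phi> e \<inter> \<phi> f = {}" if "e \<in> K" "f \<in> K" "e \<noteq> f" for e f
  proof (rule ccontr)
    assume "\<phi> e \<inter> \<phi> f \<noteq> {}"
    then obtain C where C: "C \<in> \<phi> e" "C \<in> \<phi> f" by blast
    then obtain c i where c: "proper V c" "C = cls V c i" unfolding canonical_map_iff by blast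
    then have "c e = c f" using C canonical_map_cls[OF c(1)] in_V that by metis
    then show False using proper_neq[OF c(1) K that] by blast
  qed
  have ind: "independent_set B (\<phi> e)" if e: "e \<in> K" for e
    unfolding independent_set_def
  proof (intro conjI ballI)
    show "\<phi> e \<subseteq> nodes B" by (rule canonical_map_nodes)
    fix C C' assume C: "C \<in> \<phi> e" "C' \<in> \<phi> e"
    show "{C, C'} \<notin> links B"
    proof
      assume "{C, C'} \<in> links B"
      then obtain c i j where c: "proper V c" "i \<noteq> j" "C = cls V c i" "C' = cls V c j"
        unfolding complex_link by blast
      then show False using C canonical_map_cls[OF c(1) in_V[OF e]] by metis
    qed
  qed
  have cover: "nodes B \<subseteq> \<phi> x \<union> \<phi> y \<union> \<phi> z"
  proof
    fix C assume "C \<in> nodes B"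
    then obtain c i where c: "proper V c" "C = cls V c i" unfolding node_iff by blast
    then obtain e where e: "e \<in> K" "c e = i" using proper_surj[OF c(1) K card_claw[OF K]] by blast
    then have "C \<in> \<phi> e" using c canonical_map_cls[OF c(1) in_V[OF e(1)]] by simp
    then show "C \<in> \<phi> x \<union> \<phi> y \<union> \<phi> z" using e(1) unfolding xyz by blast
  qed
  have mem: "x \<in> K" "y \<in> K" "z \<in> K" "x \<noteq> y" "x \<noteq> z" "y \<noteq> z" using xyz by auto
  have "\<phi> x \<union> \<phi> y \<union> \<phi> z = nodes B"
    using cover canonical_map_nodes[of x] canonical_map_nodes[of y] canonical_map_nodes[of z] by blast
  moreover have "\<phi> ` K = {\<phi> x, \<phi> y, \<phi> z}" unfolding xyz(1) by simp
  ultimately show ?thesis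
    unfolding three_coloring_def
    by (intro exI[of _ "\<phi> x"] exI[of _ "\<phi> y"] exI[of _ "\<phi> z"] conjI part ind mem)
qed

text \<open>Read as a labelling by colors, the partition is valid because the classes of one
  coloring are pairwise adjacent in the complex. Its parts are then the sets of classes through the
  three edges of the dictator.\<close>

lemma three_coloring_complex:
  assumes "three_coloring B Q"
  shows "\<exists>K\<in>V. Q = \<phi> ` K"
proof -
  obtain V1 V2 V3 where Q: "Q = {V1, V2, V3}" "V1 \<union> V2 \<union> V3 = nodes B"
    "V1 \<inter> V2 = {}" "V1 \<inter> V3 = {}" "V2 \<inter> V3 = {}"
    "independent_set B V1" "independent_set B V2" "independent_set B V3"
    using assms unfolding three_coloring_def by (elim exE conjE) (rule that)
  define F where "F C = (if C \<in> V1 then Red else if C \<in> V2 then Green else Blue)" for C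
  define fib where "fib i = {C \<in> nodes B. F C = i}" for i
  have fib: "fib Red = V1" "fib Green = V2" "fib Blue = V3"
    using Q(2-5) unfolding fib_def F_def by auto
  then have Qfib: "Q = range fib" unfolding range_color Q(1) by simp
  have ind: "independent_set B (fib i)" for i using fib Q(6-8) by (cases i) simp_all
  have node: "cls V c i \<in> nodes B" if "proper V c" for c i using that node_iff by blast
  have val: "valid V F"
    unfolding valid_def
  proof (intro allI impI injI, rule ccontr)
    fix c i j assume c: "proper V c" and eq: "F (cls V c i) = F (cls V c j)" and "i \<noteq> j"
    then have "{cls V c i, cls V c j} \<in> links B" unfolding complex_link by blast
    moreover have "cls V c i \<in> fib (F (cls V c i))" "cls V c j \<in> fib (F (cls V c i))"
      using node[OF c] eq unfolding fib_def by simp_all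
    ultimately show False using ind unfolding independent_set_def by blast
  qed
  then obtain K g where K: "K \<in> V" "evaluates V F K g" using dictatorial_dict[OF D] by blast
  obtain c0 where c0: "proper V c0" using dictatorial_ex[OF D] by blast
  have inj: "inj_on g K" using evaluates_inj[OF K(2) val c0 K(1)] .
  have "\<phi> e = fib (g e)" if e: "e \<in> K" for e
  proof -
    have eV: "e \<in> \<Union>V" using e K(1) by blast
    have "cls V c i \<in> \<phi> e \<longleftrightarrow> cls V c i \<in> fib (g e)" if c: "proper V c" for c i
      using canonical_map_cls[OF c eV, of i] node[OF c, of i] evaluatesD[OF K(2) c e] validD[OF val c]
      unfolding fib_def mem_Collect_eq by metis
    moreover have "\<phi> e \<subseteq> nodes B" "fib (g e) \<subseteq> nodes B"
      using canonical_map_nodes unfolding fib_def by blast+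
    ultimately show ?thesis unfolding set_eq_iff by (metis node_iff subsetD)
  qed
  then have "\<phi> ` K = fib ` (g ` K)" unfolding image_image by (rule image_cong[OF refl])
  moreover have "i \<in> g ` K" for i using inj_on_claw_surj[OF inj card_claw[OF K(1)], of i] by (metis imageI)
  then have "g ` K = UNIV" by (intro UNIV_eq_I[symmetric])
  ultimately have "Q = \<phi> ` K" unfolding Qfib by simp
  then show ?thesis using K(1) by (rule bexI)
qed

lemma three_coloring_complex_iff: "three_coloring B Q \<longleftrightarrow> (\<exists>K\<in>V. Q = \<phi> ` K)"
proof
  assume "\<exists>K\<in>V. Q = \<phi> ` K"
  then obtain K where "K \<in> V" "Q = \<phi> ` K" by (elim bexE)
  then show "three_coloring B Q" using three_coloring_of_claw by simp
qed (rule three_coloring_complex)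

lemma reflexive: "reflexive X"
  unfolding reflexive_def
proof (intro conjI)
  show "three_colorable X"
    unfolding three_colorable_def three_coloring_iff using dictatorial_ex[OF D] by blast
  show "no_isolated_vertices X"
    unfolding no_isolated_vertices_def
  proof
    fix x assume "x \<in> nodes X"
    then obtain K where K: "K \<in> V" "x \<in> K" unfolding nodes_eq by blast
    have "\<not> K \<subseteq> {x}" using card_claw[OF K(1)] card_mono[of "{x}" K] by auto
    then obtain y where "y \<in> K" "y \<noteq> x" by blast
    then show "\<exists>y\<in>nodes X. {x, y} \<in> links X" using K unfolding nodes_eq link_iff by (metis UnionI)
  qed
  show "graph_isomorphism X (coloring_complex B) \<phi>"
    unfolding graph_isomorphism_def
  proof (intro conjI ballI)
    have "Z \<in> nodes (coloring_complex B) \<longleftrightarrow> (\<exists>K\<in>V. Z \<in> \<phi> ` K)" for Z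
      unfolding nodes_coloring_complex three_coloring_complex_iff by metis
    then have "nodes (coloring_complex B) = \<phi> ` \<Union>V"
      unfolding image_Union by (intro set_eqI) (simp only: UN_iff)
    then show "bij_betw \<phi> (nodes X) (nodes (coloring_complex B))"
      using inj_canonical_map unfolding bij_betw_def nodes_eq by (intro conjI) simp_all
    fix x y assume xy: "x \<in> nodes X" "y \<in> nodes X"
    have inj: "\<phi> e \<in> \<phi> ` K \<longleftrightarrow> e \<in> K" if "e \<in> \<Union>V" "K \<in> V" for e K
      by (rule inj_on_image_mem_iff[OF inj_canonical_map that(1) Union_upper[OF that(2)]])
    have "{\<phi> x, \<phi> y} \<in> links (coloring_complex B) \<longleftrightarrow> \<phi> x \<noteq> \<phi> y \<and> (\<exists>K\<in>V. \<phi> x \<in> \<phi> ` K \<and> \<phi> y \<in> \<phi> ` K)"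
      unfolding link_coloring_complex three_coloring_complex_iff by metis
    also have "\<dots> \<longleftrightarrow> x \<noteq> y \<and> (\<exists>K\<in>V. x \<in> K \<and> y \<in> K)"
      using inj[OF xy(1)[unfolded nodes_eq]] inj[OF xy(2)[unfolded nodes_eq]]
        inj_on_eq_iff[OF inj_canonical_map xy[unfolded nodes_eq]] by (metis (no_types, lifting))
    finally show "{x, y} \<in> links X \<longleftrightarrow> {\<phi> x, \<phi> y} \<in> links (coloring_complex B)"
      unfolding link_iff by blast
  qed
qed

end

section \<open>Line graphs of cubic graphs as systems of claws, and triangles\<close>

context cubic
begin

lemma Union_stars: "\<Union>(star G ` verts G) = edges G"
proof -
  have "ends G e \<inter> verts G \<noteq> {}" if e: "e \<in> edges G" for e
  proof -
    have "ends G e \<subseteq> verts G" "card (ends G e) = 1 \<or> card (ends G e) = 2"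
      using half_edge e unfolding half_edge_graph_def by blast+
    then show ?thesis by (auto simp: Int_absorb2)
  qed
  then show ?thesis unfolding star_def by blast
qed

lemma claw_graph_line_graph: "claw_graph (star G ` verts G) (line_graph G)"
proof
  show "nodes (line_graph G) = \<Union>(star G ` verts G)" unfolding Union_stars line_graph_def by simp
  fix x y
  have "{x, y} \<in> links (line_graph G) \<longleftrightarrow> x \<in> edges G \<and> y \<in> edges G \<and> x \<noteq> y \<and> ends G x \<inter> ends G y \<noteq> {}"
    unfolding line_graph_def by (auto simp: doubleton_eq_iff)
  also have "\<dots> \<longleftrightarrow> x \<noteq> y \<and> (\<exists>K\<in>star G ` verts G. x \<in> K \<and> y \<in> K)"
  proof -
    have "(\<exists>K\<in>star G ` verts G. x \<in> K \<and> y \<in> K) \<longleftrightarrow> (\<exists>v\<in>verts G. x \<in> star G v \<and> y \<in> star G v)" by simp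
    then show ?thesis unfolding in_star using star_verts[of x] by (metis disjoint_iff)
  qed
  finally show "{x, y} \<in> links (line_graph G) \<longleftrightarrow> x \<noteq> y \<and> (\<exists>K\<in>star G ` verts G. x \<in> K \<and> y \<in> K)" .
qed

lemma edge_reflexive_imp_triangle_free:
  assumes "edge_reflexive G"
  shows "triangle_free G"
  unfolding triangle_free_def
proof (rule notI, elim bexE conjE)
  fix u v w assume uvw: "u \<in> verts G" "v \<in> verts G" "w \<in> verts G" "adjacent G u v" "adjacent G v w" "adjacent G u w"
  interpret claw_graph "star G ` verts G" "line_graph G" by (rule claw_graph_line_graph)
  define x y z where "x = ed v w" and "y = ed u w" and "z = ed u v"
  have ne: "u \<noteq> v" "v \<noteq> w" "u \<noteq> w" using uvw adj_verts by blast+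
  have en: "x \<in> edges G" "ends G x = {v, w}" "y \<in> edges G" "ends G y = {u, w}" "z \<in> edges G" "ends G z = {u, v}"
    using ed uvw unfolding x_def y_def z_def by blast+
  have neq: "x \<noteq> y" "x \<noteq> z" "y \<noteq> z" using en ne by (metis doubleton_eq_iff)+
  have st: "y \<in> star G u" "z \<in> star G u" "x \<in> star G v" "z \<in> star G v" "x \<in> star G w" "y \<in> star G w"
    using en unfolding in_star by auto
  obtain a where a: "star G u = {y, z, a}" "distinct [y, z, a]" using star_two[OF uvw(1) st(1,2) neq(3)] .
  have "a \<in> star G u" using a by blast
  then have "a \<in> edges G" "u \<in> ends G a" unfolding in_star by blast+
  then have "x \<noteq> a" using en(2) ne by auto
  have same: "c x = c a" if c: "proper (star G ` verts G) c" for c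
  proof -
    have s: "star G k \<in> star G ` verts G" if "k \<in> verts G" for k using that by blast
    have "c y \<noteq> c z" "c y \<noteq> c a" "c z \<noteq> c a"
      using proper_neq[OF c s[OF uvw(1)]] unfolding a(1) using a(2) by auto
    moreover have "c x \<noteq> c z" using proper_neq[OF c s[OF uvw(2)] st(3,4) neq(2)] .
    moreover have "c x \<noteq> c y" using proper_neq[OF c s[OF uvw(3)] st(5,6) neq(1)] .
    ultimately show ?thesis using color_third_unique[of "c y" "c z" "c a" "c x"] by metis
  qed
  have "x \<in> \<Union>(star G ` verts G)" "a \<in> \<Union>(star G ` verts G)" unfolding Union_stars by fact+
  then have "x \<in> cls (star G ` verts G) c i \<longleftrightarrow> a \<in> cls (star G ` verts G) c i" if "proper (star G ` verts G) c" for c i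
    using same[OF that] unfolding cls_def by simp
  then have "canonical_map (line_graph G) x = canonical_map (line_graph G) a"
    unfolding set_eq_iff canonical_map_iff by metis
  moreover have "inj_on (canonical_map (line_graph G)) (edges G)"
    using assms unfolding edge_reflexive_def reflexive_def graph_isomorphism_def bij_betw_def
    by (simp add: line_graph_def)
  ultimately show False using \<open>x \<noteq> a\<close> en(1) \<open>a \<in> edges G\<close> unfolding inj_on_def by blast
qed

end

theorem theorem9:
  fixes G :: "('v, 'e) hgraph"
  assumes "cubic_graph G" and "connected_graph G" and "outerplanar G"
  shows "edge_reflexive G \<longleftrightarrow> triangle_free G"
proof
  interpret cubic G by unfold_locales (fact assms(1))
  show "triangle_free G" if "edge_reflexive G"
    using edge_reflexive_imp_triangle_free that .
  assume tri: "triangle_free G"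
  have "dictatorial (star G ` verts G)"
    by (rule dictatorial_graph[OF assms(2) tri outerplanar_theta_free[OF half_edge assms(3)]])
  moreover have "star G ` verts G \<noteq> {}" using assms(2) unfolding connected_graph_def by blast
  ultimately interpret dictatorial_claw_graph "star G ` verts G" "line_graph G"
    using claw_graph_line_graph by (intro dictatorial_claw_graph.intro dictatorial_claw_graph_axioms.intro)
  show "edge_reflexive G"
    using reflexive unfolding edge_reflexive_def three_edge_colorable_def reflexive_def by blast
qed

end
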